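(* Let $L/K$ be a finite separable extension of fields with Galois closure $E$, let $G=\mathrm{Gal}(E/K)$, $S=\mathrm{Gal}(E/L)$, and let $X=G/S$ be the set of left cosets. The additive operations $\star$ on $X$ under which $(G,X)$ is an almost classical skew bracoid are in bijective correspondence with the almost classical Hopf-Galois structures on $L/K$.
   Context: A skew bracoid $(G,\cdot,N,\star,\odot)$ consists of two groups $(G,\cdot)$ and $(N,\star)$ and a transitive action $\odot$ of $G$ on the set $N$ such that $g\odot(\eta_1\star\eta_2)=(g\odot\eta_1)\star(g\odot e_N)^{-1}\star(g\odot\eta_2)$ for all $g\in G$, $\eta_1,\eta_2\in N$. It is almost classical if there is a subgroup $H$ of $G$ that is a normal complement in $G$ to the stabiliser $\mathrm{Stab}_G(e_N)$ of the identity of $N$ (i.e. $H$ normal, $G=H\,\mathrm{Stab}_G(e_N)$, $H\cap\mathrm{Stab}_G(e_N)$ trivial) such that $(h_1\odot e_N)\star(h_2\odot e_N)=h_1h_2\odot e_N$ for all $h_1,h_2\in H$. Skew bracoids written $(G,X)$ with $X=G/S$ are understood as follows: $\star$ is a group operation on $X$ whose identity is the identity coset $eS$, and $G$ acts on $X$ by left translation of cosets; thus the stabiliser of the additive identity is $S$. Hopf-Galois structures on $L/K$ (considered up to isomorphism) correspond bijectively, by the theorem of Greither and Pareigis, to the regular subgroups $N$ of $\mathrm{Perm}(X)$ that are $G$-stable, i.e. normalised by $\lambda(G)$, where $\lambda:G\to\mathrm{Perm}(X)$ is left translation of cosets; the subgroup $N$ corresponds to the structure given by the Hopf algebra $E[N]^G$.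 A Hopf-Galois structure on $L/K$ is called almost classical if under this correspondence it corresponds to a subgroup of the form $\lambda(H)^{opp}:=\{\eta\in\mathrm{Perm}(X):\lambda(h)\eta=\eta\lambda(h)\text{ for all }h\in H\}$ for some normal complement $H$ of $S$ in $G$. *)

theory Defs
  imports "HOL-Algebra.Algebra" "HOL-Algebra.Left_Coset"
begin

section \<open>Skew bracoids\<close>

definition skew_bracoid ::
    "('g, 'm) monoid_scheme \<Rightarrow> ('n, 'k) monoid_scheme \<Rightarrow> ('g \<Rightarrow> 'n \<Rightarrow> 'n) \<Rightarrow> bool"
  where "skew_bracoid G N act \<longleftrightarrow>
    group G \<and> group N \<and> transitive_action G (carrier N) act \<and>
    (\<forall>g\<in>carrier G. \<forall>x\<in>carrier N. \<forall>y\<in>carrier N.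
      act g (x \<otimes>\<^bsub>N\<^esub> y) = act g x \<otimes>\<^bsub>N\<^esub> inv\<^bsub>N\<^esub> (act g \<one>\<^bsub>N\<^esub>) \<otimes>\<^bsub>N\<^esub> act g y)"

definition normal_complement :: "('g, 'm) monoid_scheme \<Rightarrow> 'g set \<Rightarrow> 'g set \<Rightarrow> bool"
  where "normal_complement G S H \<longleftrightarrow>
    H \<lhd> G \<and> H <#>\<^bsub>G\<^esub> S = carrier G \<and> H \<inter> S = {\<one>\<^bsub>G\<^esub>}"

definition almost_classical_bracoid ::
    "('g, 'm) monoid_scheme \<Rightarrow> ('n, 'k) monoid_scheme \<Rightarrow> ('g \<Rightarrow> 'n \<Rightarrow> 'n) \<Rightarrow> bool"
  where "almost_classical_bracoid G N act \<longleftrightarrow>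
    skew_bracoid G N act \<and>
    (\<exists>H. normal_complement G (stabilizer G act \<one>\<^bsub>N\<^esub>) H \<and>
      (\<forall>h\<^sub>1\<in>H. \<forall>h\<^sub>2\<in>H. act h\<^sub>1 \<one>\<^bsub>N\<^esub> \<otimes>\<^bsub>N\<^esub> act h\<^sub>2 \<one>\<^bsub>N\<^esub> = act (h\<^sub>1 \<otimes>\<^bsub>G\<^esub> h\<^sub>2) \<one>\<^bsub>N\<^esub>))"


section \<open>Galois groups and Galois closures\<close>

text \<open>Subfields \<open>K\<close>, \<open>L\<close> of a field \<open>E\<close> are subsets of its carrier; \<open>gal R K\<close> is the group of
  automorphisms of the field \<open>R\<close> over \<open>K\<close>, as extensional functions on the carrier.\<close>

definition gal :: "('a, 'm) ring_scheme \<Rightarrow> 'a set \<Rightarrow> ('a \<Rightarrow> 'a) monoid"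
  where "gal R K = (BijGroup (carrier R))
    \<lparr>carrier := {\<sigma> \<in> Bij (carrier R). \<sigma> \<in> ring_hom R R \<and> (\<forall>k\<in>K. \<sigma> k = k)}\<rparr>"

definition finite_galois :: "('a, 'm) ring_scheme \<Rightarrow> 'a set \<Rightarrow> bool"
  where "finite_galois R K \<longleftrightarrow>
    field R \<and> subfield K R \<and> ring.finite_dimension R K (carrier R) \<and>
    {x \<in> carrier R. \<forall>\<sigma>\<in>carrier (gal R K). \<sigma> x = x} = K"

text \<open>\<open>E\<close> is a minimal Galois extension of \<open>K\<close> containing \<open>L\<close>.\<close>

definition galois_closure :: "('a, 'm) ring_scheme \<Rightarrow> 'a set \<Rightarrow> 'a set \<Rightarrow> bool"
  where "galois_closure E K L \<longleftrightarrow>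
    finite_galois E K \<and> K \<subseteq> L \<and> L \<subseteq> carrier E \<and>
    (\<forall>F. subfield F E \<and> L \<subseteq> F \<and> finite_galois (E\<lparr>carrier := F\<rparr>) K \<longrightarrow> F = carrier E)"

text \<open>Minimal polynomials of elements of \<open>L\<close> have no multiple roots. The roots are looked for in
  \<open>E\<close>, so this is separability of \<open>L\<close> over \<open>K\<close> whenever \<open>E\<close> is normal over \<open>K\<close>, in
  particular if it is the Galois closure.\<close>

definition separable_in :: "('a, 'm) ring_scheme \<Rightarrow> 'a set \<Rightarrow> 'a set \<Rightarrow> bool"
  where "separable_in E K L \<longleftrightarrow>
    (\<forall>x\<in>L. \<forall>y\<in>carrier E. ring.alg_mult E (ring.Irr E K x) y \<le> 1)"


section \<open>The coset space\<close>

definition coset_space :: "('a, 'm) ring_scheme \<Rightarrow> 'a set \<Rightarrow> 'a set \<Rightarrow> ('a \<Rightarrow> 'a) set set"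
  where "coset_space E K L = lcosets\<^bsub>gal E K\<^esub> (carrier (gal E L))"

definition base_coset :: "('a, 'm) ring_scheme \<Rightarrow> 'a set \<Rightarrow> 'a set \<Rightarrow> ('a \<Rightarrow> 'a) set"
  where "base_coset E K L = \<one>\<^bsub>gal E K\<^esub> <#\<^bsub>gal E K\<^esub> carrier (gal E L)"

definition translation ::
    "('a, 'm) ring_scheme \<Rightarrow> 'a set \<Rightarrow> 'a set \<Rightarrow> ('a \<Rightarrow> 'a) \<Rightarrow> ('a \<Rightarrow> 'a) set \<Rightarrow> ('a \<Rightarrow> 'a) set"
  where "translation E K L g = (\<lambda>C\<in>coset_space E K L. g <#\<^bsub>gal E K\<^esub> C)"

abbreviation perm :: "('a, 'm) ring_scheme \<Rightarrow> 'a set \<Rightarrow> 'a set \<Rightarrow>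
    (('a \<Rightarrow> 'a) set \<Rightarrow> ('a \<Rightarrow> 'a) set) monoid"
  where "perm E K L \<equiv> BijGroup (coset_space E K L)"

definition almost_classical_operations ::
    "('a, 'm) ring_scheme \<Rightarrow> 'a set \<Rightarrow> 'a set \<Rightarrow>
      (('a \<Rightarrow> 'a) set \<Rightarrow> ('a \<Rightarrow> 'a) set \<Rightarrow> ('a \<Rightarrow> 'a) set) set"
  where "almost_classical_operations E K L =
    {star \<in> coset_space E K L \<rightarrow>\<^sub>E (coset_space E K L \<rightarrow>\<^sub>E coset_space E K L).
      almost_classical_bracoid (gal E K)
        \<lparr>carrier = coset_space E K L, monoid.mult = star, one = base_coset E K L\<rparr>
        (translation E K L)}"


section \<open>Linear maps and tensor products over a field\<close>

definition linear_maps ::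
    "('k, 'r) ring_scheme \<Rightarrow> ('k, 'm, 's) module_scheme \<Rightarrow> ('k, 'n, 't) module_scheme \<Rightarrow> ('m \<Rightarrow> 'n) set"
  where "linear_maps F M N = {f \<in> carrier M \<rightarrow> carrier N.
    (\<forall>x\<in>carrier M. \<forall>y\<in>carrier M. f (x \<oplus>\<^bsub>M\<^esub> y) = f x \<oplus>\<^bsub>N\<^esub> f y) \<and>
    (\<forall>a\<in>carrier F. \<forall>x\<in>carrier M. f (a \<odot>\<^bsub>M\<^esub> x) = a \<odot>\<^bsub>N\<^esub> f x)}"

definition bilinear_maps ::
    "('k, 'r) ring_scheme \<Rightarrow> ('k, 'm, 's) module_scheme \<Rightarrow> ('k, 'n, 't) module_scheme \<Rightarrow>
      ('k, 'p, 'u) module_scheme \<Rightarrow> ('m \<Rightarrow> 'n \<Rightarrow> 'p) set"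
  where "bilinear_maps F M N P = {f.
    (\<forall>x\<in>carrier M. f x \<in> linear_maps F N P) \<and>
    (\<forall>y\<in>carrier N. (\<lambda>x. f x y) \<in> linear_maps F M P)}"

definition trilinear_maps ::
    "('k, 'r) ring_scheme \<Rightarrow> ('k, 'm, 's) module_scheme \<Rightarrow> ('k, 'n, 't) module_scheme \<Rightarrow>
      ('k, 'p, 'u) module_scheme \<Rightarrow> ('k, 'q, 'v) module_scheme \<Rightarrow> ('m \<Rightarrow> 'n \<Rightarrow> 'p \<Rightarrow> 'q) set"
  where "trilinear_maps F M N P Q = {f.
    (\<forall>x\<in>carrier M. f x \<in> bilinear_maps F N P Q) \<and>
    (\<forall>y\<in>carrier N. \<forall>z\<in>carrier P. (\<lambda>x. f x y z) \<in> linear_maps F M Q)}"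

definition self_module :: "('a, 'm) ring_scheme \<Rightarrow> ('a, 'a) module"
  where "self_module R =
    \<lparr>carrier = carrier R, monoid.mult = monoid.mult R, one = \<one>\<^bsub>R\<^esub>, ring.zero = \<zero>\<^bsub>R\<^esub>,
     add = add R, smult = monoid.mult R\<rparr>"

definition lsum :: "('b, 'm) ring_scheme \<Rightarrow> ('c \<Rightarrow> 'b) \<Rightarrow> 'c list \<Rightarrow> 'b"
  where "lsum M f s = foldr (\<lambda>c r. f c \<oplus>\<^bsub>M\<^esub> r) s \<zero>\<^bsub>M\<^esub>"

text \<open>The list \<open>[(x\<^sub>1, y\<^sub>1), \<dots>]\<close> stands for the formal sum of the \<open>x\<^sub>i \<otimes> y\<^sub>i\<close>. Over a field, two formal
  sums represent the same tensor iff all bilinear forms agree on them (the tensor product embeds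
  into the dual of the space of bilinear forms). A tensor is an equivalence class of formal sums,
  so that \<open>s \<in> t\<close> reads: \<open>s\<close> is an expression of the tensor \<open>t\<close> as a sum of pure tensors.\<close>

definition tensor_eq ::
    "('k, 'r) ring_scheme \<Rightarrow> ('k, 'm, 's) module_scheme \<Rightarrow> ('k, 'n, 't) module_scheme \<Rightarrow>
      ('m \<times> 'n) list \<Rightarrow> ('m \<times> 'n) list \<Rightarrow> bool"
  where "tensor_eq F M N s t \<longleftrightarrow>
    (\<forall>\<beta>\<in>bilinear_maps F M N (self_module F).
      lsum F (\<lambda>(x, y). \<beta> x y) s = lsum F (\<lambda>(x, y). \<beta> x y) t)"

definition tensor_eq3 ::
    "('k, 'r) ring_scheme \<Rightarrow> ('k, 'm, 's) module_scheme \<Rightarrow> ('k, 'n, 't) module_scheme \<Rightarrow>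
      ('k, 'p, 'u) module_scheme \<Rightarrow> ('m \<times> 'n \<times> 'p) list \<Rightarrow> ('m \<times> 'n \<times> 'p) list \<Rightarrow> bool"
  where "tensor_eq3 F M N P s t \<longleftrightarrow>
    (\<forall>\<gamma>\<in>trilinear_maps F M N P (self_module F).
      lsum F (\<lambda>(x, y, z). \<gamma> x y z) s = lsum F (\<lambda>(x, y, z). \<gamma> x y z) t)"

definition tensor_product ::
    "('k, 'r) ring_scheme \<Rightarrow> ('k, 'm, 's) module_scheme \<Rightarrow> ('k, 'n, 't) module_scheme \<Rightarrow>
      ('m \<times> 'n) list set set"
  where "tensor_product F M N = lists (carrier M \<times> carrier N) //
    {(s, t). s \<in> lists (carrier M \<times> carrier N) \<and> t \<in> lists (carrier M \<times> carrier N) \<and>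
      tensor_eq F M N s t}"


section \<open>Hopf algebras\<close>

record ('a, 'b) bialg = "('a, 'b) module" +
  comult :: "'b \<Rightarrow> ('b \<times> 'b) list set"
  counit :: "'b \<Rightarrow> 'a"

definition unital_algebra :: "('k, 'r) ring_scheme \<Rightarrow> ('k, 'b, 's) module_scheme \<Rightarrow> bool"
  where "unital_algebra F A \<longleftrightarrow> module F A \<and> ring A \<and>
    (\<forall>a\<in>carrier F. \<forall>x\<in>carrier A. \<forall>y\<in>carrier A.
      (a \<odot>\<^bsub>A\<^esub> x) \<otimes>\<^bsub>A\<^esub> y = a \<odot>\<^bsub>A\<^esub> (x \<otimes>\<^bsub>A\<^esub> y) \<and> x \<otimes>\<^bsub>A\<^esub> (a \<odot>\<^bsub>A\<^esub> y) = a \<odot>\<^bsub>A\<^esub> (x \<otimes>\<^bsub>A\<^esub> y))"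

text \<open>The first three conditions say that the comultiplication is a linear map into the tensor
  square. In the coassociativity condition, \<open>d\<close> chooses a representative of each coproduct.\<close>

definition coalgebra :: "('k, 'r) ring_scheme \<Rightarrow> ('k, 'b, 's) bialg_scheme \<Rightarrow> bool"
  where "coalgebra F A \<longleftrightarrow>
    comult A \<in> carrier A \<rightarrow> tensor_product F A A \<and>
    (\<forall>x\<in>carrier A. \<forall>y\<in>carrier A. \<forall>s\<in>comult A x. \<forall>t\<in>comult A y. s @ t \<in> comult A (x \<oplus>\<^bsub>A\<^esub> y)) \<and>
    (\<forall>a\<in>carrier F. \<forall>x\<in>carrier A. \<forall>s\<in>comult A x.
      [(a \<odot>\<^bsub>A\<^esub> u, v). (u, v) \<leftarrow> s] \<in> comult A (a \<odot>\<^bsub>A\<^esub> x)) \<and>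
    counit A \<in> linear_maps F A (self_module F) \<and>
    (\<forall>d. (\<forall>x\<in>carrier A. d x \<in> comult A x) \<longrightarrow>
      (\<forall>x\<in>carrier A. tensor_eq3 F A A A
        [(p, q, v). (u, v) \<leftarrow> d x, (p, q) \<leftarrow> d u] [(u, p, q). (u, v) \<leftarrow> d x, (p, q) \<leftarrow> d v])) \<and>
    (\<forall>x\<in>carrier A. \<forall>s\<in>comult A x.
      lsum A (\<lambda>(u, v). counit A u \<odot>\<^bsub>A\<^esub> v) s = x \<and> lsum A (\<lambda>(u, v). counit A v \<odot>\<^bsub>A\<^esub> u) s = x)"

definition bialgebra :: "('k, 'r) ring_scheme \<Rightarrow> ('k, 'b, 's) bialg_scheme \<Rightarrow> bool"
  where "bialgebra F A \<longleftrightarrow>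
    unital_algebra F A \<and> coalgebra F A \<and>
    [(\<one>\<^bsub>A\<^esub>, \<one>\<^bsub>A\<^esub>)] \<in> comult A \<one>\<^bsub>A\<^esub> \<and>
    (\<forall>x\<in>carrier A. \<forall>y\<in>carrier A. \<forall>s\<in>comult A x. \<forall>t\<in>comult A y.
      [(u \<otimes>\<^bsub>A\<^esub> p, v \<otimes>\<^bsub>A\<^esub> q). (u, v) \<leftarrow> s, (p, q) \<leftarrow> t] \<in> comult A (x \<otimes>\<^bsub>A\<^esub> y)) \<and>
    counit A \<one>\<^bsub>A\<^esub> = \<one>\<^bsub>F\<^esub> \<and>
    (\<forall>x\<in>carrier A. \<forall>y\<in>carrier A. counit A (x \<otimes>\<^bsub>A\<^esub> y) = counit A x \<otimes>\<^bsub>F\<^esub> counit A y)"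

text \<open>An antipode is unique if it exists and is preserved by bialgebra isomorphisms; it is therefore
  not part of the data.\<close>

definition hopf_algebra :: "('k, 'r) ring_scheme \<Rightarrow> ('k, 'b, 's) bialg_scheme \<Rightarrow> bool"
  where "hopf_algebra F A \<longleftrightarrow>
    bialgebra F A \<and>
    (\<exists>T\<in>linear_maps F A A. \<forall>x\<in>carrier A. \<forall>s\<in>comult A x.
      lsum A (\<lambda>(u, v). T u \<otimes>\<^bsub>A\<^esub> v) s = counit A x \<odot>\<^bsub>A\<^esub> \<one>\<^bsub>A\<^esub> \<and>
      lsum A (\<lambda>(u, v). u \<otimes>\<^bsub>A\<^esub> T v) s = counit A x \<odot>\<^bsub>A\<^esub> \<one>\<^bsub>A\<^esub>)"


section \<open>Hopf-Galois structures\<close>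

record ('a, 'b) hopf_galois = "('a, 'b) bialg" +
  action :: "'b \<Rightarrow> 'a \<Rightarrow> 'a"

text \<open>\<open>A\<close> is a Hopf algebra over \<open>K\<close>, \<open>L\<close> is an \<open>A\<close>-module algebra, and the map \<open>j\<close> from
  \<open>L \<otimes>\<^sub>K A\<close> to the \<open>K\<close>-linear endomorphisms of \<open>L\<close>, \<open>j (l \<otimes> a) (x) = l (a \<cdot> x)\<close>, is bijective (the
  last two conditions). Finite-dimensionality (and cocommutativity) of \<open>A\<close> are consequences.\<close>

definition hopf_galois_structure ::
    "('a, 'm) ring_scheme \<Rightarrow> 'a set \<Rightarrow> 'a set \<Rightarrow> ('a, 'b) hopf_galois \<Rightarrow> bool"
  where "hopf_galois_structure E K L A \<longleftrightarrow>
    (let F = E\<lparr>carrier := K\<rparr>;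
         M = (self_module E)\<lparr>carrier := L\<rparr>;
         j = (\<lambda>s x. lsum E (\<lambda>(l, a). l \<otimes>\<^bsub>E\<^esub> action A a x) s)
     in hopf_algebra F A \<and>
        action A \<in> bilinear_maps F A M M \<and>
        (\<forall>x\<in>L. action A \<one>\<^bsub>A\<^esub> x = x) \<and>
        (\<forall>a\<in>carrier A. \<forall>b\<in>carrier A. \<forall>x\<in>L. action A (a \<otimes>\<^bsub>A\<^esub> b) x = action A a (action A b x)) \<and>
        (\<forall>a\<in>carrier A. action A a \<one>\<^bsub>E\<^esub> = counit A a) \<and>
        (\<forall>a\<in>carrier A. \<forall>s\<in>comult A a. \<forall>x\<in>L. \<forall>y\<in>L.
          action A a (x \<otimes>\<^bsub>E\<^esub> y) = lsum E (\<lambda>(u, v). action A u x \<otimes>\<^bsub>E\<^esub> action A v y) s) \<and>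
        (\<forall>s\<in>lists (L \<times> carrier A). \<forall>t\<in>lists (L \<times> carrier A).
          (\<forall>x\<in>L. j s x = j t x) \<longrightarrow> tensor_eq F M A s t) \<and>
        (\<forall>f\<in>linear_maps F M M. \<exists>s\<in>lists (L \<times> carrier A). \<forall>x\<in>L. f x = j s x))"

definition hopf_galois_isomorphic ::
    "('a, 'm) ring_scheme \<Rightarrow> 'a set \<Rightarrow> 'a set \<Rightarrow> ('a, 'b) hopf_galois \<Rightarrow> ('a, 'c) hopf_galois \<Rightarrow> bool"
  where "hopf_galois_isomorphic E K L A B \<longleftrightarrow>
    (\<exists>\<psi>. \<psi> \<in> ring_iso A B \<and> \<psi> \<in> linear_maps (E\<lparr>carrier := K\<rparr>) A B \<and>
      (\<forall>a\<in>carrier A. \<forall>s\<in>comult A a. map (map_prod \<psi> \<psi>) s \<in> comult B (\<psi> a)) \<and>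
      (\<forall>a\<in>carrier A. counit B (\<psi> a) = counit A a) \<and>
      (\<forall>a\<in>carrier A. \<forall>x\<in>L. action B (\<psi> a) x = action A a x))"


section \<open>The Greither-Pareigis correspondence\<close>

definition regular_stable_subgroup ::
    "('a, 'm) ring_scheme \<Rightarrow> 'a set \<Rightarrow> 'a set \<Rightarrow> (('a \<Rightarrow> 'a) set \<Rightarrow> ('a \<Rightarrow> 'a) set) set \<Rightarrow> bool"
  where "regular_stable_subgroup E K L N \<longleftrightarrow>
    subgroup N (perm E K L) \<and>
    (\<forall>C\<in>coset_space E K L. \<forall>D\<in>coset_space E K L. \<exists>!n. n \<in> N \<and> n C = D) \<and>
    (\<forall>g\<in>carrier (gal E K). \<forall>n\<in>N.
      translation E K L g \<otimes>\<^bsub>perm E K L\<^esub> n \<otimes>\<^bsub>perm E K L\<^esub> inv\<^bsub>perm E K L\<^esub> (translation E K L g) \<in> N)"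

text \<open>All elements of a coset of the Galois group of \<open>E\<close> over \<open>L\<close> take the same value at \<open>x \<in> L\<close>.\<close>

definition coset_apply :: "('a \<Rightarrow> 'a) set \<Rightarrow> 'a \<Rightarrow> 'a"
  where "coset_apply C x = (THE y. \<exists>g\<in>C. y = g x)"

text \<open>The elements of the group algebra \<open>E[N]\<close> are functions from \<open>N\<close> to \<open>E\<close>, and \<open>E[N]\<^sup>G\<close> consists
  of the fixed points of the Galois group of \<open>E\<close> over \<open>K\<close>, which acts on coefficients and, through
  conjugation by \<open>translation\<close>, on \<open>N\<close>. The element with coefficients \<open>a n\<close> acts on \<open>x \<in> L\<close> by
  \<open>\<Sum>n. a n \<cdot> (n\<^sup>-\<^sup>1 (base_coset)) (x)\<close>. The comultiplication is that of \<open>E[N]\<close>, \<open>n \<mapsto> n \<otimes> n\<close>: a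
  formal sum of elements of \<open>E[N]\<^sup>G\<close> represents the coproduct of \<open>a\<close> iff its image in
  \<open>E[N] \<otimes>\<^sub>E E[N]\<close>, which has basis \<open>m \<otimes> n\<close>, is \<open>\<Sum>n. a n \<cdot> (n \<otimes> n)\<close>.\<close>

definition fixed_group_algebra ::
    "('a, 'm) ring_scheme \<Rightarrow> 'a set \<Rightarrow> 'a set \<Rightarrow> (('a \<Rightarrow> 'a) set \<Rightarrow> ('a \<Rightarrow> 'a) set) set \<Rightarrow>
      ((('a \<Rightarrow> 'a) set \<Rightarrow> ('a \<Rightarrow> 'a) set) \<Rightarrow> 'a) set"
  where "fixed_group_algebra E K L N = {a \<in> N \<rightarrow>\<^sub>E carrier E.
    \<forall>g\<in>carrier (gal E K). \<forall>n\<in>N.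
      a (translation E K L g \<otimes>\<^bsub>perm E K L\<^esub> n \<otimes>\<^bsub>perm E K L\<^esub> inv\<^bsub>perm E K L\<^esub> (translation E K L g)) =
      g (a n)}"

definition greither_pareigis ::
    "('a, 'm) ring_scheme \<Rightarrow> 'a set \<Rightarrow> 'a set \<Rightarrow> (('a \<Rightarrow> 'a) set \<Rightarrow> ('a \<Rightarrow> 'a) set) set \<Rightarrow>
      ('a, (('a \<Rightarrow> 'a) set \<Rightarrow> ('a \<Rightarrow> 'a) set) \<Rightarrow> 'a) hopf_galois"
  where "greither_pareigis E K L N =
    \<lparr>carrier = fixed_group_algebra E K L N,
     monoid.mult = (\<lambda>a b. \<lambda>n\<in>N. \<Oplus>\<^bsub>E\<^esub>m\<in>N. a m \<otimes>\<^bsub>E\<^esub> b (inv\<^bsub>perm E K L\<^esub> m \<otimes>\<^bsub>perm E K L\<^esub> n)),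
     one = (\<lambda>n\<in>N. if n = \<one>\<^bsub>perm E K L\<^esub> then \<one>\<^bsub>E\<^esub> else \<zero>\<^bsub>E\<^esub>),
     ring.zero = (\<lambda>n\<in>N. \<zero>\<^bsub>E\<^esub>),
     add = (\<lambda>a b. \<lambda>n\<in>N. a n \<oplus>\<^bsub>E\<^esub> b n),
     smult = (\<lambda>k a. \<lambda>n\<in>N. k \<otimes>\<^bsub>E\<^esub> a n),
     comult = (\<lambda>a. {s \<in> lists (fixed_group_algebra E K L N \<times> fixed_group_algebra E K L N).
       \<forall>m\<in>N. \<forall>n\<in>N. lsum E (\<lambda>(u, v). u m \<otimes>\<^bsub>E\<^esub> v n) s = (if m = n then a n else \<zero>\<^bsub>E\<^esub>)}),
     counit = (\<lambda>a. \<Oplus>\<^bsub>E\<^esub>n\<in>N. a n),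
     action = (\<lambda>a x. \<Oplus>\<^bsub>E\<^esub>n\<in>N.
       a n \<otimes>\<^bsub>E\<^esub> coset_apply ((inv\<^bsub>perm E K L\<^esub> n) (base_coset E K L)) x)\<rparr>"

definition lambda_opp ::
    "('a, 'm) ring_scheme \<Rightarrow> 'a set \<Rightarrow> 'a set \<Rightarrow> ('a \<Rightarrow> 'a) set \<Rightarrow>
      (('a \<Rightarrow> 'a) set \<Rightarrow> ('a \<Rightarrow> 'a) set) set"
  where "lambda_opp E K L H = {\<eta> \<in> carrier (perm E K L).
    \<forall>h\<in>H. translation E K L h \<otimes>\<^bsub>perm E K L\<^esub> \<eta> = \<eta> \<otimes>\<^bsub>perm E K L\<^esub> translation E K L h}"

text \<open>Structures of all isomorphism types occur on the chosen type of carriers: a Hopf-Galois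
  structure has dimension \<open>[L : K] = |X|\<close> over \<open>K\<close>, where \<open>X\<close> is the coset space, and the functions
  from permutations of \<open>X\<close> to \<open>E\<close> contain a copy of every such \<open>K\<close>-space.\<close>

type_synonym 'a hg_structure =
  "('a, (('a \<Rightarrow> 'a) set \<Rightarrow> ('a \<Rightarrow> 'a) set) \<Rightarrow> 'a) hopf_galois"

definition almost_classical_hopf_galois ::
    "('a, 'm) ring_scheme \<Rightarrow> 'a set \<Rightarrow> 'a set \<Rightarrow> 'a hg_structure set"
  where "almost_classical_hopf_galois E K L = {A. hopf_galois_structure E K L A \<and>
    (\<exists>N H. regular_stable_subgroup E K L N \<and>
      hopf_galois_isomorphic E K L A (greither_pareigis E K L N) \<and>
      normal_complement (gal E K) (carrier (gal E L)) H \<and> N = lambda_opp E K L H)}"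

definition iso_rel ::
    "('a, 'm) ring_scheme \<Rightarrow> 'a set \<Rightarrow> 'a set \<Rightarrow> ('a hg_structure \<times> 'a hg_structure) set"
  where "iso_rel E K L = {(A, B). hopf_galois_structure E K L A \<and> hopf_galois_structure E K L B \<and>
    hopf_galois_isomorphic E K L A B}"

end

theory Submission
  imports Defs
begin

text \<open>
  Let \<open>G\<close> be the Galois group of \<open>E\<close> over \<open>K\<close>, let \<open>S\<close> be that of \<open>E\<close> over \<open>L\<close>, and let \<open>\<lambda>\<close> be left
  translation on the coset space \<open>X = G/S\<close>. Both sides of the correspondence are compared with
  regular subgroups of \<open>Perm(X)\<close>.

  An operation on \<open>X\<close> is the same thing as the family of its right multiplications. For a skew
  bracoid these form a regular subgroup \<open>N\<close>, and the bracoid law computes the conjugate of a right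
  multiplication by \<open>\<lambda>(g)\<close> as another right multiplication
  (\<open>right_translations_regular_stable\<close>). Conversely, a regular \<open>G\<close>-stable \<open>N\<close> gives the operation
  \<open>x \<star> y = n x\<close>, where \<open>n\<close> is the element of \<open>N\<close> that takes the base coset to \<open>y\<close>
  (\<open>skew_bracoid_operation\<close>). If the operation is almost classical by means of \<open>H\<close>, then \<open>\<lambda>(h)\<close> is
  left multiplication by \<open>hS\<close> for \<open>h \<in> H\<close>, and these are all the left multiplications. The
  permutations that commute with all left multiplications are the right multiplications, so
  \<open>N = \<lambda>(H)\<^sup>o\<^sup>p\<^sup>p\<close> (\<open>right_translations_eq_lambda_opp\<close>); conversely, \<open>N = \<lambda>(H)\<^sup>o\<^sup>p\<^sup>p\<close> makes the operation
  almost classical (\<open>operation_almost_classical\<close>). Since the base coset is the identity, an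
  operation is determined by the set of its right multiplications (\<open>right_translation_inject\<close>).

  An almost classical Hopf-Galois structure is by definition isomorphic to \<open>E[N]\<^sup>G\<close> for such an \<open>N\<close>.
  It remains to see that every \<open>E[N]\<^sup>G\<close> is a Hopf-Galois structure (\<open>hopf_galois_structure_gp\<close>) and
  that \<open>N\<close> can be recovered from its isomorphism class (\<open>greither_pareigis_inject\<close>).

  The algebra rests on a form of Galois descent in which no bases occur. There are finitely many
  pairs \<open>(d\<^sub>i, e\<^sub>i)\<close> of elements of \<open>E\<close> such that \<open>\<Sum>\<^sub>i d\<^sub>i \<cdot> g e\<^sub>i\<close> is \<open>\<one>\<close> for \<open>g = \<one>\<close> and \<open>\<zero>\<close> for all other
  elements \<open>g\<close> of \<open>G\<close> (\<open>exists_galois_coordinates\<close>). They give the independence of automorphisms;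
  they show that \<open>G\<close>-equivariant functions from a finite \<open>G\<close>-set to \<open>E\<close> span all functions
  (\<open>equivariant_maps_span\<close>), and that equivariant functions on a product of two \<open>G\<close>-sets are sums of
  products (\<open>equivariant_maps_product\<close>). Both \<open>E[N]\<^sup>G\<close> and \<open>L\<close> are spaces of equivariant functions: on
  \<open>N\<close>, where \<open>G\<close> acts by conjugation, and on \<open>X\<close>, since \<open>L\<close> is the fixed field of \<open>S\<close>
  (\<open>fixed_points_S\<close>). Hence functions on \<open>N \<times> N\<close> and on \<open>X \<times> N\<close> describe tensors: equality of tensors
  is equality of values (\<open>tensor_eqI\<close>), and equivariance is enough for a function to come from a
  tensor. This yields coproducts and the bijectivity of the map from \<open>L \<otimes> E[N]\<^sup>G\<close> to the
  endomorphisms of \<open>L\<close>.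
\<close>

section \<open>Sums over lists and finite sets\<close>

lemma lsum_Nil [simp]: "lsum M f [] = \<zero>\<^bsub>M\<^esub>"
  and lsum_Cons [simp]: "lsum M f (x # s) = f x \<oplus>\<^bsub>M\<^esub> lsum M f s"
  by (simp_all add: lsum_def)

lemma lsum_cong: "(\<And>x. x \<in> set s \<Longrightarrow> f x = g x) \<Longrightarrow> lsum M f s = lsum M g s"
  by (induction s) auto

lemma lsum_map: "lsum M f (map h s) = lsum M (\<lambda>x. f (h x)) s"
  by (induction s) auto

lemma lsum_carrier_update [simp]: "lsum (M\<lparr>carrier := C\<rparr>) f s = lsum M f s"
  by (induction s) auto

context abelian_monoid
begin

lemma lsum_closed [intro, simp]:
  "(\<And>x. x \<in> set s \<Longrightarrow> f x \<in> carrier G) \<Longrightarrow> lsum G f s \<in> carrier G"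
  by (induction s) auto

lemma lsum_append:
  "(\<And>x. x \<in> set s \<union> set t \<Longrightarrow> f x \<in> carrier G) \<Longrightarrow>
    lsum G f (s @ t) = lsum G f s \<oplus> lsum G f t"
  by (induction s) (auto simp: a_assoc)

lemma lsum_concat_map:
  "(\<And>x y. x \<in> set s \<Longrightarrow> y \<in> set (h x) \<Longrightarrow> f y \<in> carrier G) \<Longrightarrow>
    lsum G f (concat (map h s)) = lsum G (\<lambda>x. lsum G f (h x)) s"
proof (induction s)
  case (Cons x s)
  have "lsum G f (concat (map h s)) = lsum G (\<lambda>x. lsum G f (h x)) s"
    using Cons by (intro Cons.IH) auto
  with Cons.prems show ?case
    by (subst list.map, subst concat.simps, subst lsum_append) auto
qed simp

lemma lsum_zero [simp]: "lsum G (\<lambda>_. \<zero>) s = \<zero>"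
  by (induction s) auto

lemma lsum_add:
  "(\<And>x. x \<in> set s \<Longrightarrow> f x \<in> carrier G) \<Longrightarrow> (\<And>x. x \<in> set s \<Longrightarrow> g x \<in> carrier G) \<Longrightarrow>
    lsum G (\<lambda>x. f x \<oplus> g x) s = lsum G f s \<oplus> lsum G g s"
  by (induction s) (auto simp: a_ac)

lemma lsum_finsum:
  assumes "\<And>x y. x \<in> set s \<Longrightarrow> y \<in> Y \<Longrightarrow> f x y \<in> carrier G"
  shows "lsum G (\<lambda>x. \<Oplus>y\<in>Y. f x y) s = (\<Oplus>y\<in>Y. lsum G (\<lambda>x. f x y) s)"
  using assms by (induction s) (auto simp: finsum_addf Pi_def)

lemma finsum_swap:
  assumes "finite A" "finite B" "\<And>x y. x \<in> A \<Longrightarrow> y \<in> B \<Longrightarrow> f x y \<in> carrier G"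
  shows "(\<Oplus>x\<in>A. \<Oplus>y\<in>B. f x y) = (\<Oplus>y\<in>B. \<Oplus>x\<in>A. f x y)"
  using assms
proof (induction A rule: finite_induct)
  case (insert x A)
  have "(\<Oplus>y\<in>B. \<Oplus>z\<in>insert x A. f z y) = (\<Oplus>y\<in>B. f x y \<oplus> (\<Oplus>z\<in>A. f z y))"
    using insert by (intro finsum_cong' refl) (auto intro!: finsum_closed)
  with insert show ?case
    by (auto simp: finsum_addf Pi_def)
qed auto

lemma finsum_delta:
  assumes "finite Y" "y \<in> Y" "f y \<in> carrier G"
  shows "(\<Oplus>z\<in>Y. if z = y then f z else \<zero>) = f y"
proof -
  have "(\<Oplus>z\<in>Y. if z = y then f z else \<zero>) = (\<Oplus>z\<in>Y. if z = y then f y else \<zero>)"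
    using assms(3) by (intro finsum_cong') auto
  also have "\<dots> = f y"
    using add.finprod_singleton_swap[OF assms(2,1), of "\<lambda>_. f y"] assms(3) by auto
  finally show ?thesis .
qed

lemma finsum_reindex_bij:
  assumes "bij_betw h A B" "\<And>x. x \<in> B \<Longrightarrow> f x \<in> carrier G"
  shows "(\<Oplus>x\<in>A. f (h x)) = (\<Oplus>x\<in>B. f x)"
  using assms finsum_reindex[of f h A] unfolding bij_betw_def by auto

end

context semiring
begin

lemma lsum_ldistr:
  "a \<in> carrier R \<Longrightarrow> (\<And>x. x \<in> set s \<Longrightarrow> f x \<in> carrier R) \<Longrightarrow>
    lsum R f s \<otimes> a = lsum R (\<lambda>x. f x \<otimes> a) s"
  by (induction s) (auto simp: l_distr)

lemma lsum_rdistr: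
  "a \<in> carrier R \<Longrightarrow> (\<And>x. x \<in> set s \<Longrightarrow> f x \<in> carrier R) \<Longrightarrow>
    a \<otimes> lsum R f s = lsum R (\<lambda>x. a \<otimes> f x) s"
  by (induction s) (auto simp: r_distr)

lemma finsum_ldistr_cong:
  assumes "finite Y" "a \<in> carrier R" "\<And>y. y \<in> Y \<Longrightarrow> f y \<in> carrier R"
    and "\<And>y. y \<in> Y \<Longrightarrow> f y \<otimes> a = g y"
  shows "(\<Oplus>y\<in>Y. f y) \<otimes> a = (\<Oplus>y\<in>Y. g y)"
proof -
  have "(\<Oplus>y\<in>Y. f y) \<otimes> a = (\<Oplus>y\<in>Y. f y \<otimes> a)"
    using assms(1-3) by (intro finsum_ldistr) auto
  also have "\<dots> = (\<Oplus>y\<in>Y. g y)"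
    by (intro finsum_cong' refl) (auto simp: assms(2-3) assms(4)[symmetric])
  finally show ?thesis .
qed

lemma finsum_rdistr_cong:
  assumes "finite Y" "a \<in> carrier R" "\<And>y. y \<in> Y \<Longrightarrow> f y \<in> carrier R"
    and "\<And>y. y \<in> Y \<Longrightarrow> a \<otimes> f y = g y"
  shows "a \<otimes> (\<Oplus>y\<in>Y. f y) = (\<Oplus>y\<in>Y. g y)"
proof -
  have "a \<otimes> (\<Oplus>y\<in>Y. f y) = (\<Oplus>y\<in>Y. a \<otimes> f y)"
    using assms(1-3) by (intro finsum_rdistr) auto
  also have "\<dots> = (\<Oplus>y\<in>Y. g y)"
    by (intro finsum_cong' refl) (auto simp: assms(2-3) assms(4)[symmetric])
  finally show ?thesis .
qed

end

lemma lsum_additive: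
  assumes "abelian_monoid M" "\<And>x. x \<in> set s \<Longrightarrow> f x \<in> carrier M"
    and "\<phi> \<zero>\<^bsub>M\<^esub> = \<zero>\<^bsub>N\<^esub>"
    and "\<And>x y. x \<in> carrier M \<Longrightarrow> y \<in> carrier M \<Longrightarrow> \<phi> (x \<oplus>\<^bsub>M\<^esub> y) = \<phi> x \<oplus>\<^bsub>N\<^esub> \<phi> y"
  shows "\<phi> (lsum M f s) = lsum N (\<lambda>x. \<phi> (f x)) s"
proof -
  interpret abelian_monoid M by fact
  show ?thesis using assms(2-4) by (induction s) auto
qed

section \<open>Galois groups\<close>

lemma gal_memD:
  assumes "g \<in> carrier (gal E K)"
  shows "g \<in> Bij (carrier E)" "g \<in> ring_hom E E" "\<And>k. k \<in> K \<Longrightarrow> g k = k"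
  using assms by (auto simp: gal_def)

context field
begin

lemma subgroup_gal_BijGroup:
  assumes "K \<subseteq> carrier R"
  shows "subgroup (carrier (gal R K)) (BijGroup (carrier R))"
proof -
  interpret B: group "BijGroup (carrier R)" by (rule group_BijGroup)
  show ?thesis
  proof (rule B.subgroupI)
    show "carrier (gal R K) \<subseteq> carrier (BijGroup (carrier R))"
      by (auto simp: gal_def BijGroup_def)
    have "(\<lambda>x\<in>carrier R. x) \<in> carrier (gal R K)"
      using assms by (auto simp: gal_def id_Bij intro!: ring_hom_memI)
    then show "carrier (gal R K) \<noteq> {}" by blast
  next
    fix g assume g: "g \<in> carrier (gal R K)"
    note gD = gal_memD[OF g]
    have bij: "bij_betw g (carrier R) (carrier R)"
      using gD(1) by (auto simp: Bij_def)
    let ?i = "inv_into (carrier R) g"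
    have i: "?i y \<in> carrier R" "g (?i y) = y" if "y \<in> carrier R" for y
      using that bij by (auto simp: bij_betw_def inv_into_into f_inv_into_f)
    have eqI: "?i y = x" if "x \<in> carrier R" "g x = y" for x y
      using that bij by (auto simp: bij_betw_def)
    have "restrict ?i (carrier R) \<in>
        {\<sigma> \<in> Bij (carrier R). \<sigma> \<in> ring_hom R R \<and> (\<forall>k\<in>K. \<sigma> k = k)}"
    proof (intro CollectI conjI ballI)
      show "restrict ?i (carrier R) \<in> Bij (carrier R)"
        using gD(1) by (rule restrict_inv_into_Bij)
      show "restrict ?i (carrier R) \<in> ring_hom R R"
        using i gD(2) by (intro ring_hom_memI)
          (auto intro!: eqI simp: ring_hom_mult ring_hom_add ring_hom_one)
      show "restrict ?i (carrier R) k = k" if "k \<in> K" for k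
        using eqI[of k k] gD(3)[OF that] assms that by (simp add: subset_iff)
    qed
    then show "inv\<^bsub>BijGroup (carrier R)\<^esub> g \<in> carrier (gal R K)"
      using gD(1) by (simp add: inv_BijGroup gal_def)
  next
    fix g h assume g: "g \<in> carrier (gal R K)" and h: "h \<in> carrier (gal R K)"
    note gD = gal_memD[OF g] and hD = gal_memD[OF h]
    have "compose (carrier R) g h \<in>
        {\<sigma> \<in> Bij (carrier R). \<sigma> \<in> ring_hom R R \<and> (\<forall>k\<in>K. \<sigma> k = k)}"
    proof (intro CollectI conjI ballI)
      show "compose (carrier R) g h \<in> Bij (carrier R)"
        using gD(1) hD(1) by (rule compose_Bij)
      show "compose (carrier R) g h \<in> ring_hom R R"
        using ring_hom_closed[OF gD(2)] ring_hom_closed[OF hD(2)]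
        by (intro ring_hom_memI)
          (simp_all add: compose_def ring_hom_mult[OF gD(2)] ring_hom_mult[OF hD(2)]
            ring_hom_add[OF gD(2)] ring_hom_add[OF hD(2)] ring_hom_one[OF gD(2)] ring_hom_one[OF hD(2)])
      show "compose (carrier R) g h k = k" if "k \<in> K" for k
        using gD(3)[OF that] hD(3)[OF that] assms that by (simp add: compose_def subset_iff)
    qed
    then show "g \<otimes>\<^bsub>BijGroup (carrier R)\<^esub> h \<in> carrier (gal R K)"
      using gD(1) hD(1) by (simp add: BijGroup_def gal_def)
  qed
qed

lemma group_gal: "K \<subseteq> carrier R \<Longrightarrow> group (gal R K)"
  using subgroup.subgroup_is_group[OF subgroup_gal_BijGroup group_BijGroup]
  by (simp add: gal_def)

lemma gal_mono: "K \<subseteq> L \<Longrightarrow> carrier (gal R L) \<subseteq> carrier (gal R K)"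
  by (auto simp: gal_def)

lemma subgroup_gal:
  assumes "K \<subseteq> L" "L \<subseteq> carrier R"
  shows "subgroup (carrier (gal R L)) (gal R K)"
proof -
  interpret B: group "BijGroup (carrier R)" by (rule group_BijGroup)
  have "subgroup (carrier (gal R L)) (BijGroup (carrier R)\<lparr>carrier := carrier (gal R K)\<rparr>)"
    using assms by (intro B.subgroup_incl subgroup_gal_BijGroup gal_mono) auto
  then show ?thesis by (simp add: gal_def)
qed

text \<open>Every element is algebraic, so it has finitely many conjugates, and an automorphism is
  determined by its values on a finite basis.\<close>

lemma finite_gal:
  assumes K: "subfield K R" and fin: "finite_dimension K (carrier R)"
  shows "finite (carrier (gal R K))"
proof -
  have Kc: "K \<subseteq> carrier R" using K by (rule subfieldE(3))
  have orbit: "finite ((\<lambda>g. g x) ` carrier (gal R K))" if x: "x \<in> carrier R" for x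
  proof -
    have "(algebraic over K) x"
      using K carrier_is_subring fin x by (rule finite_dimension_imp_algebraic)
    then obtain p where p: "p \<in> carrier (K[X]\<^bsub>R\<^esub>)" "p \<noteq> []" "eval p x = \<zero>"
      using algebraicE[OF subfieldE(1)[OF K] x] by metis
    have "p \<in> carrier (poly_ring R)"
      using p(1) carrier_polynomial[OF subfieldE(1)[OF K]]
      by (auto simp: sym[OF univ_poly_carrier])
    then have fr: "finite {x. is_root p x}" by (rule finite_number_of_roots)
    have pK: "set p \<subseteq> K"
      using p(1) by (auto simp: sym[OF univ_poly_carrier] polynomial_def)
    have "is_root p (g x)" if g: "g \<in> carrier (gal R K)" for g
    proof -
      interpret g: ring_hom_ring R R g
        using gal_memD(2)[OF g] by (intro ring_hom_ringI2 ring_axioms)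
      have "map g p = p"
        using pK gal_memD(3)[OF g] by (intro map_idI) auto
      then have "eval p (g x) = \<zero>"
        using g.eval_hom'[OF x, of p] pK Kc p(3) by auto
      then show ?thesis
        using p(2) x by (simp add: is_root_def)
    qed
    then show ?thesis
      using fr by (auto intro: finite_subset[rotated])
  qed
  obtain Us where Us: "set Us \<subseteq> carrier R" "Span K Us = carrier R"
    using fin exists_base[OF K] by (metis finite_dimensionE')
  let ?\<rho> = "\<lambda>g. restrict g (set Us)"
  have "?\<rho> ` carrier (gal R K) \<subseteq> (\<Pi>\<^sub>E u\<in>set Us. (\<lambda>g. g u) ` carrier (gal R K))"
    by auto
  moreover have "finite (\<Pi>\<^sub>E u\<in>set Us. (\<lambda>g. g u) ` carrier (gal R K))"
    using Us(1) by (intro finite_PiE orbit) auto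
  moreover have "inj_on ?\<rho> (carrier (gal R K))"
  proof (rule inj_onI)
    fix g h assume g: "g \<in> carrier (gal R K)" and h: "h \<in> carrier (gal R K)"
      and eq: "?\<rho> g = ?\<rho> h"
    have u: "g u = h u" if "u \<in> set Us" for u
      using fun_cong[OF eq, of u] that by simp
    have comb: "f (combine Ks Us) = combine Ks (map f Us)"
      if f: "f \<in> carrier (gal R K)" and "set Ks \<subseteq> K" for f Ks
    proof -
      interpret f: ring_hom_ring R R f
        using gal_memD(2)[OF f] by (intro ring_hom_ringI2 ring_axioms)
      have "f (combine Ks Us) = combine (map f Ks) (map f Us)"
        using Us(1) that(2) Kc by (intro f.combine_hom[symmetric]) auto
      moreover have "map f Ks = Ks"
        using that gal_memD(3)[OF f] by (intro map_idI) auto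
      ultimately show ?thesis by simp
    qed
    show "g = h"
    proof (rule extensionalityI[of _ "carrier R"])
      show "g \<in> extensional (carrier R)" "h \<in> extensional (carrier R)"
        using gal_memD(1)[OF g] gal_memD(1)[OF h] by (auto dest: Bij_imp_extensional)
      fix x assume "x \<in> carrier R"
      then obtain Ks where Ks: "set Ks \<subseteq> K" "x = combine Ks Us"
        using Us Span_mem_iff_length_version[OF K Us(1)] by blast
      have "map g Us = map h Us" using u by simp
      then show "g x = h x" using comb[OF g Ks(1)] comb[OF h Ks(1)] Ks(2) by metis
    qed
  qed
  ultimately show ?thesis
    by (meson finite_imageD finite_subset)
qed

text \<open>The map is the coefficient of \<open>x\<close> with respect to a basis that contains \<open>x\<close> and \<open>\<one>\<close>.\<close>

lemma exists_linear_map_separating_one: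
  assumes L: "subfield L R" and fin: "finite_dimension L (carrier R)"
    and x: "x \<in> carrier R" "x \<notin> L"
  obtains f where "f \<in> carrier R \<rightarrow> carrier R"
    "\<And>u v. u \<in> carrier R \<Longrightarrow> v \<in> carrier R \<Longrightarrow> f (u \<oplus> v) = f u \<oplus> f v"
    "\<And>l u. l \<in> L \<Longrightarrow> u \<in> carrier R \<Longrightarrow> f (l \<otimes> u) = l \<otimes> f u"
    "f \<one> = \<zero>" "f x = \<one>"
proof -
  have Lc: "L \<subseteq> carrier R" using L by (rule subfieldE(3))
  note Lring = subringE[OF subfieldE(1)[OF L]]
  have mem: "a \<in> Span L [\<one>] \<longleftrightarrow>
      (\<exists>Ks. set Ks \<subseteq> L \<and> length Ks = length [\<one>] \<and> a = combine Ks [\<one>])" for a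
    by (rule Span_mem_iff_length_version[OF L]) simp
  have Span1: "Span L [\<one>] = L"
  proof
    show "Span L [\<one>] \<subseteq> L"
    proof
      fix l assume "l \<in> Span L [\<one>]"
      then obtain Ks where Ks: "set Ks \<subseteq> L" "length Ks = length [\<one>]" "l = combine Ks [\<one>]"
        unfolding mem by blast
      then obtain k where "Ks = [k]" by (cases Ks) auto
      then show "l \<in> L" using Ks Lc by auto
    qed
    show "L \<subseteq> Span L [\<one>]"
    proof
      fix l assume l: "l \<in> L"
      then have "l = combine [l] [\<one>]" using Lc by auto
      moreover have "set [l] \<subseteq> L" "length [l] = length [\<one>]" using l by auto
      ultimately show "l \<in> Span L [\<one>]"
        unfolding mem by blast
    qed
  qed
  have "\<one> \<notin> Span L []" by simp
  then have "independent L [x, \<one>]"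
    using x Span1 by (intro li_Cons) auto
  then obtain Vs where Vs: "independent L (Vs @ [x, \<one>])" "Span L (Vs @ [x, \<one>]) = carrier R"
    using fin complete_base[OF L, of _ "carrier R" "[x, \<one>]"] x by (metis (no_types, lifting)
        empty_subsetI finite_dimensionE' insert_subset list.set(1,2) one_closed)
  \<comment> \<open>Rotation puts \<open>x\<close> in front; the span of the other vectors is a complement of the line of \<open>x\<close>
    and contains \<open>\<one>\<close>.\<close>
  have "independent L (rotate n (Vs @ [x]) @ [\<one>])" for n
    using Vs(1) independent_rotate1[OF L] by (induction n) auto
  from this[of "length Vs"] have ind: "independent L (x # Vs @ [\<one>])"
    by (simp add: rotate_append)
  define V where "V = Span L (Vs @ [\<one>])"
  have inc: "set (Vs @ [\<one>]) \<subseteq> carrier R"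
    using independent_in_carrier[OF ind] by auto
  interpret V: subgroup V "add_monoid R"
    unfolding V_def by (rule Span_is_add_subgroup[OF L inc])
  have V_smult: "l \<otimes> v \<in> V" if "l \<in> L" "v \<in> V" for l v
    using Span_smult_closed[OF L inc] that by (simp add: V_def)
  have V_one: "\<one> \<in> V"
    using Span_base_incl[OF L inc] by (auto simp: V_def)
  have xV: "x \<notin> V"
    using ind by (auto simp: V_def elim: independent.cases)
  have Vc: "V \<subseteq> carrier R" using V.subset by simp
  have "Span L (x # Vs @ [\<one>]) = carrier R"
    using Vs(2) Span_same_set[OF L, of "Vs @ [x, \<one>]" "x # Vs @ [\<one>]"] inc x(1)
    by (auto simp del: Span.simps)
  then have "line_extension L x V = carrier R" by (simp add: V_def)
  then have ex: "\<exists>l\<in>L. \<exists>v\<in>V. u = l \<otimes> x \<oplus> v" if "u \<in> carrier R" for u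
    using that line_extension_mem_iff by blast
  have uniq: "l = l'"
    if "l \<in> L" "l' \<in> L" "v \<in> V" "v' \<in> V" "l \<otimes> x \<oplus> v = l' \<otimes> x \<oplus> v'" for l l' v v'
  proof (rule ccontr)
    assume ne: "l \<noteq> l'"
    define d where "d = l \<ominus> l'"
    have c: "l \<in> carrier R" "l' \<in> carrier R" "v \<in> carrier R" "v' \<in> carrier R"
      using that Lc Vc by auto
    have d: "d \<in> L - {\<zero>}"
      using that c ne Lring(5,7) by (auto simp: d_def a_minus_def)
        (metis a_inv_closed add.inv_closed minus_equality minus_minus add.m_comm)
    have "d \<otimes> x = v' \<ominus> v"
    proof -
      have "d \<otimes> x = (l \<otimes> x \<oplus> v) \<ominus> l' \<otimes> x \<ominus> v"
        unfolding d_def using c x(1) by algebra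
      also have "\<dots> = (l' \<otimes> x \<oplus> v') \<ominus> l' \<otimes> x \<ominus> v" by (simp only: that(5))
      also have "\<dots> = v' \<ominus> v" using c x(1) by algebra
      finally show ?thesis .
    qed
    also have "\<dots> \<in> V"
      using that(3,4) V.m_closed V.m_inv_closed by (simp add: a_minus_def a_inv_def)
    finally have "d \<otimes> x \<in> V" .
    moreover have dinv: "inv d \<in> L" "inv d \<otimes> d = \<one>"
      using subfield_m_inv[OF L d] by auto
    ultimately have "inv d \<otimes> (d \<otimes> x) \<in> V" using V_smult[of "inv d" "d \<otimes> x"] by simp
    moreover have "inv d \<otimes> (d \<otimes> x) = x"
      using d dinv x(1) Lc by (subst m_assoc[symmetric]) auto
    ultimately show False using xV by simp
  qed
  define f where "f u = (THE l. l \<in> L \<and> (\<exists>v\<in>V. u = l \<otimes> x \<oplus> v))" for u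
  have f_eq: "f (l \<otimes> x \<oplus> v) = l" if "l \<in> L" "v \<in> V" for l v
    unfolding f_def using that by (intro the_equality) (auto dest: uniq)
  show thesis
  proof
    show "f \<in> carrier R \<rightarrow> carrier R"
      using ex f_eq Lc by force
    fix u assume u: "u \<in> carrier R"
    then obtain k v where u': "u = k \<otimes> x \<oplus> v" "k \<in> L" "v \<in> V" using ex by blast
    have c: "k \<in> carrier R" "v \<in> carrier R" using u' Lc Vc by auto
    {
      fix w assume w: "w \<in> carrier R"
      then obtain m z where w': "w = m \<otimes> x \<oplus> z" "m \<in> L" "z \<in> V" using ex by blast
      have c': "m \<in> carrier R" "z \<in> carrier R" using w' Lc Vc by auto
      have "u \<oplus> w = (k \<oplus> m) \<otimes> x \<oplus> (v \<oplus> z)"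
        using c c' x(1) unfolding u' w' by algebra
      then show "f (u \<oplus> w) = f u \<oplus> f w"
        using f_eq[of "k \<oplus> m" "v \<oplus> z"] f_eq u' w' V.m_closed Lring(7) by simp
    }
    fix l assume l: "l \<in> L"
    have "l \<otimes> u = (l \<otimes> k) \<otimes> x \<oplus> l \<otimes> v"
      using c x(1) subsetD[OF Lc l] unfolding u' by (simp add: r_distr m_assoc)
    then show "f (l \<otimes> u) = l \<otimes> f u"
      using f_eq[of "l \<otimes> k" "l \<otimes> v"] f_eq u' V_smult l Lring(6) by simp
  next
    show "f \<one> = \<zero>"
      using f_eq[of \<zero> \<one>] V_one Lring(2) x(1) by simp
    have "\<zero> \<in> V" using V.one_closed by simp
    then show "f x = \<one>"
      using f_eq[of \<one> \<zero>] Lring(3) x(1) by simp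
  qed
qed

end

section \<open>Galois coordinates\<close>

lemma gal_mult_apply:
  "g \<in> carrier (gal E K) \<Longrightarrow> h \<in> carrier (gal E K) \<Longrightarrow> x \<in> carrier E \<Longrightarrow>
    (g \<otimes>\<^bsub>gal E K\<^esub> h) x = g (h x)"
  by (simp add: gal_def BijGroup_def compose_def)

lemma gal_one_apply: "x \<in> carrier E \<Longrightarrow> \<one>\<^bsub>gal E K\<^esub> x = x"
  by (simp add: gal_def BijGroup_def)

locale galois_extension = field E for E (structure) +
  fixes K
  assumes galois: "finite_galois E K"
begin

abbreviation "G \<equiv> gal E K"

lemma subfield_K: "subfield K E"
  and finite_dim: "finite_dimension K (carrier E)"
  and fixed_points: "{x \<in> carrier E. \<forall>\<sigma>\<in>carrier G. \<sigma> x = x} = K"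
  using galois by (auto simp: finite_galois_def)

lemma K_carrier: "K \<subseteq> carrier E"
  using subfield_K by (rule subfieldE(3))

lemma K_mem [simp]: "k \<in> K \<Longrightarrow> k \<in> carrier E"
  using K_carrier by auto

lemma fixed_imp_K: "x \<in> carrier E \<Longrightarrow> (\<And>g. g \<in> carrier G \<Longrightarrow> g x = x) \<Longrightarrow> x \<in> K"
  using fixed_points by blast

lemmas K_subring = subringE[OF subfieldE(1)[OF subfield_K]]

sublocale G: group G
  using K_carrier by (rule group_gal)

lemma finite_G [simp, intro]: "finite (carrier G)"
  using subfield_K finite_dim by (rule finite_gal)

lemma gal_closed [simp]: "g \<in> carrier G \<Longrightarrow> x \<in> carrier E \<Longrightarrow> g x \<in> carrier E"
  and gal_mult [simp]: "g \<in> carrier G \<Longrightarrow> x \<in> carrier E \<Longrightarrow> y \<in> carrier E \<Longrightarrow> g (x \<otimes> y) = g x \<otimes> g y"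
  and gal_add [simp]: "g \<in> carrier G \<Longrightarrow> x \<in> carrier E \<Longrightarrow> y \<in> carrier E \<Longrightarrow> g (x \<oplus> y) = g x \<oplus> g y"
  and gal_one [simp]: "g \<in> carrier G \<Longrightarrow> g \<one> = \<one>"
  using ring_hom_mult[of g E E] ring_hom_add[of g E E] ring_hom_one[of g E E]
    ring_hom_closed[of g E E] gal_memD(2)[of g E K]
  by auto

lemma gal_fix [simp]: "g \<in> carrier G \<Longrightarrow> k \<in> K \<Longrightarrow> g k = k"
  by (rule gal_memD(3))

lemma gal_zero [simp]: "g \<in> carrier G \<Longrightarrow> g \<zero> = \<zero>"
  using K_subring(2) by simp

lemma gal_minus [simp]: "g \<in> carrier G \<Longrightarrow> x \<in> carrier E \<Longrightarrow> g (\<ominus> x) = \<ominus> g x"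
  using gal_add[of g x "\<ominus> x"] by (metis a_inv_closed gal_closed gal_zero minus_equality r_neg
      minus_minus add.m_comm)

lemma gal_lsum [simp]:
  "g \<in> carrier G \<Longrightarrow> (\<And>x. x \<in> set s \<Longrightarrow> f x \<in> carrier E) \<Longrightarrow>
    g (lsum E f s) = lsum E (\<lambda>x. g (f x)) s"
  by (induction s) auto

lemma gal_finsum [simp]:
  assumes "g \<in> carrier G" "\<And>y. y \<in> Y \<Longrightarrow> f y \<in> carrier E"
  shows "g (\<Oplus>y\<in>Y. f y) = (\<Oplus>y\<in>Y. g (f y))"
  using assms by (induction Y rule: infinite_finite_induct) (auto simp: Pi_def)

lemmas gal_apply [simp] = gal_mult_apply[of _ E K] gal_one_apply[of _ E K]

lemma gal_inv_apply [simp]: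
  "g \<in> carrier G \<Longrightarrow> x \<in> carrier E \<Longrightarrow> (inv\<^bsub>G\<^esub> g) (g x) = x"
  "g \<in> carrier G \<Longrightarrow> x \<in> carrier E \<Longrightarrow> g ((inv\<^bsub>G\<^esub> g) x) = x"
  using gal_mult_apply[of "inv\<^bsub>G\<^esub> g" E K g x] gal_mult_apply[of g E K "inv\<^bsub>G\<^esub> g" x] by auto

lemma gal_eqI:
  assumes "g \<in> carrier G" "h \<in> carrier G" "\<And>x. x \<in> carrier E \<Longrightarrow> g x = h x"
  shows "g = h"
  using assms(3) gal_memD(1)[OF assms(1)] gal_memD(1)[OF assms(2)]
  by (auto dest!: Bij_imp_extensional intro: extensionalityI)

lemma bij_betw_rmult_G:
  "h \<in> carrier G \<Longrightarrow> bij_betw (\<lambda>g. g \<otimes>\<^bsub>G\<^esub> h) (carrier G) (carrier G)"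
  by (intro bij_betwI[where g = "\<lambda>g. g \<otimes>\<^bsub>G\<^esub> inv\<^bsub>G\<^esub> h"]) (auto simp: G.m_assoc)

lemma bij_betw_lmult_G:
  "h \<in> carrier G \<Longrightarrow> bij_betw (\<lambda>g. h \<otimes>\<^bsub>G\<^esub> g) (carrier G) (carrier G)"
  by (intro bij_betwI[where g = "\<lambda>g. inv\<^bsub>G\<^esub> h \<otimes>\<^bsub>G\<^esub> g"]) (auto simp: G.m_assoc[symmetric])

text \<open>The functions \<open>g \<mapsto> \<Sum>\<^sub>i d\<^sub>i \<cdot> g e\<^sub>i\<close> on the Galois group are closed under products, and for every
  \<open>h \<noteq> \<one>\<close> one of them separates \<open>\<one>\<close> from \<open>h\<close>: if \<open>h x \<noteq> x\<close>, the function
  \<open>(h x - g x) / (h x - x)\<close>. The product over all \<open>h \<noteq> \<one>\<close> is the indicator function of \<open>\<one>\<close>.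
  The resulting elements \<open>d\<^sub>i\<close> and \<open>e\<^sub>i\<close> replace a basis of the extension and its dual basis in
  everything that follows.\<close>

lemma exists_galois_coordinates:
  obtains s where "s \<in> lists (carrier E \<times> carrier E)"
    "\<And>g. g \<in> carrier G \<Longrightarrow> lsum E (\<lambda>(d, e). d \<otimes> g e) s = (if g = \<one>\<^bsub>G\<^esub> then \<one> else \<zero>)"
proof -
  let ?T = "\<lambda>s g. lsum E (\<lambda>(d, e). d \<otimes> g e) s"
  have "\<exists>s \<in> lists (carrier E \<times> carrier E). ?T s \<one>\<^bsub>G\<^esub> = \<one> \<and> (\<forall>g\<in>H. ?T s g = \<zero>)"
    if "finite H" "H \<subseteq> carrier G - {\<one>\<^bsub>G\<^esub>}" for H
    using that
  proof (induction H rule: finite_induct)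
    case empty
    show ?case by (intro bexI[of _ "[(\<one>, \<one>)]"]) auto
  next
    case (insert h H)
    then obtain s where s: "s \<in> lists (carrier E \<times> carrier E)" "?T s \<one>\<^bsub>G\<^esub> = \<one>"
      "\<And>g. g \<in> H \<Longrightarrow> ?T s g = \<zero>" by auto
    have h: "h \<in> carrier G" "h \<noteq> \<one>\<^bsub>G\<^esub>" using insert.prems by auto
    then obtain x where x: "x \<in> carrier E" "h x \<noteq> x"
      using gal_eqI[of h "\<one>\<^bsub>G\<^esub>"] by auto
    have hx: "h x \<in> carrier E" using h x by simp
    define u where "u = inv (h x \<ominus> x)"
    have "h x \<ominus> x \<noteq> \<zero>" using x hx by simp
    then have u: "u \<in> carrier E" "u \<otimes> (h x \<ominus> x) = \<one>"
      unfolding u_def using x hx by (auto simp: field_Units)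
    define t where "t = [(u \<otimes> h x, \<one>), (\<ominus> u, x)]"
    have t_in: "t \<in> lists (carrier E \<times> carrier E)"
      using u hx x by (auto simp: t_def)
    have T_t: "?T t g = u \<otimes> (h x \<ominus> g x)" if "g \<in> carrier G" for g
      using u(1) hx x(1) that by (simp add: t_def minus_eq r_distr l_minus r_minus)
    let ?m = "concat (map (\<lambda>(d, e). map (\<lambda>(d', e'). (d \<otimes> d', e \<otimes> e')) t) s)"
    have m_in: "?m \<in> lists (carrier E \<times> carrier E)"
      using s(1) t_in by (auto simp: in_lists_conv_set)
    have T_m: "?T ?m g = ?T s g \<otimes> ?T t g" if g: "g \<in> carrier G" for g
    proof -
      have in_s: "d \<in> carrier E \<and> e \<in> carrier E" if "(d, e) \<in> set s" for d e
        using s(1) that by (auto simp: in_lists_conv_set)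
      have in_t: "d \<in> carrier E \<and> e \<in> carrier E" if "(d, e) \<in> set t" for d e
        using t_in that by (auto simp: in_lists_conv_set)
      have "?T ?m g = lsum E (\<lambda>(d, e). lsum E (\<lambda>(d', e'). (d \<otimes> d') \<otimes> g (e \<otimes> e')) t) s"
        using g by (subst lsum_concat_map)
          (auto simp: lsum_map case_prod_unfold dest!: in_s in_t intro!: lsum_cong)
      also have "\<dots> = lsum E (\<lambda>(d, e). (d \<otimes> g e) \<otimes> ?T t g) s"
      proof (intro lsum_cong, clarify)
        fix d e assume de: "(d, e) \<in> set s"
        have "lsum E (\<lambda>(d', e'). (d \<otimes> d') \<otimes> g (e \<otimes> e')) t =
            lsum E (\<lambda>(d', e'). (d \<otimes> g e) \<otimes> (d' \<otimes> g e')) t"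
          using in_s[OF de] g by (intro lsum_cong) (auto dest!: in_t simp: m_ac)
        also have "\<dots> = (d \<otimes> g e) \<otimes> ?T t g"
          using in_s[OF de] g by (subst lsum_rdistr) (auto dest!: in_t simp: case_prod_unfold)
        finally show "lsum E (\<lambda>(d', e'). (d \<otimes> d') \<otimes> g (e \<otimes> e')) t = (d \<otimes> g e) \<otimes> ?T t g" .
      qed
      also have "\<dots> = ?T s g \<otimes> ?T t g"
        using g in_t in_s by (subst lsum_ldistr) (auto simp: case_prod_unfold)
      finally show ?thesis .
    qed
    have "?T ?m \<one>\<^bsub>G\<^esub> = \<one>"
      using T_m[of "\<one>\<^bsub>G\<^esub>"] T_t[of "\<one>\<^bsub>G\<^esub>"] s(2) u x by simp
    moreover have "?T ?m g = \<zero>" if "g \<in> insert h H" for g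
    proof -
      have g: "g \<in> carrier G" using that insert.prems by auto
      have "?T s g \<in> carrier E" "?T t g \<in> carrier E"
        using g s(1) t_in by (auto simp: in_lists_conv_set case_prod_unfold mem_Times_iff)
      moreover have "?T s g = \<zero> \<or> ?T t g = \<zero>"
        using that s(3) T_t[OF g] u(1) hx by (auto simp: minus_eq r_neg)
      ultimately show ?thesis using T_m[OF g] by auto
    qed
    ultimately show ?case using m_in by blast
  qed
  from this[of "carrier G - {\<one>\<^bsub>G\<^esub>}"] obtain s where
    "s \<in> lists (carrier E \<times> carrier E)" "?T s \<one>\<^bsub>G\<^esub> = \<one>" "\<And>g. g \<in> carrier G - {\<one>\<^bsub>G\<^esub>} \<Longrightarrow> ?T s g = \<zero>"
    by auto
  then show thesis by (intro that) auto
qed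

definition coords where
  "coords = (SOME s. s \<in> lists (carrier E \<times> carrier E) \<and>
    (\<forall>g\<in>carrier G. lsum E (\<lambda>(d, e). d \<otimes> g e) s = (if g = \<one>\<^bsub>G\<^esub> then \<one> else \<zero>)))"

lemma coords: "coords \<in> lists (carrier E \<times> carrier E)"
  and lsum_coords: "g \<in> carrier G \<Longrightarrow>
    lsum E (\<lambda>(d, e). d \<otimes> g e) coords = (if g = \<one>\<^bsub>G\<^esub> then \<one> else \<zero>)"
proof -
  have "\<exists>s. s \<in> lists (carrier E \<times> carrier E) \<and>
    (\<forall>g\<in>carrier G. lsum E (\<lambda>(d, e). d \<otimes> g e) s = (if g = \<one>\<^bsub>G\<^esub> then \<one> else \<zero>))"
    using exists_galois_coordinates by metis
  from someI_ex[OF this] show "coords \<in> lists (carrier E \<times> carrier E)"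
    "g \<in> carrier G \<Longrightarrow> lsum E (\<lambda>(d, e). d \<otimes> g e) coords = (if g = \<one>\<^bsub>G\<^esub> then \<one> else \<zero>)"
    unfolding coords_def by auto
qed

lemma coords_mem: "(d, e) \<in> set coords \<Longrightarrow> d \<in> carrier E \<and> e \<in> carrier E"
  using coords by (auto simp: in_lists_conv_set)

lemma coords_fst_snd [simp]: "p \<in> set coords \<Longrightarrow> fst p \<in> carrier E" "p \<in> set coords \<Longrightarrow> snd p \<in> carrier E"
  using coords_mem[of "fst p" "snd p"] by auto

text \<open>Apply \<open>g\<close> to the defining relation for the inverse of \<open>g\<close>.\<close>

lemma lsum_coords_twisted:
  assumes "g \<in> carrier G"
  shows "lsum E (\<lambda>(d, e). g d \<otimes> e) coords = (if g = \<one>\<^bsub>G\<^esub> then \<one> else \<zero>)"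
proof -
  have "lsum E (\<lambda>(d, e). g d \<otimes> e) coords = g (lsum E (\<lambda>(d, e). d \<otimes> (inv\<^bsub>G\<^esub> g) e) coords)"
    using assms coords_mem
    by (subst gal_lsum) (auto intro!: lsum_cong simp: case_prod_unfold)
  also have "\<dots> = (if g = \<one>\<^bsub>G\<^esub> then \<one> else \<zero>)"
    using assms by (subst lsum_coords) (auto simp: G.inv_eq_1_iff)
  finally show ?thesis .
qed

definition trace where "trace x = (\<Oplus>g\<in>carrier G. g x)"

lemma trace_K: "x \<in> carrier E \<Longrightarrow> trace x \<in> K"
proof (rule fixed_imp_K)
  fix h assume x: "x \<in> carrier E" and h: "h \<in> carrier G"
  have "h (trace x) = (\<Oplus>g\<in>carrier G. (h \<otimes>\<^bsub>G\<^esub> g) x)"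
    using x h by (auto simp: trace_def intro!: finsum_cong')
  also have "\<dots> = trace x"
    unfolding trace_def using x finsum_reindex_bij[OF bij_betw_lmult_G[OF h], of "\<lambda>g. g x"] by simp
  finally show "h (trace x) = trace x" .
qed (auto simp: trace_def)

lemma trace_closed [simp]: "x \<in> carrier E \<Longrightarrow> trace x \<in> carrier E"
  using trace_K by auto

lemma trace_add:
  "x \<in> carrier E \<Longrightarrow> y \<in> carrier E \<Longrightarrow> trace (x \<oplus> y) = trace x \<oplus> trace y"
  by (simp add: trace_def finsum_addf Pi_def cong: finsum_cong)

lemma trace_K_mult: "k \<in> K \<Longrightarrow> x \<in> carrier E \<Longrightarrow> trace (k \<otimes> x) = k \<otimes> trace x"
  by (simp add: trace_def finsum_rdistr Pi_def cong: finsum_cong)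

text \<open>In other words, the elements \<open>e\<^sub>i\<close> generate the extension, with coordinate functions
  \<open>x \<mapsto> trace (d\<^sub>i \<cdot> x)\<close>: expanding the traces leaves only the term of \<open>\<one>\<close>.\<close>

lemma coords_expansion:
  assumes "x \<in> carrier E"
  shows "lsum E (\<lambda>(d, e). trace (d \<otimes> x) \<otimes> e) coords = x"
proof -
  have "lsum E (\<lambda>(d, e). trace (d \<otimes> x) \<otimes> e) coords =
      lsum E (\<lambda>(d, e). \<Oplus>g\<in>carrier G. g x \<otimes> (g d \<otimes> e)) coords"
  proof (intro lsum_cong, clarify)
    fix d e assume "(d, e) \<in> set coords"
    then have de: "d \<in> carrier E" "e \<in> carrier E" by (auto dest: coords_mem)
    show "trace (d \<otimes> x) \<otimes> e = (\<Oplus>g\<in>carrier G. g x \<otimes> (g d \<otimes> e))"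
      unfolding trace_def using de assms
      by (intro finsum_ldistr_cong) (auto simp: m_ac)
  qed
  also have "\<dots> = (\<Oplus>g\<in>carrier G. lsum E (\<lambda>(d, e). g x \<otimes> (g d \<otimes> e)) coords)"
    using assms by (subst lsum_finsum[symmetric]) (auto simp: case_prod_unfold dest!: coords_mem)
  also have "\<dots> = (\<Oplus>g\<in>carrier G. g x \<otimes> lsum E (\<lambda>(d, e). g d \<otimes> e) coords)"
    using assms
    by (intro finsum_cong' refl, auto simp: case_prod_unfold Pi_def dest!: coords_mem)
      (subst lsum_rdistr, auto simp: case_prod_unfold dest!: coords_mem)
  also have "\<dots> = (\<Oplus>g\<in>carrier G. if g = \<one>\<^bsub>G\<^esub> then g x else \<zero>)"
    using assms by (intro finsum_cong' refl) (auto simp: lsum_coords_twisted)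
  also have "\<dots> = x"
    using assms by (subst finsum_delta) auto
  finally show ?thesis .
qed

text \<open>If all traces vanished, so would the expansion of \<open>\<one>\<close> in coordinates.\<close>

lemma exists_trace_one: obtains t where "t \<in> carrier E" "trace t = \<one>"
proof -
  have "\<exists>x\<in>carrier E. trace x \<noteq> \<zero>"
  proof (rule ccontr)
    assume "\<not> ?thesis"
    then have "lsum E (\<lambda>(d, e). trace (d \<otimes> \<one>) \<otimes> e) coords = lsum E (\<lambda>_. \<zero>) coords"
      by (intro lsum_cong) (auto dest!: coords_mem)
    then show False using coords_expansion[of \<one>] by simp
  qed
  then obtain x where x: "x \<in> carrier E" "trace x \<noteq> \<zero>" by auto
  have k: "trace x \<in> K - {\<zero>}" using x trace_K by auto
  then have "inv (trace x) \<in> K" "inv (trace x) \<otimes> trace x = \<one>"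
    using subfield_m_inv[OF subfield_K k] by auto
  then show thesis
    using x that[of "inv (trace x) \<otimes> x"] by (simp add: trace_K_mult)
qed

text \<open>Dedekind's independence of characters. The value \<open>c h\<close> is a combination, with coefficients
  \<open>h d\<^sub>i\<close>, of the values at \<open>e\<^sub>i\<close> of the function \<open>\<Sum>\<^sub>g c g \<cdot> g\<close>.\<close>

lemma dedekind:
  assumes c: "\<And>g. g \<in> carrier G \<Longrightarrow> c g \<in> carrier E"
    and zero: "\<And>x. x \<in> carrier E \<Longrightarrow> (\<Oplus>g\<in>carrier G. c g \<otimes> g x) = \<zero>"
    and h: "h \<in> carrier G"
  shows "c h = \<zero>"
proof -
  have "c h = (\<Oplus>g\<in>carrier G. if g = h then c g else \<zero>)"
    using c h by (subst finsum_delta) auto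
  also have "\<dots> = (\<Oplus>g\<in>carrier G. lsum E (\<lambda>(d, e). h d \<otimes> (c g \<otimes> g e)) coords)"
  proof (intro finsum_cong' refl)
    fix g assume g: "g \<in> carrier G"
    have "lsum E (\<lambda>(d, e). h d \<otimes> (c g \<otimes> g e)) coords =
        c g \<otimes> h (lsum E (\<lambda>(d, e). d \<otimes> (inv\<^bsub>G\<^esub> h \<otimes>\<^bsub>G\<^esub> g) e) coords)"
      using c g h
      by (subst gal_lsum, simp, force dest!: coords_mem, subst lsum_rdistr)
        (auto intro!: lsum_cong simp: case_prod_unfold m_ac dest!: coords_mem)
    also have "\<dots> = (if g = h then c g else \<zero>)"
      using c g h G.inv_solve_left'[of "\<one>\<^bsub>G\<^esub>" h g] by (subst lsum_coords) auto
    finally show "(if g = h then c g else \<zero>) = lsum E (\<lambda>(d, e). h d \<otimes> (c g \<otimes> g e)) coords" ..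
  qed (use c h in \<open>auto simp: case_prod_unfold dest!: coords_mem\<close>)
  also have "\<dots> = lsum E (\<lambda>(d, e). \<Oplus>g\<in>carrier G. h d \<otimes> (c g \<otimes> g e)) coords"
    using c h by (subst lsum_finsum[symmetric]) (auto simp: case_prod_unfold dest!: coords_mem)
  also have "\<dots> = lsum E (\<lambda>_. \<zero>) coords"
    using c h zero
    by (intro lsum_cong, auto dest!: coords_mem)
      (subst finsum_rdistr[symmetric], auto)
  finally show ?thesis by simp
qed

text \<open>Apply the map to the expansion of \<open>x\<close> in coordinates and write the traces as sums over the
  Galois group.\<close>

lemma linear_map_eq_sum_automorphisms:
  assumes f: "f \<in> carrier E \<rightarrow> carrier E"
    and add: "\<And>u v. u \<in> carrier E \<Longrightarrow> v \<in> carrier E \<Longrightarrow> f (u \<oplus> v) = f u \<oplus> f v"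
    and smult: "\<And>k u. k \<in> K \<Longrightarrow> u \<in> carrier E \<Longrightarrow> f (k \<otimes> u) = k \<otimes> f u"
  obtains c where "c \<in> carrier G \<rightarrow> carrier E"
    "\<And>x. x \<in> carrier E \<Longrightarrow> f x = (\<Oplus>g\<in>carrier G. c g \<otimes> g x)"
proof
  let ?c = "\<lambda>g. lsum E (\<lambda>(d, e). g d \<otimes> f e) coords"
  have fc: "f u \<in> carrier E" if "u \<in> carrier E" for u using f that by auto
  show "?c \<in> carrier G \<rightarrow> carrier E"
    using fc by (auto simp: case_prod_unfold dest!: coords_mem)
  fix x assume x: "x \<in> carrier E"
  have f0: "f \<zero> = \<zero>"
    using smult[of \<zero> \<zero>] K_subring(2) fc by simp
  have "f x = f (lsum E (\<lambda>(d, e). trace (d \<otimes> x) \<otimes> e) coords)"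
    using coords_expansion[OF x] by simp
  also have "\<dots> = lsum E (\<lambda>p. f (case p of (d, e) \<Rightarrow> trace (d \<otimes> x) \<otimes> e)) coords"
    using x by (intro lsum_additive abelian_monoid_axioms)
      (auto simp: add f0 dest!: coords_mem)
  also have "\<dots> = lsum E (\<lambda>(d, e). \<Oplus>g\<in>carrier G. (g d \<otimes> f e) \<otimes> g x) coords"
  proof (intro lsum_cong, clarify)
    fix d e assume "(d, e) \<in> set coords"
    then have de: "d \<in> carrier E" "e \<in> carrier E" by (auto dest: coords_mem)
    have "f (trace (d \<otimes> x) \<otimes> e) = trace (d \<otimes> x) \<otimes> f e"
      using de x by (intro smult trace_K) auto
    also have "\<dots> = (\<Oplus>g\<in>carrier G. (g d \<otimes> f e) \<otimes> g x)"
      unfolding trace_def using de x fc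
      by (intro finsum_ldistr_cong) (auto simp: m_ac)
    finally show "f (trace (d \<otimes> x) \<otimes> e) = (\<Oplus>g\<in>carrier G. (g d \<otimes> f e) \<otimes> g x)" .
  qed
  also have "\<dots> = (\<Oplus>g\<in>carrier G. lsum E (\<lambda>(d, e). (g d \<otimes> f e) \<otimes> g x) coords)"
    unfolding case_prod_unfold using x by (intro lsum_finsum) (simp add: fc)
  also have "\<dots> = (\<Oplus>g\<in>carrier G. ?c g \<otimes> g x)"
  proof (intro finsum_cong' refl funcsetI)
    fix g assume g: "g \<in> carrier G"
    show "lsum E (\<lambda>(d, e). (g d \<otimes> f e) \<otimes> g x) coords = ?c g \<otimes> g x"
      unfolding case_prod_unfold using x g
      by (intro lsum_ldistr[symmetric]) (simp_all add: fc)
    show "?c g \<otimes> g x \<in> carrier E"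
      unfolding case_prod_unfold using x g by (simp add: fc)
  qed
  finally show "f x = (\<Oplus>g\<in>carrier G. ?c g \<otimes> g x)" .
qed

end

section \<open>Equivariant functions on finite sets with an action of the Galois group\<close>

definition equivariant_maps ::
    "('a, 'm) ring_scheme \<Rightarrow> 'a set \<Rightarrow> 'y set \<Rightarrow> (('a \<Rightarrow> 'a) \<Rightarrow> 'y \<Rightarrow> 'y) \<Rightarrow> ('y \<Rightarrow> 'a) set"
  where "equivariant_maps E K Y act =
    {u \<in> Y \<rightarrow>\<^sub>E carrier E. \<forall>g\<in>carrier (gal E K). \<forall>y\<in>Y. u (act g y) = g (u y)}"

locale gset = galois_extension +
  fixes Y :: "'y set" and act :: "('a \<Rightarrow> 'a) \<Rightarrow> 'y \<Rightarrow> 'y"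
  assumes finite_Y [simp, intro]: "finite Y"
    and act_closed [simp]: "g \<in> carrier G \<Longrightarrow> y \<in> Y \<Longrightarrow> act g y \<in> Y"
    and act_one [simp]: "y \<in> Y \<Longrightarrow> act \<one>\<^bsub>G\<^esub> y = y"
    and act_mult: "g \<in> carrier G \<Longrightarrow> h \<in> carrier G \<Longrightarrow> y \<in> Y \<Longrightarrow> act (g \<otimes>\<^bsub>G\<^esub> h) y = act g (act h y)"
begin

abbreviation "W \<equiv> equivariant_maps E K Y act"

lemma W_closed [simp]: "u \<in> W \<Longrightarrow> y \<in> Y \<Longrightarrow> u y \<in> carrier E"
  and W_act: "u \<in> W \<Longrightarrow> g \<in> carrier G \<Longrightarrow> y \<in> Y \<Longrightarrow> u (act g y) = g (u y)"
  by (auto simp: equivariant_maps_def)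

lemma act_inv [simp]:
  "g \<in> carrier G \<Longrightarrow> y \<in> Y \<Longrightarrow> act (inv\<^bsub>G\<^esub> g) (act g y) = y"
  "g \<in> carrier G \<Longrightarrow> y \<in> Y \<Longrightarrow> act g (act (inv\<^bsub>G\<^esub> g) y) = y"
  by (simp_all add: act_mult[symmetric])

lemma bij_betw_act: "g \<in> carrier G \<Longrightarrow> bij_betw (act g) Y Y"
  by (intro bij_betwI[where g = "act (inv\<^bsub>G\<^esub> g)"]) auto

lemma act_eq_iff: "g \<in> carrier G \<Longrightarrow> y \<in> Y \<Longrightarrow> z \<in> Y \<Longrightarrow> act g y = act g z \<longleftrightarrow> y = z"
  by (rule inj_on_eq_iff[OF bij_betw_imp_inj_on[OF bij_betw_act]])

lemma sum_equivariant_K: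
  assumes u: "\<And>y. y \<in> Y \<Longrightarrow> u y \<in> carrier E"
    and act: "\<And>g y. g \<in> carrier G \<Longrightarrow> y \<in> Y \<Longrightarrow> u (act g y) = g (u y)"
  shows "(\<Oplus>y\<in>Y. u y) \<in> K"
proof (rule fixed_imp_K)
  fix g assume g: "g \<in> carrier G"
  have "g (\<Oplus>y\<in>Y. u y) = (\<Oplus>y\<in>Y. u (act g y))"
    using g u act by (auto intro!: finsum_cong')
  also have "\<dots> = (\<Oplus>y\<in>Y. u y)"
    using g u by (intro finsum_reindex_bij bij_betw_act)
  finally show "g (\<Oplus>y\<in>Y. u y) = (\<Oplus>y\<in>Y. u y)" .
qed (use u in auto)

definition average where
  "average f = (\<lambda>y\<in>Y. \<Oplus>g\<in>carrier G. (inv\<^bsub>G\<^esub> g) (f (act g y)))"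

lemma average_mem:
  assumes f: "\<And>y. y \<in> Y \<Longrightarrow> f y \<in> carrier E"
  shows "average f \<in> W"
  unfolding equivariant_maps_def
proof (intro CollectI conjI ballI PiE_I)
  show "average f y \<in> carrier E" if "y \<in> Y" for y
    using that f by (auto simp: average_def)
  show "average f y = undefined" if "y \<notin> Y" for y
    using that by (auto simp: average_def)
  fix h y assume h: "h \<in> carrier G" and y: "y \<in> Y"
  have "average f (act h y) = (\<Oplus>g\<in>carrier G. (inv\<^bsub>G\<^esub> g) (f (act g (act h y))))"
    using h y by (simp add: average_def)
  also have "\<dots> = (\<Oplus>g\<in>carrier G. h ((inv\<^bsub>G\<^esub> (g \<otimes>\<^bsub>G\<^esub> h)) (f (act (g \<otimes>\<^bsub>G\<^esub> h) y))))"
    using h y f by (intro finsum_cong' refl) (auto simp: G.inv_mult_group act_mult)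
  also have "\<dots> = (\<Oplus>g\<in>carrier G. h ((inv\<^bsub>G\<^esub> g) (f (act g y))))"
    using h y f finsum_reindex_bij[OF bij_betw_rmult_G[OF h],
        of "\<lambda>g. h ((inv\<^bsub>G\<^esub> g) (f (act g y)))"] by simp
  also have "\<dots> = h (average f y)"
    using h y f by (simp add: average_def)
  finally show "average f (act h y) = h (average f y)" .
qed

text \<open>The averages of the functions \<open>e\<^sub>i \<cdot> f\<close>, combined with the coefficients \<open>d\<^sub>i\<close>, give back \<open>f\<close>,
  since the Galois coordinates cancel all terms of the average except that of \<open>\<one>\<close>. This is Galois
  descent for the space of all functions.\<close>

lemma equivariant_maps_span:
  assumes f: "\<And>y. y \<in> Y \<Longrightarrow> f y \<in> carrier E"
  obtains s where "s \<in> lists (carrier E \<times> W)"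
    "\<And>y. y \<in> Y \<Longrightarrow> f y = lsum E (\<lambda>(d, w). d \<otimes> w y) s"
proof
  let ?s = "map (\<lambda>(d, e). (d, average (\<lambda>y. e \<otimes> f y))) coords"
  show "?s \<in> lists (carrier E \<times> W)"
    using f by (auto simp: in_lists_conv_set case_prod_unfold dest: coords_mem intro!: average_mem)
  fix y assume y: "y \<in> Y"
  have "lsum E (\<lambda>(d, w). d \<otimes> w y) ?s =
      lsum E (\<lambda>(d, e). \<Oplus>g\<in>carrier G. (d \<otimes> (inv\<^bsub>G\<^esub> g) e) \<otimes> (inv\<^bsub>G\<^esub> g) (f (act g y))) coords"
    unfolding lsum_map
  proof (intro lsum_cong, goal_cases)
    case (1 p)
    obtain d e where p: "p = (d, e)" by (cases p)
    with 1 have de: "d \<in> carrier E" "e \<in> carrier E" by (auto dest: coords_mem)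
    have "d \<otimes> average (\<lambda>y. e \<otimes> f y) y =
        (\<Oplus>g\<in>carrier G. d \<otimes> (inv\<^bsub>G\<^esub> g) (e \<otimes> f (act g y)))"
      using de f y by (simp add: average_def) (subst finsum_rdistr, auto)
    also have "\<dots> = (\<Oplus>g\<in>carrier G. (d \<otimes> (inv\<^bsub>G\<^esub> g) e) \<otimes> (inv\<^bsub>G\<^esub> g) (f (act g y)))"
      using de f y by (intro finsum_cong' refl) (auto simp: m_ac)
    finally show ?case
      by (simp add: p)
  qed
  also have "\<dots> = (\<Oplus>g\<in>carrier G.
      lsum E (\<lambda>(d, e). (d \<otimes> (inv\<^bsub>G\<^esub> g) e) \<otimes> (inv\<^bsub>G\<^esub> g) (f (act g y))) coords)"
    unfolding case_prod_unfold using f y by (intro lsum_finsum) auto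
  also have "\<dots> = (\<Oplus>g\<in>carrier G. if g = \<one>\<^bsub>G\<^esub> then (inv\<^bsub>G\<^esub> g) (f (act g y)) else \<zero>)"
  proof (intro finsum_cong' refl funcsetI)
    fix g assume g: "g \<in> carrier G"
    have "lsum E (\<lambda>(d, e). (d \<otimes> (inv\<^bsub>G\<^esub> g) e) \<otimes> (inv\<^bsub>G\<^esub> g) (f (act g y))) coords =
        lsum E (\<lambda>(d, e). d \<otimes> (inv\<^bsub>G\<^esub> g) e) coords \<otimes> (inv\<^bsub>G\<^esub> g) (f (act g y))"
      unfolding case_prod_unfold using f y g by (subst lsum_ldistr) auto
    then show "lsum E (\<lambda>(d, e). (d \<otimes> (inv\<^bsub>G\<^esub> g) e) \<otimes> (inv\<^bsub>G\<^esub> g) (f (act g y))) coords =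
        (if g = \<one>\<^bsub>G\<^esub> then (inv\<^bsub>G\<^esub> g) (f (act g y)) else \<zero>)"
      using f y g by (simp add: lsum_coords G.inv_eq_1_iff)
  qed (use f y in auto)
  also have "\<dots> = f y"
    using f y by (subst finsum_delta) auto
  finally show "f y = lsum E (\<lambda>(d, w). d \<otimes> w y) ?s" ..
qed

text \<open>Multiply the expansion by \<open>t\<close> and sum its conjugates: the functions are equivariant and come
  out of the sum unchanged, while the coefficients become traces.\<close>

lemma expansion_with_fixed_coefficients:
  assumes t: "t \<in> carrier E" "trace t = \<one>"
    and Q: "\<And>y. y \<in> Y \<Longrightarrow> Q y \<in> carrier E"
      "\<And>g y. g \<in> carrier G \<Longrightarrow> y \<in> Y \<Longrightarrow> Q (act g y) = g (Q y)"
    and w: "\<And>i y. i \<in> set s \<Longrightarrow> y \<in> Y \<Longrightarrow> w i y \<in> carrier E"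
      "\<And>i g y. i \<in> set s \<Longrightarrow> g \<in> carrier G \<Longrightarrow> y \<in> Y \<Longrightarrow> w i (act g y) = g (w i y)"
    and c: "\<And>i. i \<in> set s \<Longrightarrow> c i \<in> carrier E"
    and expand: "\<And>y. y \<in> Y \<Longrightarrow> Q y = lsum E (\<lambda>i. c i \<otimes> w i y) s"
    and y: "y \<in> Y"
  shows "Q y = lsum E (\<lambda>i. trace (t \<otimes> c i) \<otimes> w i y) s"
proof -
  have "Q y = trace t \<otimes> Q y"
    using t Q(1) y by simp
  also have "\<dots> = (\<Oplus>g\<in>carrier G. g t \<otimes> Q y)"
    unfolding trace_def using t(1) Q(1) y by (intro finsum_ldistr) auto
  also have "\<dots> = (\<Oplus>g\<in>carrier G. lsum E (\<lambda>i. g (t \<otimes> c i) \<otimes> w i y) s)"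
  proof (intro finsum_cong' refl funcsetI)
    fix g assume g: "g \<in> carrier G"
    let ?y = "act (inv\<^bsub>G\<^esub> g) y"
    have y': "?y \<in> Y" using g y by simp
    have "Q y = g (Q ?y)"
      using Q(2)[OF g y'] g y by simp
    also have "\<dots> = lsum E (\<lambda>i. g (c i \<otimes> w i ?y)) s"
      using c w(1) g y' by (simp add: expand[OF y'])
    also have "\<dots> = lsum E (\<lambda>i. g (c i) \<otimes> w i y) s"
      using c w(1) g y y' w(2)[OF _ g y'] by (intro lsum_cong) simp
    finally have "g t \<otimes> Q y = lsum E (\<lambda>i. g t \<otimes> (g (c i) \<otimes> w i y)) s"
      using t(1) c w(1) g y by (simp add: lsum_rdistr)
    also have "\<dots> = lsum E (\<lambda>i. g (t \<otimes> c i) \<otimes> w i y) s"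
      using t(1) c w(1) g y by (intro lsum_cong) (simp add: m_assoc)
    finally show "g t \<otimes> Q y = lsum E (\<lambda>i. g (t \<otimes> c i) \<otimes> w i y) s" .
  qed (use t(1) c w(1) y in auto)
  also have "\<dots> = lsum E (\<lambda>i. \<Oplus>g\<in>carrier G. g (t \<otimes> c i) \<otimes> w i y) s"
    using t(1) c w(1) y by (intro lsum_finsum[symmetric]) auto
  also have "\<dots> = lsum E (\<lambda>i. trace (t \<otimes> c i) \<otimes> w i y) s"
    unfolding trace_def using t(1) c w(1) y
    by (intro lsum_cong finsum_ldistr[symmetric]) auto
  finally show ?thesis .
qed

end

locale gset_pair = A?: gset E K Y act + B?: gset E K Z act'
  for E (structure) and K and Y :: "'y set" and act and Z :: "'z set" and act'
begin

text \<open>Spanning in each variable expands any function on the product, with coefficients in the top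
  field; for an equivariant function the coefficients can be replaced by elements of the base
  field, which go into the first factors.\<close>

lemma equivariant_maps_product:
  assumes Q: "\<And>y z. y \<in> Y \<Longrightarrow> z \<in> Z \<Longrightarrow> Q y z \<in> carrier E"
    and act: "\<And>g y z. g \<in> carrier G \<Longrightarrow> y \<in> Y \<Longrightarrow> z \<in> Z \<Longrightarrow> Q (act g y) (act' g z) = g (Q y z)"
  obtains s where "s \<in> lists (A.W \<times> B.W)"
    "\<And>y z. y \<in> Y \<Longrightarrow> z \<in> Z \<Longrightarrow> Q y z = lsum E (\<lambda>(u, v). u y \<otimes> v z) s"
proof -
  define expansion where "expansion q s \<longleftrightarrow> s \<in> lists (carrier E \<times> (A.W \<times> B.W)) \<and>
    (\<forall>y\<in>Y. \<forall>z\<in>Z. q y z = lsum E (\<lambda>(c, u, v). c \<otimes> (u y \<otimes> v z)) s)" for q s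
  have expansion_mem: "c \<in> carrier E \<and> u \<in> A.W \<and> v \<in> B.W" if "expansion q s" "(c, u, v) \<in> set s" for q s c u v
    using that by (auto simp: expansion_def in_lists_conv_set)
  have expansion_prod: "\<exists>s. expansion (\<lambda>y z. p y \<otimes> q z) s"
    if p: "\<And>y. y \<in> Y \<Longrightarrow> p y \<in> carrier E" and q: "\<And>z. z \<in> Z \<Longrightarrow> q z \<in> carrier E" for p q
  proof -
    obtain s where s: "s \<in> lists (carrier E \<times> A.W)"
      "\<And>y. y \<in> Y \<Longrightarrow> p y = lsum E (\<lambda>(d, w). d \<otimes> w y) s"
      using A.equivariant_maps_span[of p] p by blast
    obtain r where r: "r \<in> lists (carrier E \<times> B.W)"
      "\<And>z. z \<in> Z \<Longrightarrow> q z = lsum E (\<lambda>(d, w). d \<otimes> w z) r"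
      using B.equivariant_maps_span[of q] q by blast
    have s_mem: "i \<in> set s \<Longrightarrow> fst i \<in> carrier E \<and> snd i \<in> A.W" for i
      using s(1) by (auto simp: in_lists_conv_set)
    have r_mem: "i \<in> set r \<Longrightarrow> fst i \<in> carrier E \<and> snd i \<in> B.W" for i
      using r(1) by (auto simp: in_lists_conv_set)
    let ?m = "concat (map (\<lambda>i. map (\<lambda>j. (fst i \<otimes> fst j, snd i, snd j)) r) s)"
    have "expansion (\<lambda>y z. p y \<otimes> q z) ?m"
      unfolding expansion_def
    proof (intro conjI ballI)
      show "?m \<in> lists (carrier E \<times> A.W \<times> B.W)"
        using s_mem r_mem by (auto simp: in_lists_conv_set)
      fix y z assume y: "y \<in> Y" and z: "z \<in> Z"
      have "lsum E (\<lambda>(c, u, v). c \<otimes> (u y \<otimes> v z)) ?m =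
          lsum E (\<lambda>i. lsum E (\<lambda>j. fst i \<otimes> fst j \<otimes> (snd i y \<otimes> snd j z)) r) s"
        using y z s_mem r_mem by (subst lsum_concat_map) (auto simp: lsum_map)
      also have "\<dots> = lsum E (\<lambda>i. (fst i \<otimes> snd i y) \<otimes> q z) s"
      proof (intro lsum_cong)
        fix i assume i: "i \<in> set s"
        have "lsum E (\<lambda>j. fst i \<otimes> fst j \<otimes> (snd i y \<otimes> snd j z)) r =
            lsum E (\<lambda>j. (fst i \<otimes> snd i y) \<otimes> (fst j \<otimes> snd j z)) r"
          using s_mem[OF i] r_mem y z by (intro lsum_cong) (simp add: m_ac)
        also have "\<dots> = (fst i \<otimes> snd i y) \<otimes> q z"
          using s_mem[OF i] r_mem y z r(2)[OF z] by (simp add: case_prod_unfold lsum_rdistr)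
        finally show "lsum E (\<lambda>j. fst i \<otimes> fst j \<otimes> (snd i y \<otimes> snd j z)) r = (fst i \<otimes> snd i y) \<otimes> q z" .
      qed
      also have "\<dots> = p y \<otimes> q z"
        using s_mem y z q s(2)[OF y] by (simp add: case_prod_unfold lsum_ldistr)
      finally show "p y \<otimes> q z = lsum E (\<lambda>(c, u, v). c \<otimes> (u y \<otimes> v z)) ?m" ..
    qed
    then show ?thesis by blast
  qed
  have expansion_finsum: "\<exists>s. expansion (\<lambda>y z. \<Oplus>i\<in>I. q i y z) s"
    if "finite I" "\<And>i. i \<in> I \<Longrightarrow> \<exists>s. expansion (q i) s" for I :: "'z set" and q
    using that
  proof (induction I rule: finite_induct)
    case empty
    have "expansion (\<lambda>y z. \<Oplus>i\<in>{}. q i y z) []" by (auto simp: expansion_def)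
    then show ?case by blast
  next
    case (insert i I)
    then obtain s r where sr: "expansion (\<lambda>y z. \<Oplus>i\<in>I. q i y z) s" "expansion (q i) r" by blast
    have q: "q j y z \<in> carrier E" if j: "j \<in> insert i I" and yz: "y \<in> Y" "z \<in> Z" for j y z
    proof -
      obtain s' where s': "expansion (q j) s'" using insert.prems j by auto
      then have "q j y z = lsum E (\<lambda>(c, u, v). c \<otimes> (u y \<otimes> v z)) s'"
        using yz by (auto simp: expansion_def)
      also have "\<dots> \<in> carrier E"
        using expansion_mem[OF s'] yz by (intro lsum_closed) auto
      finally show ?thesis .
    qed
    have "expansion (\<lambda>y z. \<Oplus>i\<in>insert i I. q i y z) (r @ s)"
      unfolding expansion_def
    proof (intro conjI ballI)
      show "r @ s \<in> lists (carrier E \<times> A.W \<times> B.W)" using sr by (auto simp: expansion_def)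
      fix y z assume y: "y \<in> Y" and z: "z \<in> Z"
      have "lsum E (\<lambda>(c, u, v). c \<otimes> (u y \<otimes> v z)) (r @ s) = q i y z \<oplus> (\<Oplus>i\<in>I. q i y z)"
        using sr y z expansion_mem[OF sr(1)] expansion_mem[OF sr(2)]
        by (subst lsum_append) (auto simp: expansion_def)
      also have "\<dots> = (\<Oplus>i\<in>insert i I. q i y z)"
        using insert.hyps q[OF _ y z] by (subst finsum_insert) auto
      finally show "(\<Oplus>i\<in>insert i I. q i y z) = lsum E (\<lambda>(c, u, v). c \<otimes> (u y \<otimes> v z)) (r @ s)" ..
    qed
    then show ?case by blast
  qed
  \<comment> \<open>\<open>Q\<close> is the sum over \<open>z'\<close> of its section at \<open>z'\<close> times the indicator function of \<open>z'\<close>.\<close>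
  have "\<exists>s. expansion (\<lambda>y z. \<Oplus>z'\<in>Z. Q y z' \<otimes> (if z' = z then \<one> else \<zero>)) s"
    using Q by (intro expansion_finsum expansion_prod) auto
  then obtain s where s: "expansion (\<lambda>y z. \<Oplus>z'\<in>Z. Q y z' \<otimes> (if z' = z then \<one> else \<zero>)) s" ..
  have Q_eq: "Q y z = lsum E (\<lambda>(c, u, v). c \<otimes> (u y \<otimes> v z)) s" if y: "y \<in> Y" and z: "z \<in> Z" for y z
  proof -
    have "(\<Oplus>z'\<in>Z. Q y z' \<otimes> (if z' = z then \<one> else \<zero>)) = (\<Oplus>z'\<in>Z. if z' = z then Q y z' else \<zero>)"
      using Q y z by (intro finsum_cong' refl) auto
    also have "\<dots> = Q y z" using Q y z by (intro finsum_delta) auto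
    finally show ?thesis using s y z by (auto simp: expansion_def)
  qed
  obtain t where t: "t \<in> carrier E" "trace t = \<one>" by (rule exists_trace_one)
  have mem: "fst i \<in> carrier E \<and> fst (snd i) \<in> A.W \<and> snd (snd i) \<in> B.W" if "i \<in> set s" for i
    using expansion_mem[OF s, of "fst i" "fst (snd i)" "snd (snd i)"] that by auto
  interpret P: gset E K "Y \<times> Z" "\<lambda>g (y, z). (act g y, act' g z)"
    by unfold_locales (auto simp: A.act_mult B.act_mult)
  let ?s = "map (\<lambda>(c, u, v). ((\<lambda>y\<in>Y. trace (t \<otimes> c) \<otimes> u y), v)) s"
  show thesis
  proof
    show "?s \<in> lists (A.W \<times> B.W)"
    proof -
      have "(\<lambda>y\<in>Y. trace (t \<otimes> c) \<otimes> u y) \<in> A.W" if c: "c \<in> carrier E" and u: "u \<in> A.W" for c u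
      proof -
        have "trace (t \<otimes> c) \<in> K" using t c by (intro trace_K) auto
        then show ?thesis
          using A.W_closed[OF u] A.W_act[OF u] by (auto simp: equivariant_maps_def)
      qed
      then show ?thesis
        using expansion_mem[OF s] by (fastforce simp: in_lists_conv_set)
    qed
    fix y z assume y: "y \<in> Y" and z: "z \<in> Z"
    have "(case (y, z) of (y, z) \<Rightarrow> Q y z) =
        lsum E (\<lambda>i. trace (t \<otimes> fst i) \<otimes> (case (y, z) of (y, z) \<Rightarrow> fst (snd i) y \<otimes> snd (snd i) z)) s"
    proof (rule P.expansion_with_fixed_coefficients[OF t], goal_cases)
      case 1 then show ?case using Q by auto
    next
      case 2 then show ?case using act by auto
    next
      case (3 i p) then show ?case using mem[of i] by auto
    next
      case (4 i g p) then show ?case using mem[of i] by (auto simp: A.W_act B.W_act)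
    next
      case (5 i) then show ?case using mem[of i] by auto
    next
      case 6 then show ?case using Q_eq by (auto simp: case_prod_unfold)
    next
      case 7 then show ?case using y z by auto
    qed
    also have "\<dots> = lsum E (\<lambda>(u, v). u y \<otimes> v z) ?s"
      unfolding lsum_map using t y z expansion_mem[OF s]
      by (intro lsum_cong) (auto simp: m_assoc)
    finally show "Q y z = lsum E (\<lambda>(u, v). u y \<otimes> v z) ?s" by simp
  qed
qed

end

context gset
begin

text \<open>The pairs in the list are dual bases, up to linear dependencies, with respect to the form
  \<open>(u, v) \<mapsto> \<Sum>\<^sub>y u y \<cdot> v y\<close>: the reason is that the diagonal of \<open>Y \<times> Y\<close> is invariant.\<close>

lemma exists_dual_family:
  obtains B where "B \<in> lists (W \<times> W)"
    "\<And>u v. u \<in> W \<Longrightarrow> v \<in> W \<Longrightarrow> (\<Oplus>y\<in>Y. v y \<otimes> u y) \<in> K"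
    "\<And>u y. u \<in> W \<Longrightarrow> y \<in> Y \<Longrightarrow> u y = lsum E (\<lambda>(v, w). (\<Oplus>z\<in>Y. v z \<otimes> u z) \<otimes> w y) B"
proof -
  interpret gset_pair E K Y act Y act by unfold_locales
  obtain B where B: "B \<in> lists (W \<times> W)"
    "\<And>y z. y \<in> Y \<Longrightarrow> z \<in> Y \<Longrightarrow> (if y = z then \<one> else \<zero>) = lsum E (\<lambda>(u, v). u y \<otimes> v z) B"
    by (rule equivariant_maps_product[of "\<lambda>y z. if y = z then \<one> else \<zero>"]) (auto simp: act_eq_iff)
  have B_mem: "p \<in> set B \<Longrightarrow> fst p \<in> W \<and> snd p \<in> W" for p
    using B(1) by (auto simp: in_lists_conv_set)
  show thesis
  proof
    show "B \<in> lists (W \<times> W)" by fact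
    show "(\<Oplus>y\<in>Y. v y \<otimes> u y) \<in> K" if "u \<in> W" "v \<in> W" for u v
      using that by (intro sum_equivariant_K) (auto simp: W_act)
    fix u y assume u: "u \<in> W" and y: "y \<in> Y"
    have "u y = (\<Oplus>z\<in>Y. if z = y then u z else \<zero>)"
      using u y by (subst finsum_delta) auto
    also have "\<dots> = (\<Oplus>z\<in>Y. u z \<otimes> lsum E (\<lambda>(v, w). v z \<otimes> w y) B)"
      using u y by (intro finsum_cong' refl) (auto simp: B(2)[symmetric])
    also have "\<dots> = (\<Oplus>z\<in>Y. lsum E (\<lambda>(v, w). (v z \<otimes> u z) \<otimes> w y) B)"
      unfolding case_prod_unfold using u y B_mem
      by (intro finsum_cong' refl) (auto simp: lsum_rdistr m_ac intro!: lsum_cong)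
    also have "\<dots> = lsum E (\<lambda>(v, w). \<Oplus>z\<in>Y. (v z \<otimes> u z) \<otimes> w y) B"
      unfolding case_prod_unfold using u y B_mem by (intro lsum_finsum[symmetric]) auto
    also have "\<dots> = lsum E (\<lambda>(v, w). (\<Oplus>z\<in>Y. v z \<otimes> u z) \<otimes> w y) B"
      unfolding case_prod_unfold using u y B_mem
      by (intro lsum_cong finsum_ldistr[symmetric]) auto
    finally show "u y = lsum E (\<lambda>(v, w). (\<Oplus>z\<in>Y. v z \<otimes> u z) \<otimes> w y) B" .
  qed
qed

end

section \<open>Tensors over the base field\<close>

lemma self_module_simps [simp]:
  "carrier (self_module R) = carrier R"
  "x \<oplus>\<^bsub>self_module R\<^esub> y = x \<oplus>\<^bsub>R\<^esub> y"
  "a \<odot>\<^bsub>self_module R\<^esub> x = a \<otimes>\<^bsub>R\<^esub> x"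
  "\<zero>\<^bsub>self_module R\<^esub> = \<zero>\<^bsub>R\<^esub>" "\<one>\<^bsub>self_module R\<^esub> = \<one>\<^bsub>R\<^esub>"
  "x \<otimes>\<^bsub>self_module R\<^esub> y = x \<otimes>\<^bsub>R\<^esub> y"
  by (simp_all add: self_module_def)

lemma linear_mapsD:
  assumes "f \<in> linear_maps F M N"
  shows "x \<in> carrier M \<Longrightarrow> f x \<in> carrier N"
    "x \<in> carrier M \<Longrightarrow> y \<in> carrier M \<Longrightarrow> f (x \<oplus>\<^bsub>M\<^esub> y) = f x \<oplus>\<^bsub>N\<^esub> f y"
    "a \<in> carrier F \<Longrightarrow> x \<in> carrier M \<Longrightarrow> f (a \<odot>\<^bsub>M\<^esub> x) = a \<odot>\<^bsub>N\<^esub> f x"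
  using assms by (auto simp: linear_maps_def)

context galois_extension
begin

abbreviation "F \<equiv> E\<lparr>carrier := K\<rparr>"
abbreviation "functionals M \<equiv> linear_maps F M (self_module E)"

lemma functionalI:
  assumes "\<And>x. x \<in> carrier M \<Longrightarrow> f x \<in> carrier E"
    and "\<And>x y. x \<in> carrier M \<Longrightarrow> y \<in> carrier M \<Longrightarrow> f (x \<oplus>\<^bsub>M\<^esub> y) = f x \<oplus> f y"
    and "\<And>a x. a \<in> K \<Longrightarrow> x \<in> carrier M \<Longrightarrow> f (a \<odot>\<^bsub>M\<^esub> x) = a \<otimes> f x"
  shows "f \<in> functionals M"
  using assms by (auto simp: linear_maps_def)

lemma functionalD:
  assumes "f \<in> functionals M"
  shows "x \<in> carrier M \<Longrightarrow> f x \<in> carrier E"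
    "x \<in> carrier M \<Longrightarrow> y \<in> carrier M \<Longrightarrow> f (x \<oplus>\<^bsub>M\<^esub> y) = f x \<oplus> f y"
    "a \<in> K \<Longrightarrow> x \<in> carrier M \<Longrightarrow> f (a \<odot>\<^bsub>M\<^esub> x) = a \<otimes> f x"
  using linear_mapsD[OF assms] by auto

lemma functionals_mono: "linear_maps F M (self_module F) \<subseteq> functionals M"
  by (auto simp: linear_maps_def Pi_iff)

lemma lsum_functional:
  assumes "\<And>i. i \<in> set s \<Longrightarrow> c i \<in> carrier E" "\<And>i. i \<in> set s \<Longrightarrow> \<phi> i \<in> functionals M"
  shows "(\<lambda>x. lsum E (\<lambda>i. c i \<otimes> \<phi> i x) s) \<in> functionals M"
proof (rule functionalI)
  have \<phi>: "\<phi> i x \<in> carrier E" if "i \<in> set s" "x \<in> carrier M" for i x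
    using functionalD(1)[OF assms(2)] that by blast
  fix x assume x: "x \<in> carrier M"
  show "lsum E (\<lambda>i. c i \<otimes> \<phi> i x) s \<in> carrier E"
    using assms(1) \<phi> x by (intro lsum_closed m_closed)
  {
    fix y assume y: "y \<in> carrier M"
    have "lsum E (\<lambda>i. c i \<otimes> \<phi> i (x \<oplus>\<^bsub>M\<^esub> y)) s = lsum E (\<lambda>i. c i \<otimes> \<phi> i x \<oplus> c i \<otimes> \<phi> i y) s"
      using assms(1) \<phi> x y functionalD(2)[OF assms(2)] by (intro lsum_cong) (simp add: r_distr)
    also have "\<dots> = lsum E (\<lambda>i. c i \<otimes> \<phi> i x) s \<oplus> lsum E (\<lambda>i. c i \<otimes> \<phi> i y) s"
      using assms(1) \<phi> x y by (intro lsum_add m_closed)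
    finally show "lsum E (\<lambda>i. c i \<otimes> \<phi> i (x \<oplus>\<^bsub>M\<^esub> y)) s =
        lsum E (\<lambda>i. c i \<otimes> \<phi> i x) s \<oplus> lsum E (\<lambda>i. c i \<otimes> \<phi> i y) s" .
  }
  fix a assume a: "a \<in> K"
  have "lsum E (\<lambda>i. c i \<otimes> \<phi> i (a \<odot>\<^bsub>M\<^esub> x)) s = lsum E (\<lambda>i. a \<otimes> (c i \<otimes> \<phi> i x)) s"
    using assms(1) \<phi> a x functionalD(3)[OF assms(2)] by (intro lsum_cong) (simp add: m_lcomm)
  also have "\<dots> = a \<otimes> lsum E (\<lambda>i. c i \<otimes> \<phi> i x) s"
    using assms(1) \<phi> a x by (intro lsum_rdistr[symmetric]) auto
  finally show "lsum E (\<lambda>i. c i \<otimes> \<phi> i (a \<odot>\<^bsub>M\<^esub> x)) s = a \<otimes> lsum E (\<lambda>i. c i \<otimes> \<phi> i x) s" .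
qed

lemma lsum_scaled_swap:
  assumes "\<And>y i. y \<in> Y \<Longrightarrow> i \<in> set s \<Longrightarrow> g y i \<in> carrier E"
    and "\<And>y. y \<in> Y \<Longrightarrow> p y \<in> carrier E"
  shows "lsum E (\<lambda>i. \<Oplus>y\<in>Y. p y \<otimes> g y i) s = (\<Oplus>y\<in>Y. p y \<otimes> lsum E (g y) s)"
proof -
  have "lsum E (\<lambda>i. \<Oplus>y\<in>Y. p y \<otimes> g y i) s = (\<Oplus>y\<in>Y. lsum E (\<lambda>i. p y \<otimes> g y i) s)"
    using assms by (intro lsum_finsum) auto
  also have "\<dots> = (\<Oplus>y\<in>Y. p y \<otimes> lsum E (g y) s)"
    using assms by (intro finsum_cong' refl) (auto simp: lsum_rdistr)
  finally show ?thesis .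
qed

lemma lsum_scaled_swap2:
  assumes g: "\<And>y z i. y \<in> Y \<Longrightarrow> z \<in> Z \<Longrightarrow> i \<in> set s \<Longrightarrow> g y z i \<in> carrier E"
    and p: "\<And>y z. y \<in> Y \<Longrightarrow> z \<in> Z \<Longrightarrow> p y z \<in> carrier E"
  shows "lsum E (\<lambda>i. \<Oplus>y\<in>Y. \<Oplus>z\<in>Z. p y z \<otimes> g y z i) s = (\<Oplus>y\<in>Y. \<Oplus>z\<in>Z. p y z \<otimes> lsum E (g y z) s)"
proof -
  have "lsum E (\<lambda>i. \<Oplus>y\<in>Y. \<Oplus>z\<in>Z. p y z \<otimes> g y z i) s =
      (\<Oplus>y\<in>Y. lsum E (\<lambda>i. \<Oplus>z\<in>Z. p y z \<otimes> g y z i) s)"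
    using g p by (intro lsum_finsum finsum_closed funcsetI m_closed)
  also have "\<dots> = (\<Oplus>y\<in>Y. \<Oplus>z\<in>Z. p y z \<otimes> lsum E (g y z) s)"
  proof (rule finsum_cong')
    fix y assume y: "y \<in> Y"
    show "lsum E (\<lambda>i. \<Oplus>z\<in>Z. p y z \<otimes> g y z i) s = (\<Oplus>z\<in>Z. p y z \<otimes> lsum E (g y z) s)"
      using g p y by (intro lsum_scaled_swap)
  qed (use g p in \<open>auto intro!: finsum_closed funcsetI m_closed lsum_closed\<close>)
  finally show ?thesis .
qed

lemma lsum_scaled_swap3:
  assumes g: "\<And>x y z i. x \<in> A \<Longrightarrow> y \<in> Y \<Longrightarrow> z \<in> Z \<Longrightarrow> i \<in> set s \<Longrightarrow> g x y z i \<in> carrier E"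
    and p: "\<And>x y z. x \<in> A \<Longrightarrow> y \<in> Y \<Longrightarrow> z \<in> Z \<Longrightarrow> p x y z \<in> carrier E"
  shows "lsum E (\<lambda>i. \<Oplus>x\<in>A. \<Oplus>y\<in>Y. \<Oplus>z\<in>Z. p x y z \<otimes> g x y z i) s =
    (\<Oplus>x\<in>A. \<Oplus>y\<in>Y. \<Oplus>z\<in>Z. p x y z \<otimes> lsum E (g x y z) s)"
proof -
  have "lsum E (\<lambda>i. \<Oplus>x\<in>A. \<Oplus>y\<in>Y. \<Oplus>z\<in>Z. p x y z \<otimes> g x y z i) s =
      (\<Oplus>x\<in>A. lsum E (\<lambda>i. \<Oplus>y\<in>Y. \<Oplus>z\<in>Z. p x y z \<otimes> g x y z i) s)"
    using g p by (intro lsum_finsum finsum_closed funcsetI m_closed)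
  also have "\<dots> = (\<Oplus>x\<in>A. \<Oplus>y\<in>Y. \<Oplus>z\<in>Z. p x y z \<otimes> lsum E (g x y z) s)"
  proof (rule finsum_cong')
    fix x assume x: "x \<in> A"
    show "lsum E (\<lambda>i. \<Oplus>y\<in>Y. \<Oplus>z\<in>Z. p x y z \<otimes> g x y z i) s =
        (\<Oplus>y\<in>Y. \<Oplus>z\<in>Z. p x y z \<otimes> lsum E (g x y z) s)"
      using g p x by (intro lsum_scaled_swap2)
  qed (use g p in \<open>auto intro!: finsum_closed funcsetI m_closed lsum_closed\<close>)
  finally show ?thesis .
qed

text \<open>The module \<open>M\<close> over the base field is embedded by \<open>ev\<close> into the functions from a finite set to
  the top field in such a way that functionals of \<open>M\<close> are combinations of values. Therefore a
  multilinear form on such modules vanishes on all formal sums whose values vanish: this is the test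
  by which tensors are compared below.\<close>

definition coordinatized where
  "coordinatized M Y ev \<longleftrightarrow> finite Y \<and> (\<forall>y\<in>Y. ev y \<in> functionals M) \<and>
    (\<exists>B. B \<in> lists ((Y \<rightarrow> carrier E) \<times> carrier M) \<and>
      (\<forall>\<phi>\<in>functionals M. \<forall>u\<in>carrier M.
        \<phi> u = (\<Oplus>y\<in>Y. lsum E (\<lambda>(c, w). c y \<otimes> \<phi> w) B \<otimes> ev y u)))"

lemma coordinatizedD:
  assumes "coordinatized M Y ev"
  shows "finite Y" "y \<in> Y \<Longrightarrow> u \<in> carrier M \<Longrightarrow> ev y u \<in> carrier E"
  using assms functionalD(1)[of "ev y"] unfolding coordinatized_def by auto

lemma coordinatizedE:
  assumes "coordinatized M Y ev"
  obtains B where "finite Y" "\<And>y. y \<in> Y \<Longrightarrow> ev y \<in> functionals M"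
    "\<And>p y. p \<in> set B \<Longrightarrow> y \<in> Y \<Longrightarrow> fst p y \<in> carrier E" "\<And>p. p \<in> set B \<Longrightarrow> snd p \<in> carrier M"
    "\<And>\<phi> u. \<phi> \<in> functionals M \<Longrightarrow> u \<in> carrier M \<Longrightarrow>
      \<phi> u = (\<Oplus>y\<in>Y. lsum E (\<lambda>p. fst p y \<otimes> \<phi> (snd p)) B \<otimes> ev y u)"
proof -
  from assms obtain B where B: "finite Y" "\<forall>y\<in>Y. ev y \<in> functionals M"
    "B \<in> lists ((Y \<rightarrow> carrier E) \<times> carrier M)"
    "\<forall>\<phi>\<in>functionals M. \<forall>u\<in>carrier M.
        \<phi> u = (\<Oplus>y\<in>Y. lsum E (\<lambda>(c, w). c y \<otimes> \<phi> w) B \<otimes> ev y u)"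
    unfolding coordinatized_def by blast
  show thesis
    using B by (intro that[of B]) (auto simp: in_lists_conv_set case_prod_unfold mem_Times_iff)
qed

text \<open>Expand the form first in \<open>u\<close>; the coefficients are functionals of \<open>v\<close>.\<close>

lemma bilinear_form_expansion:
  assumes M: "coordinatized M Y ev" and N: "coordinatized N Z ev'"
    and b: "\<And>u. u \<in> carrier M \<Longrightarrow> b u \<in> functionals N"
      "\<And>v. v \<in> carrier N \<Longrightarrow> (\<lambda>u. b u v) \<in> functionals M"
  obtains p where "\<And>y z. y \<in> Y \<Longrightarrow> z \<in> Z \<Longrightarrow> p y z \<in> carrier E"
    "\<And>u v. u \<in> carrier M \<Longrightarrow> v \<in> carrier N \<Longrightarrow>
      b u v = (\<Oplus>y\<in>Y. \<Oplus>z\<in>Z. p y z \<otimes> (ev y u \<otimes> ev' z v))"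
proof -
  obtain B where B: "finite Y" "\<And>y. y \<in> Y \<Longrightarrow> ev y \<in> functionals M"
    "\<And>p y. p \<in> set B \<Longrightarrow> y \<in> Y \<Longrightarrow> fst p y \<in> carrier E" "\<And>p. p \<in> set B \<Longrightarrow> snd p \<in> carrier M"
    "\<And>\<phi> u. \<phi> \<in> functionals M \<Longrightarrow> u \<in> carrier M \<Longrightarrow>
      \<phi> u = (\<Oplus>y\<in>Y. lsum E (\<lambda>p. fst p y \<otimes> \<phi> (snd p)) B \<otimes> ev y u)"
    using M by (rule coordinatizedE) blast
  obtain C where C: "finite Z" "\<And>z. z \<in> Z \<Longrightarrow> ev' z \<in> functionals N"
    "\<And>p z. p \<in> set C \<Longrightarrow> z \<in> Z \<Longrightarrow> fst p z \<in> carrier E" "\<And>p. p \<in> set C \<Longrightarrow> snd p \<in> carrier N"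
    "\<And>\<phi> u. \<phi> \<in> functionals N \<Longrightarrow> u \<in> carrier N \<Longrightarrow>
      \<phi> u = (\<Oplus>z\<in>Z. lsum E (\<lambda>p. fst p z \<otimes> \<phi> (snd p)) C \<otimes> ev' z u)"
    using N by (rule coordinatizedE) blast
  define P where "P y v = lsum E (\<lambda>p. fst p y \<otimes> b (snd p) v) B" for y v
  have P: "P y \<in> functionals N" if "y \<in> Y" for y
    unfolding P_def using B(3,4) b(1) that by (intro lsum_functional) auto
  define p where "p y z = lsum E (\<lambda>q. fst q z \<otimes> P y (snd q)) C" for y z
  have p: "p y z \<in> carrier E" if "y \<in> Y" "z \<in> Z" for y z
    unfolding p_def using C(3,4) functionalD(1)[OF P] that by (intro lsum_closed) auto
  show thesis
  proof (rule that[of p])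
    show "p y z \<in> carrier E" if "y \<in> Y" "z \<in> Z" for y z by (rule p[OF that])
    fix u v assume u: "u \<in> carrier M" and v: "v \<in> carrier N"
    have ev: "ev y u \<in> carrier E" if "y \<in> Y" for y using functionalD(1)[OF B(2)] that u by blast
    have ev': "ev' z v \<in> carrier E" if "z \<in> Z" for z using functionalD(1)[OF C(2)] that v by blast
    have "b u v = (\<Oplus>y\<in>Y. P y v \<otimes> ev y u)"
      using B(5)[OF b(2)[OF v] u] by (simp add: P_def)
    also have "\<dots> = (\<Oplus>y\<in>Y. (\<Oplus>z\<in>Z. p y z \<otimes> ev' z v) \<otimes> ev y u)"
      using C(5)[OF P v] p ev ev' by (intro finsum_cong' refl) (auto simp: p_def)
    also have "\<dots> = (\<Oplus>y\<in>Y. \<Oplus>z\<in>Z. p y z \<otimes> (ev y u \<otimes> ev' z v))"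
    proof (intro finsum_cong' refl funcsetI)
      fix y assume y: "y \<in> Y"
      show "(\<Oplus>z\<in>Z. p y z \<otimes> ev' z v) \<otimes> ev y u =
          (\<Oplus>z\<in>Z. p y z \<otimes> (ev y u \<otimes> ev' z v))"
      using C(1) p ev ev' y
      by (intro finsum_ldistr_cong) (auto simp: m_ac)
    qed (use C(1) p ev ev' in \<open>auto intro!: finsum_closed\<close>)
    finally show "b u v = (\<Oplus>y\<in>Y. \<Oplus>z\<in>Z. p y z \<otimes> (ev y u \<otimes> ev' z v))" .
  qed
qed

lemma bilinear_mapsD:
  assumes "\<beta> \<in> bilinear_maps F M N (self_module F)"
  shows "u \<in> carrier M \<Longrightarrow> \<beta> u \<in> functionals N" "v \<in> carrier N \<Longrightarrow> (\<lambda>u. \<beta> u v) \<in> functionals M"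
  using assms functionals_mono unfolding bilinear_maps_def by blast+

lemma tensor_eqI:
  assumes M: "coordinatized M Y ev" and N: "coordinatized N Z ev'"
    and s: "s \<in> lists (carrier M \<times> carrier N)" and t: "t \<in> lists (carrier M \<times> carrier N)"
    and eq: "\<And>y z. y \<in> Y \<Longrightarrow> z \<in> Z \<Longrightarrow>
      lsum E (\<lambda>(u, v). ev y u \<otimes> ev' z v) s = lsum E (\<lambda>(u, v). ev y u \<otimes> ev' z v) t"
  shows "tensor_eq F M N s t"
  unfolding tensor_eq_def
proof
  fix \<beta> assume \<beta>: "\<beta> \<in> bilinear_maps F M N (self_module F)"
  note b = bilinear_mapsD[OF \<beta>]
  obtain p where p: "\<And>y z. y \<in> Y \<Longrightarrow> z \<in> Z \<Longrightarrow> p y z \<in> carrier E"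
    "\<And>u v. u \<in> carrier M \<Longrightarrow> v \<in> carrier N \<Longrightarrow>
      \<beta> u v = (\<Oplus>y\<in>Y. \<Oplus>z\<in>Z. p y z \<otimes> (ev y u \<otimes> ev' z v))"
    using bilinear_form_expansion[OF M N b] by blast
  have evs: "finite Y" "finite Z" "\<And>y u. y \<in> Y \<Longrightarrow> u \<in> carrier M \<Longrightarrow> ev y u \<in> carrier E"
    "\<And>z v. z \<in> Z \<Longrightarrow> v \<in> carrier N \<Longrightarrow> ev' z v \<in> carrier E"
    using coordinatizedD[OF M] coordinatizedD[OF N] by auto
  have "lsum E (\<lambda>(u, v). \<beta> u v) r =
      (\<Oplus>y\<in>Y. \<Oplus>z\<in>Z. p y z \<otimes> lsum E (\<lambda>(u, v). ev y u \<otimes> ev' z v) r)"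
    if r: "r \<in> lists (carrier M \<times> carrier N)" for r
  proof -
    have mem: "fst q \<in> carrier M" "snd q \<in> carrier N" if "q \<in> set r" for q
      using r that by (auto simp: in_lists_conv_set)
    have "lsum E (\<lambda>(u, v). \<beta> u v) r =
        lsum E (\<lambda>q. \<Oplus>y\<in>Y. \<Oplus>z\<in>Z. p y z \<otimes> (ev y (fst q) \<otimes> ev' z (snd q))) r"
      using mem p(2) by (intro lsum_cong) (simp add: case_prod_unfold)
    also have "\<dots> = (\<Oplus>y\<in>Y. \<Oplus>z\<in>Z. p y z \<otimes> lsum E (\<lambda>q. ev y (fst q) \<otimes> ev' z (snd q)) r)"
      using mem p(1) evs by (intro lsum_scaled_swap2) simp_all
    finally show ?thesis by (simp add: case_prod_unfold)
  qed
  from this[OF s] this[OF t]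
  have "lsum E (\<lambda>(u, v). \<beta> u v) s = lsum E (\<lambda>(u, v). \<beta> u v) t"
    using eq p(1) evs s t
    by (auto intro!: finsum_cong' finsum_closed simp: in_lists_conv_set case_prod_unfold mem_Times_iff)
  then show "lsum F (\<lambda>(u, v). \<beta> u v) s = lsum F (\<lambda>(u, v). \<beta> u v) t" by simp
qed

text \<open>Fixing the first argument reduces the expansion of a trilinear form to that of bilinear forms.\<close>

lemma tensor_eq3I:
  assumes M: "coordinatized M Y ev" and N: "coordinatized N Z ev'" and P: "coordinatized P V ev''"
    and s: "s \<in> lists (carrier M \<times> carrier N \<times> carrier P)"
    and t: "t \<in> lists (carrier M \<times> carrier N \<times> carrier P)"
    and eq: "\<And>x y z. x \<in> Y \<Longrightarrow> y \<in> Z \<Longrightarrow> z \<in> V \<Longrightarrow>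
      lsum E (\<lambda>(u, v, w). ev x u \<otimes> (ev' y v \<otimes> ev'' z w)) s =
      lsum E (\<lambda>(u, v, w). ev x u \<otimes> (ev' y v \<otimes> ev'' z w)) t"
  shows "tensor_eq3 F M N P s t"
  unfolding tensor_eq3_def
proof
  fix \<gamma> assume \<gamma>: "\<gamma> \<in> trilinear_maps F M N P (self_module F)"
  have g1: "\<gamma> u \<in> bilinear_maps F N P (self_module F)" if "u \<in> carrier M" for u
    using \<gamma> that by (auto simp: trilinear_maps_def)
  have g2: "(\<lambda>u. \<gamma> u v w) \<in> functionals M" if "v \<in> carrier N" "w \<in> carrier P" for v w
    using \<gamma> that functionals_mono[of M] unfolding trilinear_maps_def by blast
  obtain B where B: "finite Y" "\<And>y. y \<in> Y \<Longrightarrow> ev y \<in> functionals M"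
    "\<And>p y. p \<in> set B \<Longrightarrow> y \<in> Y \<Longrightarrow> fst p y \<in> carrier E" "\<And>p. p \<in> set B \<Longrightarrow> snd p \<in> carrier M"
    "\<And>\<phi> u. \<phi> \<in> functionals M \<Longrightarrow> u \<in> carrier M \<Longrightarrow>
      \<phi> u = (\<Oplus>y\<in>Y. lsum E (\<lambda>p. fst p y \<otimes> \<phi> (snd p)) B \<otimes> ev y u)"
    using M by (rule coordinatizedE) blast
  define b where "b x v w = lsum E (\<lambda>p. fst p x \<otimes> \<gamma> (snd p) v w) B" for x v w
  have b1: "b x v \<in> functionals P" if "x \<in> Y" "v \<in> carrier N" for x v
    unfolding b_def using B(3,4) that bilinear_mapsD(1)[OF g1]
    by (intro lsum_functional) auto
  have b2: "(\<lambda>v. b x v w) \<in> functionals N" if "x \<in> Y" "w \<in> carrier P" for x w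
    unfolding b_def using B(3,4) that bilinear_mapsD(2)[OF g1]
    by (intro lsum_functional) auto
  have "\<exists>p. (\<forall>y\<in>Z. \<forall>z\<in>V. p y z \<in> carrier E) \<and> (\<forall>v\<in>carrier N. \<forall>w\<in>carrier P.
      b x v w = (\<Oplus>y\<in>Z. \<Oplus>z\<in>V. p y z \<otimes> (ev' y v \<otimes> ev'' z w)))" if x: "x \<in> Y" for x
  proof -
    obtain p where "\<And>y z. y \<in> Z \<Longrightarrow> z \<in> V \<Longrightarrow> p y z \<in> carrier E"
      "\<And>v w. v \<in> carrier N \<Longrightarrow> w \<in> carrier P \<Longrightarrow>
        b x v w = (\<Oplus>y\<in>Z. \<Oplus>z\<in>V. p y z \<otimes> (ev' y v \<otimes> ev'' z w))"
      using bilinear_form_expansion[OF N P b1[OF x] b2[OF x]] by blast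
    then show ?thesis by (intro exI[of _ p]) simp
  qed
  then have "\<forall>x\<in>Y. \<exists>p. (\<forall>y\<in>Z. \<forall>z\<in>V. p y z \<in> carrier E) \<and> (\<forall>v\<in>carrier N. \<forall>w\<in>carrier P.
      b x v w = (\<Oplus>y\<in>Z. \<Oplus>z\<in>V. p y z \<otimes> (ev' y v \<otimes> ev'' z w)))" by blast
  from bchoice[OF this] obtain p where p: "\<And>x y z. x \<in> Y \<Longrightarrow> y \<in> Z \<Longrightarrow> z \<in> V \<Longrightarrow> p x y z \<in> carrier E"
    "\<And>x v w. x \<in> Y \<Longrightarrow> v \<in> carrier N \<Longrightarrow> w \<in> carrier P \<Longrightarrow>
      b x v w = (\<Oplus>y\<in>Z. \<Oplus>z\<in>V. p x y z \<otimes> (ev' y v \<otimes> ev'' z w))"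
    by blast
  have evs: "finite Z" "finite V" "\<And>y u. y \<in> Y \<Longrightarrow> u \<in> carrier M \<Longrightarrow> ev y u \<in> carrier E"
    "\<And>y v. y \<in> Z \<Longrightarrow> v \<in> carrier N \<Longrightarrow> ev' y v \<in> carrier E"
    "\<And>z w. z \<in> V \<Longrightarrow> w \<in> carrier P \<Longrightarrow> ev'' z w \<in> carrier E"
    using coordinatizedD[OF M] coordinatizedD[OF N] coordinatizedD[OF P] by auto
  have \<gamma>_eq: "\<gamma> u v w = (\<Oplus>x\<in>Y. \<Oplus>y\<in>Z. \<Oplus>z\<in>V. p x y z \<otimes> (ev x u \<otimes> (ev' y v \<otimes> ev'' z w)))"
    if u: "u \<in> carrier M" and v: "v \<in> carrier N" and w: "w \<in> carrier P" for u v w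
  proof -
    have "\<gamma> u v w = (\<Oplus>x\<in>Y. b x v w \<otimes> ev x u)"
      using B(5)[OF g2[OF v w] u] by (simp add: b_def)
    also have "\<dots> = (\<Oplus>x\<in>Y. \<Oplus>y\<in>Z. \<Oplus>z\<in>V. p x y z \<otimes> (ev x u \<otimes> (ev' y v \<otimes> ev'' z w)))"
    proof (intro finsum_cong' refl funcsetI)
      fix x assume x: "x \<in> Y"
      have "b x v w \<otimes> ev x u = (\<Oplus>y\<in>Z. (\<Oplus>z\<in>V. p x y z \<otimes> (ev' y v \<otimes> ev'' z w)) \<otimes> ev x u)"
        unfolding p(2)[OF x v w] using p(1) evs u v w x
        by (intro finsum_ldistr) (auto intro!: finsum_closed)
      also have "\<dots> = (\<Oplus>y\<in>Z. \<Oplus>z\<in>V. p x y z \<otimes> (ev x u \<otimes> (ev' y v \<otimes> ev'' z w)))"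
      proof (intro finsum_cong' refl funcsetI)
        fix y assume y: "y \<in> Z"
        show "(\<Oplus>z\<in>V. p x y z \<otimes> (ev' y v \<otimes> ev'' z w)) \<otimes> ev x u =
            (\<Oplus>z\<in>V. p x y z \<otimes> (ev x u \<otimes> (ev' y v \<otimes> ev'' z w)))"
      using p(1) evs u v w x y
      by (intro finsum_ldistr_cong) (auto simp: m_ac)
      qed (use p(1) evs u v w x in \<open>auto intro!: finsum_closed\<close>)
      finally show "b x v w \<otimes> ev x u =
          (\<Oplus>y\<in>Z. \<Oplus>z\<in>V. p x y z \<otimes> (ev x u \<otimes> (ev' y v \<otimes> ev'' z w)))" .
    qed (use p(1) evs u v w in \<open>auto intro!: finsum_closed\<close>)
    finally show ?thesis .
  qed
  have "lsum E (\<lambda>(u, v, w). \<gamma> u v w) r = (\<Oplus>x\<in>Y. \<Oplus>y\<in>Z. \<Oplus>z\<in>V.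
      p x y z \<otimes> lsum E (\<lambda>(u, v, w). ev x u \<otimes> (ev' y v \<otimes> ev'' z w)) r)"
    if r: "r \<in> lists (carrier M \<times> carrier N \<times> carrier P)" for r
  proof -
    have mem: "fst q \<in> carrier M" "fst (snd q) \<in> carrier N" "snd (snd q) \<in> carrier P"
      if "q \<in> set r" for q
      using r that by (auto simp: in_lists_conv_set)
    let ?e = "\<lambda>x y z q. ev x (fst q) \<otimes> (ev' y (fst (snd q)) \<otimes> ev'' z (snd (snd q)))"
    have e: "?e x y z q \<in> carrier E" if "x \<in> Y" "y \<in> Z" "z \<in> V" "q \<in> set r" for x y z q
      using that mem evs by auto
    have "lsum E (\<lambda>(u, v, w). \<gamma> u v w) r =
        lsum E (\<lambda>q. \<Oplus>x\<in>Y. \<Oplus>y\<in>Z. \<Oplus>z\<in>V. p x y z \<otimes> ?e x y z q) r"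
      using mem by (intro lsum_cong) (simp add: case_prod_unfold \<gamma>_eq)
    also have "\<dots> = (\<Oplus>x\<in>Y. \<Oplus>y\<in>Z. \<Oplus>z\<in>V. p x y z \<otimes> lsum E (?e x y z) r)"
      using p(1) e by (intro lsum_scaled_swap3)
    finally show ?thesis by (simp add: case_prod_unfold)
  qed
  note expand = this[OF s] this[OF t]
  have "lsum E (\<lambda>(u, v, w). \<gamma> u v w) s = lsum E (\<lambda>(u, v, w). \<gamma> u v w) t"
    unfolding expand using eq p(1) evs t
    by (intro finsum_cong' refl)
      (auto intro!: finsum_closed lsum_closed m_closed simp: in_lists_conv_set mem_Times_iff)
  then show "lsum F (\<lambda>(u, v, w). \<gamma> u v w) s = lsum F (\<lambda>(u, v, w). \<gamma> u v w) t" by simp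
qed

text \<open>Tensors are compared by forms with values in the base field. The forms \<open>trace (d\<^sub>i \<cdot> \<phi> u \<cdot> \<psi> v)\<close> are
  of this kind, and their values determine \<open>\<phi> u \<cdot> \<psi> v\<close> by the coordinate expansion.\<close>

lemma tensor_eq_imp_lsum_eq:
  assumes eq: "tensor_eq F M N s t"
    and s: "s \<in> lists (carrier M \<times> carrier N)" and t: "t \<in> lists (carrier M \<times> carrier N)"
    and \<phi>: "\<phi> \<in> functionals M" and \<psi>: "\<psi> \<in> functionals N"
  shows "lsum E (\<lambda>(u, v). \<phi> u \<otimes> \<psi> v) s = lsum E (\<lambda>(u, v). \<phi> u \<otimes> \<psi> v) t"
proof -
  let ?x = "\<lambda>r. lsum E (\<lambda>(u, v). \<phi> u \<otimes> \<psi> v) r"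
  note \<phi>D = functionalD[OF \<phi>] and \<psi>D = functionalD[OF \<psi>]
  have closed: "?x r \<in> carrier E" if "r \<in> lists (carrier M \<times> carrier N)" for r
    using that \<phi>D(1) \<psi>D(1) by (auto simp: in_lists_conv_set case_prod_unfold mem_Times_iff)
  have tr: "trace (d \<otimes> ?x s) = trace (d \<otimes> ?x t)" if d: "d \<in> carrier E" for d
  proof -
    define \<beta> where "\<beta> u v = trace (d \<otimes> (\<phi> u \<otimes> \<psi> v))" for u v
    have "\<beta> \<in> bilinear_maps F M N (self_module F)"
      unfolding bilinear_maps_def linear_maps_def \<beta>_def
    proof (intro CollectI conjI ballI funcsetI, goal_cases)
      case (1 u v)
      then show ?case using d \<phi>D \<psi>D by (simp add: trace_K)
    next
      case (2 u v w)
      then show ?case using d \<phi>D \<psi>D by (simp add: trace_add[symmetric] r_distr)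
    next
      case (3 u a v)
      then have "d \<otimes> (\<phi> u \<otimes> (a \<otimes> \<psi> v)) = a \<otimes> (d \<otimes> (\<phi> u \<otimes> \<psi> v))"
        using d \<phi>D(1) \<psi>D(1) by (simp add: m_ac)
      then show ?case using 3 d \<phi>D \<psi>D by (simp add: trace_K_mult)
    next
      case (4 v u)
      then show ?case using d \<phi>D \<psi>D by (simp add: trace_K)
    next
      case (5 v u w)
      then show ?case using d \<phi>D \<psi>D by (simp add: trace_add[symmetric] r_distr l_distr)
    next
      case (6 v a u)
      then have "d \<otimes> ((a \<otimes> \<phi> u) \<otimes> \<psi> v) = a \<otimes> (d \<otimes> (\<phi> u \<otimes> \<psi> v))"
        using d \<phi>D(1) \<psi>D(1) by (simp add: m_ac)
      then show ?case using 6 d \<phi>D \<psi>D by (simp add: trace_K_mult)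
    qed
    then have "lsum E (\<lambda>(u, v). \<beta> u v) s = lsum E (\<lambda>(u, v). \<beta> u v) t"
      using eq by (simp add: tensor_eq_def)
    moreover have "trace (d \<otimes> ?x r) = lsum E (\<lambda>(u, v). \<beta> u v) r"
      if r: "r \<in> lists (carrier M \<times> carrier N)" for r
    proof -
      have mem: "fst q \<in> carrier M" "snd q \<in> carrier N" if "q \<in> set r" for q
        using r that by (auto simp: in_lists_conv_set)
      have "trace (d \<otimes> ?x r) = trace (lsum E (\<lambda>q. d \<otimes> (\<phi> (fst q) \<otimes> \<psi> (snd q))) r)"
        using mem d \<phi>D(1) \<psi>D(1) by (simp add: case_prod_unfold lsum_rdistr)
      also have "\<dots> = lsum E (\<lambda>q. trace (d \<otimes> (\<phi> (fst q) \<otimes> \<psi> (snd q)))) r"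
        using mem d \<phi>D(1) \<psi>D(1) trace_K_mult[of \<zero> \<zero>] K_subring(2)
        by (intro lsum_additive abelian_monoid_axioms) (auto simp: trace_add)
      finally show ?thesis by (simp add: \<beta>_def case_prod_unfold)
    qed
    ultimately show ?thesis using s t by simp
  qed
  have "?x s = lsum E (\<lambda>(d, e). trace (d \<otimes> ?x s) \<otimes> e) coords"
    using coords_expansion[OF closed[OF s]] ..
  also have "\<dots> = lsum E (\<lambda>(d, e). trace (d \<otimes> ?x t) \<otimes> e) coords"
    by (intro lsum_cong) (auto simp: tr dest!: coords_mem)
  also have "\<dots> = ?x t"
    by (rule coords_expansion[OF closed[OF t]])
  finally show ?thesis .
qed

end

context gset
begin

text \<open>By descent the indicator function of \<open>z\<close> is a combination of equivariant functions.\<close>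

lemma equivariant_maps_separate_coefficients:
  assumes c: "\<And>y. y \<in> Y \<Longrightarrow> c y \<in> carrier E" "\<And>y. y \<in> Y \<Longrightarrow> c' y \<in> carrier E"
    and eq: "\<And>w. w \<in> W \<Longrightarrow> (\<Oplus>y\<in>Y. c y \<otimes> w y) = (\<Oplus>y\<in>Y. c' y \<otimes> w y)"
    and z: "z \<in> Y"
  shows "c z = c' z"
proof -
  obtain s where s: "s \<in> lists (carrier E \<times> W)"
    "\<And>y. y \<in> Y \<Longrightarrow> (if y = z then \<one> else \<zero>) = lsum E (\<lambda>(d, w). d \<otimes> w y) s"
    by (rule equivariant_maps_span[of "\<lambda>y. if y = z then \<one> else \<zero>"]) auto
  have mem: "fst p \<in> carrier E" "snd p \<in> W" if "p \<in> set s" for p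
    using s(1) that by (auto simp: in_lists_conv_set)
  have "c z = lsum E (\<lambda>p. fst p \<otimes> (\<Oplus>y\<in>Y. c y \<otimes> snd p y)) s"
    if c: "\<And>y. y \<in> Y \<Longrightarrow> c y \<in> carrier E" for c
  proof -
    have "c z = (\<Oplus>y\<in>Y. if y = z then c y else \<zero>)"
      using c z by (subst finsum_delta) auto
    also have "\<dots> = (\<Oplus>y\<in>Y. c y \<otimes> lsum E (\<lambda>p. fst p \<otimes> snd p y) s)"
    proof (intro finsum_cong' refl funcsetI)
      fix y assume y: "y \<in> Y"
      have "lsum E (\<lambda>p. fst p \<otimes> snd p y) s = (if y = z then \<one> else \<zero>)"
        unfolding s(2)[OF y] by (simp add: case_prod_unfold)
      then show "(if y = z then c y else \<zero>) = c y \<otimes> lsum E (\<lambda>p. fst p \<otimes> snd p y) s"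
        using c[OF y] by (cases "y = z") simp_all
    qed (use c mem in auto)
    also have "\<dots> = lsum E (\<lambda>p. \<Oplus>y\<in>Y. c y \<otimes> (fst p \<otimes> snd p y)) s"
      using c mem by (intro lsum_scaled_swap[symmetric]) auto
    also have "\<dots> = lsum E (\<lambda>p. fst p \<otimes> (\<Oplus>y\<in>Y. c y \<otimes> snd p y)) s"
    proof (intro lsum_cong)
      fix p assume p: "p \<in> set s"
      show "(\<Oplus>y\<in>Y. c y \<otimes> (fst p \<otimes> snd p y)) = fst p \<otimes> (\<Oplus>y\<in>Y. c y \<otimes> snd p y)"
      using c mem[OF p]
      by (intro finsum_rdistr_cong[symmetric]) (auto simp: m_lcomm)
    qed
    finally show ?thesis .
  qed
  from this[of c] this[of c'] show ?thesis
    using c eq mem(2) by (simp cong: lsum_cong)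
qed

text \<open>The dual family of the equivariant functions provides the coefficients. The condition on the zero
  of \<open>M\<close> is there because functionals are only required to be additive and homogeneous.\<close>

lemma coordinatizedI:
  assumes M: "abelian_monoid M" "\<zero>\<^bsub>M\<^esub> = \<zero>\<^bsub>F\<^esub> \<odot>\<^bsub>M\<^esub> \<zero>\<^bsub>M\<^esub>"
    and smult: "\<And>a x. a \<in> K \<Longrightarrow> x \<in> carrier M \<Longrightarrow> a \<odot>\<^bsub>M\<^esub> x \<in> carrier M"
    and ev: "\<And>y. y \<in> Y \<Longrightarrow> ev y \<in> functionals M"
    and eqv: "\<And>x. x \<in> carrier M \<Longrightarrow> (\<lambda>y\<in>Y. ev y x) \<in> W"
    and surj: "\<And>w. w \<in> W \<Longrightarrow> \<exists>x\<in>carrier M. \<forall>y\<in>Y. ev y x = w y"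
    and inj: "\<And>x x'. x \<in> carrier M \<Longrightarrow> x' \<in> carrier M \<Longrightarrow> (\<And>y. y \<in> Y \<Longrightarrow> ev y x = ev y x') \<Longrightarrow> x = x'"
  shows "coordinatized M Y ev"
proof -
  interpret M: abelian_monoid M by fact
  obtain B where B: "B \<in> lists (W \<times> W)"
    "\<And>u v. u \<in> W \<Longrightarrow> v \<in> W \<Longrightarrow> (\<Oplus>y\<in>Y. v y \<otimes> u y) \<in> K"
    "\<And>u y. u \<in> W \<Longrightarrow> y \<in> Y \<Longrightarrow> u y = lsum E (\<lambda>(v, w). (\<Oplus>z\<in>Y. v z \<otimes> u z) \<otimes> w y) B"
    using exists_dual_family by blast
  have B_mem: "p \<in> set B \<Longrightarrow> fst p \<in> W \<and> snd p \<in> W" for p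
    using B(1) by (auto simp: in_lists_conv_set)
  obtain r where r: "\<And>w. w \<in> W \<Longrightarrow> r w \<in> carrier M" "\<And>w y. w \<in> W \<Longrightarrow> y \<in> Y \<Longrightarrow> ev y (r w) = w y"
    using surj by metis
  let ?B = "map (\<lambda>p. (fst p, r (snd p))) B"
  have "\<phi> u = (\<Oplus>y\<in>Y. lsum E (\<lambda>(c, w). c y \<otimes> \<phi> w) ?B \<otimes> ev y u)"
    if \<phi>: "\<phi> \<in> functionals M" and u: "u \<in> carrier M" for \<phi> u
  proof -
    note \<phi>D = functionalD[OF \<phi>]
    have evc: "ev y x \<in> carrier E" if "y \<in> Y" "x \<in> carrier M" for x y
      using functionalD(1)[OF ev] that by blast
    let ?k = "\<lambda>p. \<Oplus>z\<in>Y. fst p z \<otimes> ev z u"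
    have k: "?k p \<in> K" if "p \<in> set B" for p
    proof -
      have "?k p = (\<Oplus>z\<in>Y. fst p z \<otimes> (\<lambda>y\<in>Y. ev y u) z)"
        using B_mem[OF that] evc u by (intro finsum_cong' refl) auto
      also have "\<dots> \<in> K" using B(2)[OF eqv[OF u]] B_mem[OF that] by blast
      finally show ?thesis .
    qed
    have terms: "?k p \<odot>\<^bsub>M\<^esub> r (snd p) \<in> carrier M" if "p \<in> set B" for p
      using k[OF that] B_mem[OF that] r(1) smult by blast
    have zero: "f \<zero>\<^bsub>M\<^esub> = \<zero>" if f: "f \<in> functionals M" for f
    proof -
      have "f \<zero>\<^bsub>M\<^esub> = f (\<zero>\<^bsub>F\<^esub> \<odot>\<^bsub>M\<^esub> \<zero>\<^bsub>M\<^esub>)" using M(2) by simp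
      also have "\<dots> = \<zero>"
        using functionalD(3)[OF f, of \<zero> "\<zero>\<^bsub>M\<^esub>"] functionalD(1)[OF f, of "\<zero>\<^bsub>M\<^esub>"] K_subring(2) M.zero_closed by simp
      finally show ?thesis .
    qed
    have f_lsum: "f (lsum M (\<lambda>p. ?k p \<odot>\<^bsub>M\<^esub> r (snd p)) B) = lsum E (\<lambda>p. ?k p \<otimes> f (r (snd p))) B"
      if f: "f \<in> functionals M" for f
    proof -
      have "f (lsum M (\<lambda>p. ?k p \<odot>\<^bsub>M\<^esub> r (snd p)) B) = lsum E (\<lambda>p. f (?k p \<odot>\<^bsub>M\<^esub> r (snd p))) B"
        using terms zero[OF f] functionalD(2)[OF f] by (intro lsum_additive M(1)) auto
      also have "\<dots> = lsum E (\<lambda>p. ?k p \<otimes> f (r (snd p))) B"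
        using k B_mem r(1) functionalD(3)[OF f] by (intro lsum_cong) blast
      finally show ?thesis .
    qed
    have "u = lsum M (\<lambda>p. ?k p \<odot>\<^bsub>M\<^esub> r (snd p)) B"
    proof (rule inj[OF u])
      show "lsum M (\<lambda>p. ?k p \<odot>\<^bsub>M\<^esub> r (snd p)) B \<in> carrier M"
        using terms by (rule M.lsum_closed)
      fix y assume y: "y \<in> Y"
      have "ev y u = lsum E (\<lambda>(v, w). (\<Oplus>z\<in>Y. v z \<otimes> (\<lambda>y\<in>Y. ev y u) z) \<otimes> w y) B"
        using B(3)[OF eqv[OF u] y] y by simp
      also have "\<dots> = lsum E (\<lambda>p. ?k p \<otimes> ev y (r (snd p))) B"
        using B_mem evc u y r(2)
        by (intro lsum_cong)
          (auto simp: case_prod_unfold intro!: arg_cong2[where f = "(\<otimes>)"] finsum_cong')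
      also have "\<dots> = ev y (lsum M (\<lambda>p. ?k p \<odot>\<^bsub>M\<^esub> r (snd p)) B)"
        using f_lsum[OF ev[OF y]] ..
      finally show "ev y u = ev y (lsum M (\<lambda>p. ?k p \<odot>\<^bsub>M\<^esub> r (snd p)) B)" .
    qed
    then have "\<phi> u = lsum E (\<lambda>p. ?k p \<otimes> \<phi> (r (snd p))) B"
      using f_lsum[OF \<phi>] by simp
    also have "\<dots> = lsum E (\<lambda>p. \<Oplus>y\<in>Y. (fst p y \<otimes> \<phi> (r (snd p))) \<otimes> ev y u) B"
    proof (intro lsum_cong)
      fix p assume p: "p \<in> set B"
      have c: "\<phi> (r (snd p)) \<in> carrier E" using B_mem[OF p] r(1) \<phi>D(1) by blast
      show "?k p \<otimes> \<phi> (r (snd p)) =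
          (\<Oplus>y\<in>Y. (fst p y \<otimes> \<phi> (r (snd p))) \<otimes> ev y u)"
      using B_mem[OF p] evc u c
      by (intro finsum_ldistr_cong) (auto simp: m_ac)
    qed
    also have "\<dots> = (\<Oplus>y\<in>Y. lsum E (\<lambda>p. (fst p y \<otimes> \<phi> (r (snd p))) \<otimes> ev y u) B)"
      using B_mem evc u r(1) \<phi>D(1) by (intro lsum_finsum) auto
    also have "\<dots> = (\<Oplus>y\<in>Y. lsum E (\<lambda>(c, w). c y \<otimes> \<phi> w) ?B \<otimes> ev y u)"
      unfolding lsum_map using B_mem evc u r(1) \<phi>D(1)
      by (intro finsum_cong' refl) (auto simp: lsum_ldistr)
    finally show ?thesis .
  qed
  moreover have "?B \<in> lists ((Y \<rightarrow> carrier E) \<times> carrier M)"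
    using B_mem r(1) by (auto simp: in_lists_conv_set)
  ultimately show ?thesis
    unfolding coordinatized_def using ev finite_Y by blast
qed

end

section \<open>The coset space of an intermediate field\<close>

lemma gal_not_fixing:
  "g \<in> carrier (gal E K) \<Longrightarrow> g \<notin> carrier (gal E L) \<Longrightarrow> \<exists>l\<in>L. g l \<noteq> l"
  by (auto simp: gal_def)

lemma BijGroup_mult_apply:
  "n \<in> carrier (BijGroup A) \<Longrightarrow> m \<in> carrier (BijGroup A) \<Longrightarrow> x \<in> A \<Longrightarrow>
    (n \<otimes>\<^bsub>BijGroup A\<^esub> m) x = n (m x)"
  by (simp add: BijGroup_def compose_def)

lemma BijGroup_one_apply: "x \<in> A \<Longrightarrow> \<one>\<^bsub>BijGroup A\<^esub> x = x"
  by (simp add: BijGroup_def)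

lemma BijGroup_apply_closed: "n \<in> carrier (BijGroup A) \<Longrightarrow> x \<in> A \<Longrightarrow> n x \<in> A"
  by (auto simp: BijGroup_def dest!: Bij_imp_funcset)

locale intermediate_field = galois_extension +
  fixes L
  assumes subfield_L: "subfield L E" and K_subset_L: "K \<subseteq> L"
begin

abbreviation "S \<equiv> carrier (gal E L)"
abbreviation "\<Omega> \<equiv> coset_space E K L"
abbreviation "base \<equiv> base_coset E K L"
abbreviation "\<tau> \<equiv> translation E K L"
abbreviation "P \<equiv> perm E K L"

lemma L_carrier: "L \<subseteq> carrier E"
  using subfield_L by (rule subfieldE(3))

lemma L_mem [simp]: "l \<in> L \<Longrightarrow> l \<in> carrier E"
  using L_carrier by auto

lemmas L_subring = subringE[OF subfieldE(1)[OF subfield_L]]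

sublocale S: subgroup S G
  using K_subset_L L_carrier by (rule subgroup_gal)

lemma S_G: "s \<in> S \<Longrightarrow> s \<in> carrier G"
  by (rule S.mem_carrier)

lemma S_fix: "s \<in> S \<Longrightarrow> l \<in> L \<Longrightarrow> s l = l"
  by (rule gal_memD(3))

text \<open>A map that is linear over \<open>L\<close> is a combination of automorphisms over \<open>K\<close>, and by independence only
  automorphisms over \<open>L\<close> occur in it; so it is linear over their fixed field as well. If it kills
  \<open>\<one>\<close>, it therefore kills the whole fixed field, whereas an element outside \<open>L\<close> could be separated
  from \<open>\<one>\<close> by such a map.\<close>

lemma fixed_points_S:
  assumes x: "x \<in> carrier E" and fixed: "\<And>s. s \<in> S \<Longrightarrow> s x = x"
  shows "x \<in> L"
proof (rule ccontr)
  assume "x \<notin> L"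
  have fin: "finite_dimension L (carrier E)"
  proof -
    obtain Us where Us: "set Us \<subseteq> carrier E" "Span K Us = carrier E"
      using finite_dim exists_base[OF subfield_K] by (metis finite_dimensionE')
    have "carrier E \<subseteq> Span L Us"
      using Us Span_mem_iff_length_version[OF subfield_K Us(1)]
        Span_mem_iff_length_version[OF subfield_L Us(1)] K_subset_L by blast
    then have "Span L Us = carrier E"
      using Span_in_carrier[OF L_carrier Us(1)] by auto
    then show ?thesis
      using Span_finite_dimension[OF subfield_L Us(1)] by simp
  qed
  obtain f where f: "f \<in> carrier E \<rightarrow> carrier E"
    "\<And>u v. u \<in> carrier E \<Longrightarrow> v \<in> carrier E \<Longrightarrow> f (u \<oplus> v) = f u \<oplus> f v"
    "\<And>l u. l \<in> L \<Longrightarrow> u \<in> carrier E \<Longrightarrow> f (l \<otimes> u) = l \<otimes> f u"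
    "f \<one> = \<zero>" "f x = \<one>"
    using exists_linear_map_separating_one[OF subfield_L fin x \<open>x \<notin> L\<close>] by blast
  have fK: "f (k \<otimes> u) = k \<otimes> f u" if "k \<in> K" "u \<in> carrier E" for k u
    using f(3) that K_subset_L by auto
  obtain c where c: "c \<in> carrier G \<rightarrow> carrier E"
    "\<And>u. u \<in> carrier E \<Longrightarrow> f u = (\<Oplus>g\<in>carrier G. c g \<otimes> g u)"
    using linear_map_eq_sum_automorphisms[OF f(1,2) fK] by blast
  have cc: "c g \<in> carrier E" if "g \<in> carrier G" for g using c(1) that by auto
  have supp: "c g = \<zero>" if g: "g \<in> carrier G" "g \<notin> S" for g
  proof -
    obtain l where l: "l \<in> L" "g l \<noteq> l"
      using gal_not_fixing[OF g] by blast
    \<comment> \<open>Linearity over \<open>L\<close> says \<open>f (l \<cdot> u) - l \<cdot> f u = \<zero>\<close>, a relation among automorphisms with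
      coefficients \<open>c g \<cdot> (g l - l)\<close>.\<close>
    have "c g \<otimes> (g l \<ominus> l) = \<zero>"
    proof (rule dedekind[where c = "\<lambda>g. c g \<otimes> (g l \<ominus> l)" and h = g])
      show "c g \<otimes> (g l \<ominus> l) \<in> carrier E" if "g \<in> carrier G" for g
        using that cc l by simp
      fix u assume u: "u \<in> carrier E"
      have "c g \<otimes> (g l \<ominus> l) \<otimes> g u = c g \<otimes> g (l \<otimes> u) \<oplus> (\<ominus> l) \<otimes> (c g \<otimes> g u)"
        if g: "g \<in> carrier G" for g
      proof -
        have "c g \<in> carrier E" "g l \<in> carrier E" "g u \<in> carrier E" "l \<in> carrier E"
          using cc l u g by auto
        moreover have "g (l \<otimes> u) = g l \<otimes> g u" using l u g by simp
        ultimately show ?thesis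
          by (simp only: minus_eq r_distr l_distr l_minus r_minus m_ac m_closed a_inv_closed)
      qed
      then have "(\<Oplus>g\<in>carrier G. c g \<otimes> (g l \<ominus> l) \<otimes> g u) =
          (\<Oplus>g\<in>carrier G. c g \<otimes> g (l \<otimes> u) \<oplus> (\<ominus> l) \<otimes> (c g \<otimes> g u))"
        using cc l u by (intro finsum_cong' refl) auto
      also have "\<dots> = (\<Oplus>g\<in>carrier G. c g \<otimes> g (l \<otimes> u)) \<oplus> (\<Oplus>g\<in>carrier G. (\<ominus> l) \<otimes> (c g \<otimes> g u))"
        using cc l u by (intro finsum_addf) auto
      also have "(\<Oplus>g\<in>carrier G. (\<ominus> l) \<otimes> (c g \<otimes> g u)) = (\<ominus> l) \<otimes> (\<Oplus>g\<in>carrier G. c g \<otimes> g u)"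
        using cc l u by (intro finsum_rdistr[symmetric]) auto
      also have "(\<Oplus>g\<in>carrier G. c g \<otimes> g (l \<otimes> u)) = f (l \<otimes> u)"
        using c(2) l u by simp
      also have "(\<Oplus>g\<in>carrier G. c g \<otimes> g u) = f u"
        using c(2) u by simp
      also have "f (l \<otimes> u) \<oplus> (\<ominus> l) \<otimes> f u = \<zero>"
        using f(1,3) l u by (auto simp: l_minus r_neg Pi_iff)
      finally show "(\<Oplus>g\<in>carrier G. c g \<otimes> (g l \<ominus> l) \<otimes> g u) = \<zero>" .
    qed (fact g(1))
    moreover have "g l \<ominus> l \<noteq> \<zero>" using l g by simp
    ultimately show ?thesis
      using cc[OF g(1)] g l by (metis L_mem gal_closed integral minus_closed)
  qed
  have "f x = (\<Oplus>g\<in>carrier G. c g \<otimes> g \<one> \<otimes> x)"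
    unfolding c(2)[OF x]
  proof (intro finsum_cong' refl funcsetI)
    fix g assume g: "g \<in> carrier G"
    show "c g \<otimes> g x = c g \<otimes> g \<one> \<otimes> x"
      using supp[OF g] fixed[of g] cc[OF g] g x by (cases "g \<in> S") auto
  qed (use cc x in auto)
  also have "\<dots> = f \<one> \<otimes> x"
    using cc x by (simp add: c(2) finsum_ldistr Pi_def)
  finally show False using f(4,5) x by simp
qed

lemma lcos_eq_iff:
  assumes "g \<in> carrier G" "h \<in> carrier G"
  shows "g <#\<^bsub>G\<^esub> S = h <#\<^bsub>G\<^esub> S \<longleftrightarrow> inv\<^bsub>G\<^esub> g \<otimes>\<^bsub>G\<^esub> h \<in> S"
proof
  assume "g <#\<^bsub>G\<^esub> S = h <#\<^bsub>G\<^esub> S"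
  then have "h \<in> g <#\<^bsub>G\<^esub> S" using G.lcos_self[OF assms(2) S.subgroup_axioms] by simp
  then show "inv\<^bsub>G\<^esub> g \<otimes>\<^bsub>G\<^esub> h \<in> S"
    using S.lcos_module_imp[OF G.group_axioms assms(1)] by blast
next
  assume "inv\<^bsub>G\<^esub> g \<otimes>\<^bsub>G\<^esub> h \<in> S"
  then have "h \<in> g <#\<^bsub>G\<^esub> S"
    using S.lcos_module_rev[OF G.group_axioms assms] by blast
  then show "g <#\<^bsub>G\<^esub> S = h <#\<^bsub>G\<^esub> S"
    using G.l_repr_independence[OF _ assms(1) S.subgroup_axioms] by blast
qed

lemma lcos_mem [simp]: "g \<in> carrier G \<Longrightarrow> g <#\<^bsub>G\<^esub> S \<in> \<Omega>"
  by (auto simp: coset_space_def LCOSETS_def)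

lemma coset_cases:
  assumes "C \<in> \<Omega>"
  obtains g where "g \<in> carrier G" "C = g <#\<^bsub>G\<^esub> S"
  using assms by (auto simp: coset_space_def LCOSETS_def)

lemma base_mem [simp]: "base \<in> \<Omega>"
  using lcos_mem[of "\<one>\<^bsub>G\<^esub>"] by (simp add: base_coset_def)

lemma translation_lcos:
  "g \<in> carrier G \<Longrightarrow> h \<in> carrier G \<Longrightarrow> \<tau> g (h <#\<^bsub>G\<^esub> S) = (g \<otimes>\<^bsub>G\<^esub> h) <#\<^bsub>G\<^esub> S"
  using G.lcos_m_assoc[OF S.subset] by (simp add: translation_def)

lemma translation_base: "g \<in> carrier G \<Longrightarrow> \<tau> g base = g <#\<^bsub>G\<^esub> S"
  using translation_lcos[of g "\<one>\<^bsub>G\<^esub>"] by (simp add: base_coset_def)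

lemma finite_cosets: "finite \<Omega>"
  by (auto simp: coset_space_def LCOSETS_def)

sublocale X: gset E K \<Omega> \<tau>
proof (unfold_locales, goal_cases)
  case 1 show ?case by (rule finite_cosets)
next
  case (2 g C) then show ?case by (auto elim!: coset_cases simp: translation_lcos)
next
  case (3 C) then show ?case by (auto elim!: coset_cases simp: translation_lcos)
next
  case (4 g h C) then show ?case by (auto elim!: coset_cases simp: translation_lcos G.m_assoc)
qed

lemma coset_as_translate:
  assumes "C \<in> \<Omega>"
  obtains g where "g \<in> carrier G" "C = \<tau> g base"
  using assms by (auto elim!: coset_cases simp: translation_base)

lemma translation_base_eq_iff: "g \<in> carrier G \<Longrightarrow> \<tau> g base = base \<longleftrightarrow> g \<in> S"
proof -
  assume g: "g \<in> carrier G"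
  have "\<tau> g base = base \<longleftrightarrow> \<one>\<^bsub>G\<^esub> <#\<^bsub>G\<^esub> S = g <#\<^bsub>G\<^esub> S"
    unfolding translation_base[OF g] unfolding base_coset_def by (rule eq_commute)
  also have "\<dots> \<longleftrightarrow> g \<in> S"
    unfolding lcos_eq_iff[OF G.one_closed g] using g by (simp only: G.inv_one G.l_one)
  finally show ?thesis .
qed

lemma translation_perm: "g \<in> carrier G \<Longrightarrow> \<tau> g \<in> carrier P"
  using X.bij_betw_act[of g] by (simp add: BijGroup_def Bij_def translation_def)

lemma perm_mult_apply: "n \<in> carrier P \<Longrightarrow> m \<in> carrier P \<Longrightarrow> C \<in> \<Omega> \<Longrightarrow> (n \<otimes>\<^bsub>P\<^esub> m) C = n (m C)"
  by (rule BijGroup_mult_apply)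

lemma perm_one_apply: "C \<in> \<Omega> \<Longrightarrow> \<one>\<^bsub>P\<^esub> C = C"
  by (rule BijGroup_one_apply)

lemma perm_closed: "n \<in> carrier P \<Longrightarrow> C \<in> \<Omega> \<Longrightarrow> n C \<in> \<Omega>"
  by (rule BijGroup_apply_closed)

sublocale P: group P
  by (rule group_BijGroup)

lemma perm_inv_apply:
  assumes "n \<in> carrier P" "C \<in> \<Omega>"
  shows "(inv\<^bsub>P\<^esub> n) (n C) = C" "n ((inv\<^bsub>P\<^esub> n) C) = C"
  using assms perm_mult_apply[of "inv\<^bsub>P\<^esub> n" n C] perm_mult_apply[of n "inv\<^bsub>P\<^esub> n" C]
  by (auto simp: perm_one_apply)

lemma perm_eqI:
  assumes "n \<in> carrier P" "m \<in> carrier P" "\<And>C. C \<in> \<Omega> \<Longrightarrow> n C = m C"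
  shows "n = m"
  using assms by (auto simp: BijGroup_def dest!: Bij_imp_extensional intro: extensionalityI)

lemma translation_mult:
  "g \<in> carrier G \<Longrightarrow> h \<in> carrier G \<Longrightarrow> \<tau> (g \<otimes>\<^bsub>G\<^esub> h) = \<tau> g \<otimes>\<^bsub>P\<^esub> \<tau> h"
  by (intro perm_eqI) (auto simp: translation_perm perm_mult_apply X.act_mult)

lemma translation_one: "\<tau> \<one>\<^bsub>G\<^esub> = \<one>\<^bsub>P\<^esub>"
  by (intro perm_eqI) (auto simp: translation_perm perm_one_apply)

text \<open>The value does not depend on the representative, since elements of \<open>S\<close> fix \<open>L\<close>.\<close>

lemma coset_apply_lcos:
  assumes "g \<in> carrier G" "x \<in> L"
  shows "coset_apply (g <#\<^bsub>G\<^esub> S) x = g x"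
  unfolding coset_apply_def
proof (rule the_equality)
  show "\<exists>h\<in>g <#\<^bsub>G\<^esub> S. g x = h x"
    using G.lcos_self[OF assms(1) S.subgroup_axioms] by blast
  show "y = g x" if "\<exists>h\<in>g <#\<^bsub>G\<^esub> S. y = h x" for y
  proof -
    obtain s where s: "s \<in> S" "y = (g \<otimes>\<^bsub>G\<^esub> s) x" using \<open>\<exists>h\<in>g <#\<^bsub>G\<^esub> S. y = h x\<close> by (auto simp: l_coset_def)
    then show ?thesis using assms S_G[OF s(1)] S_fix[OF s(1) assms(2)] by simp
  qed
qed

lemma coset_apply_closed [simp]: "C \<in> \<Omega> \<Longrightarrow> x \<in> L \<Longrightarrow> coset_apply C x \<in> carrier E"
  by (auto elim!: coset_cases simp: coset_apply_lcos)

lemma coset_apply_translation: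
  "g \<in> carrier G \<Longrightarrow> C \<in> \<Omega> \<Longrightarrow> x \<in> L \<Longrightarrow> coset_apply (\<tau> g C) x = g (coset_apply C x)"
  by (auto elim!: coset_cases simp: translation_lcos coset_apply_lcos)

lemma coset_apply_base: "x \<in> L \<Longrightarrow> coset_apply base x = x"
  using coset_apply_lcos[of "\<one>\<^bsub>G\<^esub>" x] by (simp add: base_coset_def)

lemma coset_apply_mult:
  "C \<in> \<Omega> \<Longrightarrow> x \<in> L \<Longrightarrow> y \<in> L \<Longrightarrow> coset_apply C (x \<otimes> y) = coset_apply C x \<otimes> coset_apply C y"
  and coset_apply_add:
  "C \<in> \<Omega> \<Longrightarrow> x \<in> L \<Longrightarrow> y \<in> L \<Longrightarrow> coset_apply C (x \<oplus> y) = coset_apply C x \<oplus> coset_apply C y"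
  and coset_apply_K: "C \<in> \<Omega> \<Longrightarrow> k \<in> K \<Longrightarrow> coset_apply C k = k"
  using L_subring(6,7) K_subset_L by (auto elim!: coset_cases simp: coset_apply_lcos)

lemma coset_apply_equivariant: "x \<in> L \<Longrightarrow> (\<lambda>C\<in>\<Omega>. coset_apply C x) \<in> X.W"
  by (auto simp: equivariant_maps_def coset_apply_translation)

text \<open>An equivariant function on the coset space is determined by its value at the base coset, which
  is fixed by the stabilizer \<open>S\<close> and therefore lies in \<open>L\<close>.\<close>

lemma equivariant_imp_coset_apply:
  assumes w: "w \<in> X.W"
  shows "w base \<in> L" "C \<in> \<Omega> \<Longrightarrow> coset_apply C (w base) = w C"
proof -
  show wL: "w base \<in> L"
  proof (rule fixed_points_S)
    show "s (w base) = w base" if "s \<in> S" for s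
      using X.W_act[OF w S_G[OF that] base_mem] translation_base_eq_iff[OF S_G[OF that]] that by simp
  qed (use w in auto)
  show "coset_apply C (w base) = w C" if C: "C \<in> \<Omega>"
  proof -
    obtain g where g: "g \<in> carrier G" "C = \<tau> g base" using C by (rule coset_as_translate)
    then show ?thesis
      using coset_apply_translation[OF g(1) base_mem wL] coset_apply_base[OF wL]
        X.W_act[OF w g(1) base_mem] by simp
  qed
qed

abbreviation "L_module \<equiv> (self_module E)\<lparr>carrier := L\<rparr>"

lemma abelian_monoid_L: "abelian_monoid L_module"
  using L_subring by (intro abelian_monoidI) (auto simp: a_ac)

lemma coordinatized_L: "coordinatized L_module \<Omega> coset_apply"
proof (rule X.coordinatizedI)
  show "abelian_monoid L_module" by (rule abelian_monoid_L)
  show "\<zero>\<^bsub>L_module\<^esub> = \<zero>\<^bsub>F\<^esub> \<odot>\<^bsub>L_module\<^esub> \<zero>\<^bsub>L_module\<^esub>" by simp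
  show "a \<odot>\<^bsub>L_module\<^esub> x \<in> carrier L_module" if "a \<in> K" "x \<in> carrier L_module" for a x
    using that K_subset_L L_subring(6) by auto
  show "coset_apply C \<in> functionals L_module" if "C \<in> \<Omega>" for C
    using that K_subset_L
    by (intro functionalI) (auto simp: coset_apply_add coset_apply_mult coset_apply_K subset_iff)
  show "(\<lambda>C\<in>\<Omega>. coset_apply C x) \<in> X.W" if "x \<in> carrier L_module" for x
    using that by (intro coset_apply_equivariant) simp
  show "\<exists>x\<in>carrier L_module. \<forall>C\<in>\<Omega>. coset_apply C x = w C" if "w \<in> X.W" for w
    using equivariant_imp_coset_apply[OF that] by (intro bexI[of _ "w base"]) auto
  show "x = x'" if "x \<in> carrier L_module" "x' \<in> carrier L_module"
    "\<And>C. C \<in> \<Omega> \<Longrightarrow> coset_apply C x = coset_apply C x'" for x x'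
    using that(1,2) that(3)[OF base_mem] by (simp add: coset_apply_base)
qed

text \<open>Independence of the embeddings of \<open>L\<close>: elements of \<open>L\<close> provide all equivariant functions on the
  coset space, and these separate coefficients.\<close>

lemma dedekind_cosets:
  assumes z: "\<And>C. C \<in> \<Omega> \<Longrightarrow> z C \<in> carrier E" "\<And>C. C \<in> \<Omega> \<Longrightarrow> z' C \<in> carrier E"
    and eq: "\<And>x. x \<in> L \<Longrightarrow>
      (\<Oplus>C\<in>\<Omega>. z C \<otimes> coset_apply C x) = (\<Oplus>C\<in>\<Omega>. z' C \<otimes> coset_apply C x)"
    and D: "D \<in> \<Omega>"
  shows "z D = z' D"
proof (rule X.equivariant_maps_separate_coefficients[OF z _ D])
  fix w assume w: "w \<in> X.W"
  have "(\<Oplus>C\<in>\<Omega>. c C \<otimes> w C) = (\<Oplus>C\<in>\<Omega>. c C \<otimes> coset_apply C (w base))"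
    if "\<And>C. C \<in> \<Omega> \<Longrightarrow> c C \<in> carrier E" for c
    using that w equivariant_imp_coset_apply[OF w] by (intro finsum_cong' refl) auto
  then show "(\<Oplus>C\<in>\<Omega>. z C \<otimes> w C) = (\<Oplus>C\<in>\<Omega>. z' C \<otimes> w C)"
    using z eq equivariant_imp_coset_apply(1)[OF w] by simp
qed

end

section \<open>Regular stable subgroups\<close>

locale regular_stable = intermediate_field +
  fixes N
  assumes regular_stable: "regular_stable_subgroup E K L N"
begin

sublocale N: subgroup N P
  using regular_stable by (simp add: regular_stable_subgroup_def)

lemma N_P [simp]: "n \<in> N \<Longrightarrow> n \<in> carrier P"
  by (rule N.mem_carrier)

lemma regular: "C \<in> \<Omega> \<Longrightarrow> D \<in> \<Omega> \<Longrightarrow> \<exists>!n. n \<in> N \<and> n C = D"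
  using regular_stable by (simp add: regular_stable_subgroup_def)

lemma regular_eqI: "n \<in> N \<Longrightarrow> m \<in> N \<Longrightarrow> C \<in> \<Omega> \<Longrightarrow> n C = m C \<Longrightarrow> n = m"
  using regular[of C "n C"] perm_closed[of n C] by auto

lemma N_closed [simp]: "n \<in> N \<Longrightarrow> C \<in> \<Omega> \<Longrightarrow> n C \<in> \<Omega>"
  by (simp add: perm_closed)

definition conj where "conj g n = \<tau> g \<otimes>\<^bsub>P\<^esub> n \<otimes>\<^bsub>P\<^esub> inv\<^bsub>P\<^esub> (\<tau> g)"

lemma conj_closed [simp]: "g \<in> carrier G \<Longrightarrow> n \<in> N \<Longrightarrow> conj g n \<in> N"
  using regular_stable by (simp add: regular_stable_subgroup_def conj_def)

lemma conj_mult: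
  "g \<in> carrier G \<Longrightarrow> n \<in> N \<Longrightarrow> m \<in> N \<Longrightarrow> conj g (n \<otimes>\<^bsub>P\<^esub> m) = conj g n \<otimes>\<^bsub>P\<^esub> conj g m"
  using translation_perm[of g] by (simp add: conj_def P.m_assoc P.inv_solve_left)

lemma conj_one [simp]: "g \<in> carrier G \<Longrightarrow> conj g \<one>\<^bsub>P\<^esub> = \<one>\<^bsub>P\<^esub>"
  using translation_perm[of g] by (simp add: conj_def)

lemma conj_inv: "g \<in> carrier G \<Longrightarrow> n \<in> N \<Longrightarrow> conj g (inv\<^bsub>P\<^esub> n) = inv\<^bsub>P\<^esub> (conj g n)"
  using translation_perm[of g] by (simp add: conj_def P.inv_mult_group P.m_assoc)

lemma conj_apply_translation:
  "g \<in> carrier G \<Longrightarrow> n \<in> N \<Longrightarrow> C \<in> \<Omega> \<Longrightarrow> conj g n (\<tau> g C) = \<tau> g (n C)"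
  using translation_perm[of g] by (simp add: conj_def perm_mult_apply perm_inv_apply)

lemma finite_N: "finite N"
proof (rule finite_imageD)
  show "finite ((\<lambda>n. n base) ` N)"
    by (rule finite_subset[OF _ finite_cosets]) auto
  show "inj_on (\<lambda>n. n base) N"
    by (intro inj_onI) (auto intro: regular_eqI[where C = base])
qed

sublocale N: gset E K N conj
proof (unfold_locales, goal_cases)
  case 1 show ?case by (rule finite_N)
next
  case (2 g n) then show ?case by simp
next
  case (3 n) then show ?case by (simp add: conj_def translation_one)
next
  case (4 g h n)
  then show ?case
    using translation_perm[of g] translation_perm[of h]
    by (simp add: conj_def translation_mult P.inv_mult_group P.m_assoc)
qed

lemma fixed_group_algebra_eq: "fixed_group_algebra E K L N = N.W"
  by (simp add: fixed_group_algebra_def equivariant_maps_def conj_def)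

text \<open>The element \<open>n\<close> of the group algebra acts on \<open>L\<close> as the embedding given by this coset.\<close>

definition twist where "twist n = (inv\<^bsub>P\<^esub> n) base"

lemma twist_mem [simp]: "n \<in> N \<Longrightarrow> twist n \<in> \<Omega>"
  by (simp add: twist_def)

lemma bij_betw_twist: "bij_betw twist N \<Omega>"
  unfolding bij_betw_def
proof
  show "inj_on twist N"
  proof (rule inj_onI)
    fix n m assume nm: "n \<in> N" "m \<in> N" "twist n = twist m"
    then have "inv\<^bsub>P\<^esub> n = inv\<^bsub>P\<^esub> m"
      by (intro regular_eqI[of _ _ base]) (auto simp: twist_def)
    then show "n = m" using nm P.inv_inv by (metis N_P)
  qed
  show "twist ` N = \<Omega>"
  proof
    show "\<Omega> \<subseteq> twist ` N"
    proof
      fix C assume "C \<in> \<Omega>"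
      then obtain n where n: "n \<in> N" "n base = C" using regular[of base C] by auto
      then have "C = twist (inv\<^bsub>P\<^esub> n)" by (simp add: twist_def)
      then show "C \<in> twist ` N" using n by blast
    qed
  qed auto
qed

lemma finsum_twist:
  assumes "\<And>C. C \<in> \<Omega> \<Longrightarrow> f C \<in> carrier E"
  shows "(\<Oplus>n\<in>N. f (twist n)) = (\<Oplus>C\<in>\<Omega>. f C)"
  by (rule finsum_reindex_bij[OF bij_betw_twist assms])

text \<open>For every \<open>g\<close>, the inverse of \<open>conj g n\<close> takes \<open>\<tau> g base\<close> to \<open>\<tau> g (twist n)\<close>; if \<open>g\<close> lies in
  \<open>S\<close>, then \<open>\<tau> g base\<close> is the base coset.\<close>

lemma twist_conj_stabilizer: "s \<in> S \<Longrightarrow> n \<in> N \<Longrightarrow> twist (conj s n) = \<tau> s (twist n)"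
  using conj_apply_translation[of s "inv\<^bsub>P\<^esub> n" base] translation_base_eq_iff[of s]
  by (simp add: twist_def conj_inv S_G)

end

section \<open>The fixed points of the group algebra form a Hopf algebra\<close>

context regular_stable
begin

abbreviation "A \<equiv> greither_pareigis E K L N"

lemma gp_carrier [simp]: "carrier A = N.W"
  by (simp add: greither_pareigis_def fixed_group_algebra_eq)

lemma gp_mult: "a \<otimes>\<^bsub>A\<^esub> b = (\<lambda>n\<in>N. \<Oplus>m\<in>N. a m \<otimes> b (inv\<^bsub>P\<^esub> m \<otimes>\<^bsub>P\<^esub> n))"
  and gp_one: "\<one>\<^bsub>A\<^esub> = (\<lambda>n\<in>N. if n = \<one>\<^bsub>P\<^esub> then \<one> else \<zero>)"
  and gp_zero: "\<zero>\<^bsub>A\<^esub> = (\<lambda>n\<in>N. \<zero>)"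
  and gp_add: "a \<oplus>\<^bsub>A\<^esub> b = (\<lambda>n\<in>N. a n \<oplus> b n)"
  and gp_smult: "k \<odot>\<^bsub>A\<^esub> a = (\<lambda>n\<in>N. k \<otimes> a n)"
  and gp_counit: "counit A a = (\<Oplus>n\<in>N. a n)"
  and gp_action: "action A a x = (\<Oplus>n\<in>N. a n \<otimes> coset_apply (twist n) x)"
  by (simp_all add: greither_pareigis_def twist_def)

lemma gp_apply [simp]:
  assumes "n \<in> N"
  shows "(a \<otimes>\<^bsub>A\<^esub> b) n = (\<Oplus>m\<in>N. a m \<otimes> b (inv\<^bsub>P\<^esub> m \<otimes>\<^bsub>P\<^esub> n))"
    "\<one>\<^bsub>A\<^esub> n = (if n = \<one>\<^bsub>P\<^esub> then \<one> else \<zero>)" "\<zero>\<^bsub>A\<^esub> n = \<zero>"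
    "(a \<oplus>\<^bsub>A\<^esub> b) n = a n \<oplus> b n" "(k \<odot>\<^bsub>A\<^esub> a) n = k \<otimes> a n"
  using assms by (simp_all add: gp_mult gp_one gp_zero gp_add gp_smult)

lemma gp_comult: "s \<in> comult A a \<longleftrightarrow> s \<in> lists (N.W \<times> N.W) \<and>
    (\<forall>m\<in>N. \<forall>n\<in>N. lsum E (\<lambda>(u, v). u m \<otimes> v n) s = (if m = n then a n else \<zero>))"
  by (simp add: greither_pareigis_def fixed_group_algebra_eq)

lemma gp_lsum: "n \<in> N \<Longrightarrow> lsum A f s n = lsum E (\<lambda>x. f x n) s"
  by (induction s) (auto simp: gp_zero gp_add)

lemma N_ops [simp]:
  "\<one>\<^bsub>P\<^esub> \<in> N" "n \<in> N \<Longrightarrow> m \<in> N \<Longrightarrow> n \<otimes>\<^bsub>P\<^esub> m \<in> N" "n \<in> N \<Longrightarrow> inv\<^bsub>P\<^esub> n \<in> N"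
  by (auto simp: N.m_closed)

lemma N_cancel [simp]:
  "n \<in> N \<Longrightarrow> m \<in> N \<Longrightarrow> inv\<^bsub>P\<^esub> n \<otimes>\<^bsub>P\<^esub> (n \<otimes>\<^bsub>P\<^esub> m) = m"
  "n \<in> N \<Longrightarrow> m \<in> N \<Longrightarrow> n \<otimes>\<^bsub>P\<^esub> (inv\<^bsub>P\<^esub> n \<otimes>\<^bsub>P\<^esub> m) = m"
  by (simp_all add: P.m_assoc[symmetric])

lemma finsum_N_lmult:
  assumes "k \<in> N" "\<And>n. n \<in> N \<Longrightarrow> f n \<in> carrier E"
  shows "(\<Oplus>n\<in>N. f (k \<otimes>\<^bsub>P\<^esub> n)) = (\<Oplus>n\<in>N. f n)"
  using assms
  by (intro finsum_reindex_bij bij_betwI[where g = "\<lambda>n. inv\<^bsub>P\<^esub> k \<otimes>\<^bsub>P\<^esub> n"]) auto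

lemma finsum_N_inv:
  assumes "\<And>n. n \<in> N \<Longrightarrow> f n \<in> carrier E"
  shows "(\<Oplus>n\<in>N. f (inv\<^bsub>P\<^esub> n)) = (\<Oplus>n\<in>N. f n)"
  using assms by (intro finsum_reindex_bij bij_betwI[where g = "\<lambda>n. inv\<^bsub>P\<^esub> n"]) auto

lemma finsum_N_conj:
  assumes "g \<in> carrier G" "\<And>n. n \<in> N \<Longrightarrow> f n \<in> carrier E"
  shows "(\<Oplus>n\<in>N. f (conj g n)) = (\<Oplus>n\<in>N. f n)"
  using assms by (intro finsum_reindex_bij N.bij_betw_act)

lemma N_W_I:
  assumes "\<And>n. n \<in> N \<Longrightarrow> u n \<in> carrier E" "\<And>n. n \<notin> N \<Longrightarrow> u n = undefined"
    and "\<And>g n. g \<in> carrier G \<Longrightarrow> n \<in> N \<Longrightarrow> u (conj g n) = g (u n)"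
  shows "u \<in> N.W"
  unfolding equivariant_maps_def
  by (intro CollectI conjI ballI PiE_I) (simp_all only: assms not_False_eq_True)

lemma N_W_eqI: "u \<in> N.W \<Longrightarrow> v \<in> N.W \<Longrightarrow> (\<And>n. n \<in> N \<Longrightarrow> u n = v n) \<Longrightarrow> u = v"
  unfolding equivariant_maps_def
  by (rule PiE_ext[where k = N and s = "\<lambda>_. carrier E"]) simp_all

lemma mult_closed:
  assumes a: "a \<in> N.W" and b: "b \<in> N.W"
  shows "a \<otimes>\<^bsub>A\<^esub> b \<in> N.W"
proof (rule N_W_I)
  fix g n assume g: "g \<in> carrier G" and n: "n \<in> N"
  have "(a \<otimes>\<^bsub>A\<^esub> b) (conj g n) = (\<Oplus>m\<in>N. a (conj g m) \<otimes> b (inv\<^bsub>P\<^esub> (conj g m) \<otimes>\<^bsub>P\<^esub> conj g n))"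
    using g n a b
      finsum_N_conj[OF g, of "\<lambda>m. a m \<otimes> b (inv\<^bsub>P\<^esub> m \<otimes>\<^bsub>P\<^esub> conj g n)"] by (simp add: gp_mult)
  also have "\<dots> = (\<Oplus>m\<in>N. g (a m \<otimes> b (inv\<^bsub>P\<^esub> m \<otimes>\<^bsub>P\<^esub> n)))"
    using g n a b
    by (intro finsum_cong' refl)
      (simp_all add: conj_inv[symmetric] conj_mult[symmetric] N.W_act Pi_def)
  also have "\<dots> = g ((a \<otimes>\<^bsub>A\<^esub> b) n)"
    using g n a b by (simp add: gp_mult)
  finally show "(a \<otimes>\<^bsub>A\<^esub> b) (conj g n) = g ((a \<otimes>\<^bsub>A\<^esub> b) n)" .
qed (use a b in \<open>auto simp: gp_mult\<close>)

lemma one_closed_W: "\<one>\<^bsub>A\<^esub> \<in> N.W"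
proof (rule N_W_I)
  fix g n assume g: "g \<in> carrier G" and n: "n \<in> N"
  have "conj g n = \<one>\<^bsub>P\<^esub> \<longleftrightarrow> n = \<one>\<^bsub>P\<^esub>"
    using N.act_eq_iff[OF g n N_ops(1)] g by simp
  then show "\<one>\<^bsub>A\<^esub> (conj g n) = g (\<one>\<^bsub>A\<^esub> n)"
    using g n by (simp add: gp_one)
qed (auto simp: gp_one)

lemma zero_closed_W: "\<zero>\<^bsub>A\<^esub> \<in> N.W"
  by (rule N_W_I) (auto simp: gp_zero)

lemma add_closed_W: "a \<in> N.W \<Longrightarrow> b \<in> N.W \<Longrightarrow> a \<oplus>\<^bsub>A\<^esub> b \<in> N.W"
  by (rule N_W_I) (auto simp: gp_add N.W_act)

lemma smult_closed_W: "k \<in> K \<Longrightarrow> a \<in> N.W \<Longrightarrow> k \<odot>\<^bsub>A\<^esub> a \<in> N.W"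
  by (rule N_W_I) (auto simp: gp_smult N.W_act)

lemma abelian_group_gp: "abelian_group A"
proof (rule abelian_groupI, goal_cases)
  case (6 a)
  have "(\<lambda>n\<in>N. \<ominus> a n) \<in> N.W"
    using 6 by (intro N_W_I) (auto simp: N.W_act)
  moreover from this have "(\<lambda>n\<in>N. \<ominus> a n) \<oplus>\<^bsub>A\<^esub> a = \<zero>\<^bsub>A\<^esub>"
    using 6 by (intro N_W_eqI) (auto simp: l_neg add_closed_W zero_closed_W)
  ultimately show ?case by auto
qed (auto simp: add_closed_W zero_closed_W a_ac intro: N_W_eqI)

lemma mult_assoc_W:
  assumes a: "a \<in> N.W" and b: "b \<in> N.W" and c: "c \<in> N.W"
  shows "(a \<otimes>\<^bsub>A\<^esub> b) \<otimes>\<^bsub>A\<^esub> c = a \<otimes>\<^bsub>A\<^esub> (b \<otimes>\<^bsub>A\<^esub> c)"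
proof (rule N_W_eqI)
  fix n assume n: "n \<in> N"
  let ?t = "\<lambda>k m. a k \<otimes> (b (inv\<^bsub>P\<^esub> k \<otimes>\<^bsub>P\<^esub> m) \<otimes> c (inv\<^bsub>P\<^esub> m \<otimes>\<^bsub>P\<^esub> n))"
  have "((a \<otimes>\<^bsub>A\<^esub> b) \<otimes>\<^bsub>A\<^esub> c) n =
      (\<Oplus>m\<in>N. (\<Oplus>k\<in>N. a k \<otimes> b (inv\<^bsub>P\<^esub> k \<otimes>\<^bsub>P\<^esub> m)) \<otimes> c (inv\<^bsub>P\<^esub> m \<otimes>\<^bsub>P\<^esub> n))"
    using a b c n by (simp add: gp_mult cong: finsum_cong)
  also have "\<dots> = (\<Oplus>m\<in>N. \<Oplus>k\<in>N. ?t k m)"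
  proof (intro finsum_cong' refl funcsetI)
    fix m assume m: "m \<in> N"
    show "(\<Oplus>k\<in>N. a k \<otimes> b (inv\<^bsub>P\<^esub> k \<otimes>\<^bsub>P\<^esub> m)) \<otimes> c (inv\<^bsub>P\<^esub> m \<otimes>\<^bsub>P\<^esub> n) = (\<Oplus>k\<in>N. ?t k m)"
      using a b c n m
      by (intro finsum_ldistr_cong) (auto simp: m_assoc)
  qed (use a b c n in auto)
  also have "\<dots> = (\<Oplus>k\<in>N. \<Oplus>m\<in>N. ?t k m)"
    using a b c n by (intro finsum_swap) auto
  also have "\<dots> = (\<Oplus>k\<in>N. a k \<otimes> (b \<otimes>\<^bsub>A\<^esub> c) (inv\<^bsub>P\<^esub> k \<otimes>\<^bsub>P\<^esub> n))"
  proof (intro finsum_cong' refl funcsetI)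
    fix k assume k: "k \<in> N"
    have "(\<Oplus>m\<in>N. ?t k m) = (\<Oplus>m\<in>N. ?t k (k \<otimes>\<^bsub>P\<^esub> m))"
      using a b c n k by (intro finsum_N_lmult[symmetric]) auto
    also have "\<dots> = (\<Oplus>m\<in>N. a k \<otimes> (b m \<otimes> c (inv\<^bsub>P\<^esub> m \<otimes>\<^bsub>P\<^esub> (inv\<^bsub>P\<^esub> k \<otimes>\<^bsub>P\<^esub> n))))"
      using a b c n k by (intro finsum_cong' refl) (auto simp: P.inv_mult_group P.m_assoc)
    also have "\<dots> = a k \<otimes> (b \<otimes>\<^bsub>A\<^esub> c) (inv\<^bsub>P\<^esub> k \<otimes>\<^bsub>P\<^esub> n)"
      using a b c n k by (simp add: gp_mult finsum_rdistr Pi_def)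
    finally show "(\<Oplus>m\<in>N. ?t k m) = a k \<otimes> (b \<otimes>\<^bsub>A\<^esub> c) (inv\<^bsub>P\<^esub> k \<otimes>\<^bsub>P\<^esub> n)" .
  qed (use a b c n mult_closed in auto)
  also have "\<dots> = (a \<otimes>\<^bsub>A\<^esub> (b \<otimes>\<^bsub>A\<^esub> c)) n"
    using n by (simp add: gp_mult)
  finally show "((a \<otimes>\<^bsub>A\<^esub> b) \<otimes>\<^bsub>A\<^esub> c) n = (a \<otimes>\<^bsub>A\<^esub> (b \<otimes>\<^bsub>A\<^esub> c)) n" .
qed (use a b c mult_closed in auto)

lemma one_mult_W: "a \<in> N.W \<Longrightarrow> \<one>\<^bsub>A\<^esub> \<otimes>\<^bsub>A\<^esub> a = a"
proof (rule N_W_eqI)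
  fix n assume a: "a \<in> N.W" and n: "n \<in> N"
  have "(\<one>\<^bsub>A\<^esub> \<otimes>\<^bsub>A\<^esub> a) n = (\<Oplus>m\<in>N. if m = \<one>\<^bsub>P\<^esub> then a (inv\<^bsub>P\<^esub> m \<otimes>\<^bsub>P\<^esub> n) else \<zero>)"
    using a n by (simp add: gp_mult gp_one) (intro finsum_cong' refl, auto)
  also have "\<dots> = a n"
    using a n by (subst finsum_delta) auto
  finally show "(\<one>\<^bsub>A\<^esub> \<otimes>\<^bsub>A\<^esub> a) n = a n" .
qed (auto simp: mult_closed one_closed_W)

lemma mult_one_W: "a \<in> N.W \<Longrightarrow> a \<otimes>\<^bsub>A\<^esub> \<one>\<^bsub>A\<^esub> = a"
proof (rule N_W_eqI)
  fix n assume a: "a \<in> N.W" and n: "n \<in> N"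
  have "inv\<^bsub>P\<^esub> m \<otimes>\<^bsub>P\<^esub> n = \<one>\<^bsub>P\<^esub> \<longleftrightarrow> m = n" if "m \<in> N" for m
    using that n P.inv_solve_left'[of "\<one>\<^bsub>P\<^esub>" m n] by auto
  then have "(a \<otimes>\<^bsub>A\<^esub> \<one>\<^bsub>A\<^esub>) n = (\<Oplus>m\<in>N. if m = n then a m else \<zero>)"
    using a n by (simp add: gp_mult gp_one) (intro finsum_cong' refl, auto)
  also have "\<dots> = a n"
    using a n by (subst finsum_delta) auto
  finally show "(a \<otimes>\<^bsub>A\<^esub> \<one>\<^bsub>A\<^esub>) n = a n" .
qed (auto simp: mult_closed one_closed_W)

lemma ring_gp: "ring A"
proof (rule ringI)
  show "abelian_group A" by (rule abelian_group_gp)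
  show "monoid A"
    by (rule monoidI) (auto simp: mult_closed one_closed_W mult_assoc_W one_mult_W mult_one_W)
  fix a b c assume a: "a \<in> carrier A" and b: "b \<in> carrier A" and c: "c \<in> carrier A"
  show "(a \<oplus>\<^bsub>A\<^esub> b) \<otimes>\<^bsub>A\<^esub> c = a \<otimes>\<^bsub>A\<^esub> c \<oplus>\<^bsub>A\<^esub> b \<otimes>\<^bsub>A\<^esub> c"
  proof (rule N_W_eqI)
    fix n assume n: "n \<in> N"
    have "((a \<oplus>\<^bsub>A\<^esub> b) \<otimes>\<^bsub>A\<^esub> c) n = (\<Oplus>m\<in>N. a m \<otimes> c (inv\<^bsub>P\<^esub> m \<otimes>\<^bsub>P\<^esub> n) \<oplus> b m \<otimes> c (inv\<^bsub>P\<^esub> m \<otimes>\<^bsub>P\<^esub> n))"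
      unfolding gp_apply(1)[OF n] using a b c n by (intro finsum_cong' refl) (auto simp: l_distr)
    also have "\<dots> = (a \<otimes>\<^bsub>A\<^esub> c \<oplus>\<^bsub>A\<^esub> b \<otimes>\<^bsub>A\<^esub> c) n"
      using a b c n by (simp add: finsum_addf Pi_def)
    finally show "((a \<oplus>\<^bsub>A\<^esub> b) \<otimes>\<^bsub>A\<^esub> c) n = (a \<otimes>\<^bsub>A\<^esub> c \<oplus>\<^bsub>A\<^esub> b \<otimes>\<^bsub>A\<^esub> c) n" .
  qed (use a b c in \<open>auto simp: mult_closed add_closed_W\<close>)
  show "c \<otimes>\<^bsub>A\<^esub> (a \<oplus>\<^bsub>A\<^esub> b) = c \<otimes>\<^bsub>A\<^esub> a \<oplus>\<^bsub>A\<^esub> c \<otimes>\<^bsub>A\<^esub> b"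
  proof (rule N_W_eqI)
    fix n assume n: "n \<in> N"
    have "(c \<otimes>\<^bsub>A\<^esub> (a \<oplus>\<^bsub>A\<^esub> b)) n = (\<Oplus>m\<in>N. c m \<otimes> a (inv\<^bsub>P\<^esub> m \<otimes>\<^bsub>P\<^esub> n) \<oplus> c m \<otimes> b (inv\<^bsub>P\<^esub> m \<otimes>\<^bsub>P\<^esub> n))"
      unfolding gp_apply(1)[OF n] using a b c n by (intro finsum_cong' refl) (auto simp: r_distr)
    also have "\<dots> = (c \<otimes>\<^bsub>A\<^esub> a \<oplus>\<^bsub>A\<^esub> c \<otimes>\<^bsub>A\<^esub> b) n"
      using a b c n by (simp add: finsum_addf Pi_def)
    finally show "(c \<otimes>\<^bsub>A\<^esub> (a \<oplus>\<^bsub>A\<^esub> b)) n = (c \<otimes>\<^bsub>A\<^esub> a \<oplus>\<^bsub>A\<^esub> c \<otimes>\<^bsub>A\<^esub> b) n" .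
  qed (use a b c in \<open>auto simp: mult_closed add_closed_W\<close>)
qed

lemma cring_F: "cring F"
  using subfield_iff(2)[OF subfield_K] by (simp add: field_def domain_def)

lemma module_gp: "module F A"
proof (rule moduleI)
  show "cring F" by (rule cring_F)
  show "abelian_group A" by (rule abelian_group_gp)
qed (auto simp: smult_closed_W add_closed_W l_distr r_distr m_assoc K_subring intro!: N_W_eqI)

lemma smult_mult_W:
  assumes "k \<in> K" "a \<in> N.W" "b \<in> N.W"
  shows "(k \<odot>\<^bsub>A\<^esub> a) \<otimes>\<^bsub>A\<^esub> b = k \<odot>\<^bsub>A\<^esub> (a \<otimes>\<^bsub>A\<^esub> b)" "a \<otimes>\<^bsub>A\<^esub> (k \<odot>\<^bsub>A\<^esub> b) = k \<odot>\<^bsub>A\<^esub> (a \<otimes>\<^bsub>A\<^esub> b)"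
proof -
  have k: "k \<in> carrier E" using assms(1) by simp
  have *: "k \<otimes> ((a \<otimes>\<^bsub>A\<^esub> b) n) = (\<Oplus>m\<in>N. k \<otimes> (a m \<otimes> b (inv\<^bsub>P\<^esub> m \<otimes>\<^bsub>P\<^esub> n)))" if "n \<in> N" for n
    using that assms k by (simp add: finsum_rdistr Pi_def)
  show "(k \<odot>\<^bsub>A\<^esub> a) \<otimes>\<^bsub>A\<^esub> b = k \<odot>\<^bsub>A\<^esub> (a \<otimes>\<^bsub>A\<^esub> b)"
  proof (rule N_W_eqI)
    show "((k \<odot>\<^bsub>A\<^esub> a) \<otimes>\<^bsub>A\<^esub> b) n = (k \<odot>\<^bsub>A\<^esub> (a \<otimes>\<^bsub>A\<^esub> b)) n" if n: "n \<in> N" for n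
      using n assms k unfolding gp_apply(5)[OF n] *[OF n] unfolding gp_apply(1)[OF n]
      by (intro finsum_cong' refl) (auto simp: m_assoc)
  qed (use assms in \<open>auto simp: mult_closed smult_closed_W\<close>)
  show "a \<otimes>\<^bsub>A\<^esub> (k \<odot>\<^bsub>A\<^esub> b) = k \<odot>\<^bsub>A\<^esub> (a \<otimes>\<^bsub>A\<^esub> b)"
  proof (rule N_W_eqI)
    show "(a \<otimes>\<^bsub>A\<^esub> (k \<odot>\<^bsub>A\<^esub> b)) n = (k \<odot>\<^bsub>A\<^esub> (a \<otimes>\<^bsub>A\<^esub> b)) n" if n: "n \<in> N" for n
      using n assms k unfolding gp_apply(5)[OF n] *[OF n] unfolding gp_apply(1)[OF n]
      by (intro finsum_cong' refl) (auto simp: m_lcomm)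
  qed (use assms in \<open>auto simp: mult_closed smult_closed_W\<close>)
qed

lemma unital_algebra_gp: "unital_algebra F A"
  unfolding unital_algebra_def using module_gp ring_gp smult_mult_W by auto

lemma value_functional: "n \<in> N \<Longrightarrow> (\<lambda>a. a n) \<in> functionals A"
  by (intro functionalI) (auto simp: gp_add gp_smult)

lemma coordinatized_gp: "coordinatized A N (\<lambda>n a. a n)"
proof (rule N.coordinatizedI)
  show "abelian_monoid A" using abelian_group_gp by (rule abelian_group.axioms)
  show "\<zero>\<^bsub>A\<^esub> = \<zero>\<^bsub>F\<^esub> \<odot>\<^bsub>A\<^esub> \<zero>\<^bsub>A\<^esub>" by (auto simp: gp_zero gp_smult)
  show "(\<lambda>n\<in>N. a n) \<in> N.W" if "a \<in> carrier A" for a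
    using that by (auto intro!: N_W_I simp: N.W_act)
qed (auto simp: smult_closed_W value_functional intro: N_W_eqI)

lemma comult_mem:
  assumes "s \<in> comult A a" "p \<in> set s"
  shows "fst p \<in> N.W" "snd p \<in> N.W"
  using assms by (auto simp: gp_comult in_lists_conv_set)

lemma comult_eq:
  "s \<in> comult A a \<Longrightarrow> m \<in> N \<Longrightarrow> n \<in> N \<Longrightarrow>
    lsum E (\<lambda>p. fst p m \<otimes> snd p n) s = (if m = n then a n else \<zero>)"
  by (auto simp: gp_comult case_prod_unfold)

text \<open>A sum over a coproduct of products of values is a sum over the diagonal, because the coproduct
  of \<open>n\<close> is \<open>n \<otimes> n\<close>. All computations with the comultiplication go through this lemma or its variant
  for double sums.\<close>

lemma comult_lsum:
  assumes s: "s \<in> comult A a" and a: "a \<in> N.W"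
    and f: "\<And>i. i \<in> I \<Longrightarrow> f i \<in> carrier E"
    and \<alpha>: "\<And>i. i \<in> I \<Longrightarrow> \<alpha> i \<in> N" "\<And>i. i \<in> I \<Longrightarrow> \<beta> i \<in> N"
  shows "lsum E (\<lambda>p. \<Oplus>i\<in>I. f i \<otimes> (fst p (\<alpha> i) \<otimes> snd p (\<beta> i))) s =
    (\<Oplus>i\<in>I. if \<alpha> i = \<beta> i then f i \<otimes> a (\<beta> i) else \<zero>)"
proof -
  have "lsum E (\<lambda>p. \<Oplus>i\<in>I. f i \<otimes> (fst p (\<alpha> i) \<otimes> snd p (\<beta> i))) s =
      (\<Oplus>i\<in>I. f i \<otimes> lsum E (\<lambda>p. fst p (\<alpha> i) \<otimes> snd p (\<beta> i)) s)"
    using comult_mem[OF s] f \<alpha> by (intro lsum_scaled_swap) auto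
  also have "\<dots> = (\<Oplus>i\<in>I. if \<alpha> i = \<beta> i then f i \<otimes> a (\<beta> i) else \<zero>)"
    using comult_eq[OF s] a f \<alpha> by (intro finsum_cong' refl) auto
  finally show ?thesis .
qed

lemma comult_lsum2:
  assumes s: "s \<in> comult A a" and a: "a \<in> N.W"
    and f: "\<And>m n. m \<in> N \<Longrightarrow> n \<in> N \<Longrightarrow> f m n \<in> carrier E"
  shows "lsum E (\<lambda>p. \<Oplus>m\<in>N. \<Oplus>n\<in>N. f m n \<otimes> (fst p m \<otimes> snd p n)) s = (\<Oplus>n\<in>N. f n n \<otimes> a n)"
proof -
  have "lsum E (\<lambda>p. \<Oplus>m\<in>N. \<Oplus>n\<in>N. f m n \<otimes> (fst p m \<otimes> snd p n)) s =
      (\<Oplus>m\<in>N. \<Oplus>n\<in>N. f m n \<otimes> lsum E (\<lambda>p. fst p m \<otimes> snd p n) s)"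
    using comult_mem[OF s] f by (intro lsum_scaled_swap2) auto
  also have "\<dots> = (\<Oplus>m\<in>N. f m m \<otimes> a m)"
  proof (intro finsum_cong' refl funcsetI)
    fix m assume m: "m \<in> N"
    have "(\<Oplus>n\<in>N. f m n \<otimes> lsum E (\<lambda>p. fst p m \<otimes> snd p n) s) =
        (\<Oplus>n\<in>N. if n = m then f m n \<otimes> a n else \<zero>)"
      using comult_eq[OF s] a f m by (intro finsum_cong' refl) auto
    also have "\<dots> = f m m \<otimes> a m"
      using a f m by (subst finsum_delta) auto
    finally show "(\<Oplus>n\<in>N. f m n \<otimes> lsum E (\<lambda>p. fst p m \<otimes> snd p n) s) = f m m \<otimes> a m" .
  qed (use a f in auto)
  finally show ?thesis .
qed

text \<open>The function on \<open>N \<times> N\<close> which is \<open>a\<close> on the diagonal and zero elsewhere is equivariant, so it is a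
  sum of products of equivariant functions.\<close>

lemma comult_nonempty:
  assumes a: "a \<in> N.W"
  obtains s where "s \<in> comult A a"
proof -
  interpret gset_pair E K N conj N conj by unfold_locales
  obtain s where "s \<in> lists (N.W \<times> N.W)"
    "\<And>m n. m \<in> N \<Longrightarrow> n \<in> N \<Longrightarrow> (if m = n then a n else \<zero>) = lsum E (\<lambda>(u, v). u m \<otimes> v n) s"
    by (rule equivariant_maps_product[of "\<lambda>m n. if m = n then a n else \<zero>"])
      (use a in \<open>auto simp: N.W_act N.act_eq_iff\<close>)
  then show thesis
    by (intro that[of s]) (auto simp: gp_comult)
qed

lemma tensor_eq_gp_iff:
  assumes s: "s \<in> lists (N.W \<times> N.W)" and t: "t \<in> lists (N.W \<times> N.W)"
  shows "tensor_eq F A A s t \<longleftrightarrow>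
    (\<forall>m\<in>N. \<forall>n\<in>N. lsum E (\<lambda>(u, v). u m \<otimes> v n) s = lsum E (\<lambda>(u, v). u m \<otimes> v n) t)"
proof
  assume eq: "tensor_eq F A A s t"
  then show "\<forall>m\<in>N. \<forall>n\<in>N. lsum E (\<lambda>(u, v). u m \<otimes> v n) s = lsum E (\<lambda>(u, v). u m \<otimes> v n) t"
    using tensor_eq_imp_lsum_eq[OF eq _ _ value_functional value_functional] s t by auto
next
  assume "\<forall>m\<in>N. \<forall>n\<in>N. lsum E (\<lambda>(u, v). u m \<otimes> v n) s = lsum E (\<lambda>(u, v). u m \<otimes> v n) t"
  then show "tensor_eq F A A s t"
    using s t by (intro tensor_eqI[OF coordinatized_gp coordinatized_gp]) auto
qed

lemma comult_tensor:
  assumes a: "a \<in> N.W"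
  shows "comult A a \<in> tensor_product F A A"
proof -
  obtain s where s: "s \<in> comult A a" using a by (rule comult_nonempty)
  then have sl: "s \<in> lists (N.W \<times> N.W)" by (simp add: gp_comult)
  have sd: "lsum E (\<lambda>(u, v). u m \<otimes> v n) s = (if m = n then a n else \<zero>)"
    if "m \<in> N" "n \<in> N" for m n
    using s that by (simp add: gp_comult)
  let ?R = "{(s, t). s \<in> lists (carrier A \<times> carrier A) \<and> t \<in> lists (carrier A \<times> carrier A) \<and>
      tensor_eq F A A s t}"
  have "t \<in> comult A a \<longleftrightarrow> (s, t) \<in> ?R" for t
  proof (cases "t \<in> lists (N.W \<times> N.W)")
    case True
    have "t \<in> comult A a \<longleftrightarrow> tensor_eq F A A s t"
      unfolding tensor_eq_gp_iff[OF sl True] using True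
      by (auto simp: gp_comult sd)
    then show ?thesis using sl True by simp
  qed (simp add: gp_comult)
  then have "comult A a = ?R `` {s}" by blast
  moreover have "s \<in> lists (carrier A \<times> carrier A)" using sl by simp
  ultimately show ?thesis
    unfolding tensor_product_def by (simp only: quotientI)
qed

lemma counit_K: "a \<in> N.W \<Longrightarrow> counit A a \<in> K"
  unfolding gp_counit by (intro N.sum_equivariant_K) (auto simp: N.W_act)

text \<open>The conditions are identities of values on powers of \<open>N\<close>. For coassociativity, both sides have
  the value \<open>x n\<close> at the triples \<open>(n, n, n)\<close> and vanish elsewhere.\<close>

lemma coalgebra_gp: "coalgebra F A"
  unfolding coalgebra_def
proof (intro conjI allI ballI impI)
  show "comult A \<in> carrier A \<rightarrow> tensor_product F A A"
    using comult_tensor by auto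
next
  fix a b s t assume "a \<in> carrier A" "b \<in> carrier A" and s: "s \<in> comult A a" and t: "t \<in> comult A b"
  then have ab: "a \<in> N.W" "b \<in> N.W" by auto
  show "s @ t \<in> comult A (a \<oplus>\<^bsub>A\<^esub> b)"
    unfolding gp_comult
  proof (intro conjI ballI)
    show "s @ t \<in> lists (N.W \<times> N.W)" using s t by (simp add: gp_comult)
    fix m n assume m: "m \<in> N" and n: "n \<in> N"
    have "lsum E (\<lambda>p. fst p m \<otimes> snd p n) (s @ t) =
        lsum E (\<lambda>p. fst p m \<otimes> snd p n) s \<oplus> lsum E (\<lambda>p. fst p m \<otimes> snd p n) t"
      using comult_mem[OF s] comult_mem[OF t] m n by (intro lsum_append) auto
    then show "lsum E (\<lambda>(u, v). u m \<otimes> v n) (s @ t) = (if m = n then (a \<oplus>\<^bsub>A\<^esub> b) n else \<zero>)"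
      using comult_eq[OF s m n] comult_eq[OF t m n] m n ab
      by (simp add: gp_add case_prod_unfold)
  qed
next
  fix k a s assume k: "k \<in> carrier F" and "a \<in> carrier A" and s: "s \<in> comult A a"
  then have a: "a \<in> N.W" and kK: "k \<in> K" by auto
  let ?s = "[(k \<odot>\<^bsub>A\<^esub> u, v). (u, v) \<leftarrow> s]"
  show "?s \<in> comult A (k \<odot>\<^bsub>A\<^esub> a)"
    unfolding gp_comult
  proof (intro conjI ballI)
    show "?s \<in> lists (N.W \<times> N.W)"
      using comult_mem[OF s] kK by (auto simp: in_lists_conv_set smult_closed_W)
    fix m n assume m: "m \<in> N" and n: "n \<in> N"
    have "lsum E (\<lambda>(u, v). u m \<otimes> v n) ?s = lsum E (\<lambda>p. k \<otimes> (fst p m \<otimes> snd p n)) s"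
      unfolding lsum_map using comult_mem[OF s] m n kK
      by (intro lsum_cong) (auto simp: gp_smult case_prod_unfold m_assoc)
    also have "\<dots> = k \<otimes> lsum E (\<lambda>p. fst p m \<otimes> snd p n) s"
      using comult_mem[OF s] m n kK by (intro lsum_rdistr[symmetric]) auto
    finally show "lsum E (\<lambda>(u, v). u m \<otimes> v n) ?s = (if m = n then (k \<odot>\<^bsub>A\<^esub> a) n else \<zero>)"
      using comult_eq[OF s m n] m n kK by (simp add: gp_smult)
  qed
next
  show "counit A \<in> linear_maps F A (self_module F)"
    unfolding linear_maps_def
  proof (intro CollectI conjI ballI funcsetI)
    show "counit A a \<in> carrier (self_module F)" if "a \<in> carrier A" for a
      using that counit_K by simp
    show "counit A (a \<oplus>\<^bsub>A\<^esub> b) = counit A a \<oplus>\<^bsub>self_module F\<^esub> counit A b"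
      if "a \<in> carrier A" "b \<in> carrier A" for a b
    proof -
      have "counit A (a \<oplus>\<^bsub>A\<^esub> b) = (\<Oplus>n\<in>N. a n \<oplus> b n)"
        unfolding gp_counit using that by (intro finsum_cong' refl) (auto simp: gp_add)
      then show ?thesis
        using that by (simp add: gp_counit finsum_addf Pi_def)
    qed
    show "counit A (k \<odot>\<^bsub>A\<^esub> a) = k \<odot>\<^bsub>self_module F\<^esub> counit A a"
      if "k \<in> carrier F" "a \<in> carrier A" for k a
    proof -
      have "counit A (k \<odot>\<^bsub>A\<^esub> a) = (\<Oplus>n\<in>N. k \<otimes> a n)"
        unfolding gp_counit using that by (intro finsum_cong' refl) (auto simp: gp_smult)
      then show ?thesis
        using that by (simp add: gp_counit finsum_rdistr Pi_def)
    qed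
  qed
next
  fix d x assume d: "\<forall>x\<in>carrier A. d x \<in> comult A x" and "x \<in> carrier A"
  then have x: "x \<in> N.W" by simp
  have dD: "d y \<in> comult A y" if "y \<in> N.W" for y using d that by simp
  note dx = comult_mem[OF dD[OF x]]
  have dy: "fst p \<in> N.W \<and> snd p \<in> N.W" if "p \<in> set (d y)" "y \<in> N.W" for y p
    using comult_mem[OF dD[OF that(2)] that(1)] by simp
  let ?s = "[(p, q, v). (u, v) \<leftarrow> d x, (p, q) \<leftarrow> d u]"
  let ?t = "[(u, p, q). (u, v) \<leftarrow> d x, (p, q) \<leftarrow> d v]"
  show "tensor_eq3 F A A A ?s ?t"
  proof (rule tensor_eq3I[OF coordinatized_gp coordinatized_gp coordinatized_gp])
    show "?s \<in> lists (carrier A \<times> carrier A \<times> carrier A)"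
      "?t \<in> lists (carrier A \<times> carrier A \<times> carrier A)"
      using dx dy by (fastforce simp: in_lists_conv_set case_prod_unfold)+
    fix k m n assume k: "k \<in> N" and m: "m \<in> N" and n: "n \<in> N"
    have "lsum E (\<lambda>(u, v, w). u k \<otimes> (v m \<otimes> w n)) ?s =
        lsum E (\<lambda>r. lsum E (\<lambda>q. fst q k \<otimes> (snd q m \<otimes> snd r n)) (d (fst r))) (d x)"
      unfolding case_prod_unfold using dx dy k m n
      by (subst lsum_concat_map) (auto simp: lsum_map)
    also have "\<dots> = lsum E (\<lambda>r. (if k = m then \<one> else \<zero>) \<otimes> (fst r m \<otimes> snd r n)) (d x)"
    proof (intro lsum_cong)
      fix r assume r: "r \<in> set (d x)"
      have "lsum E (\<lambda>q. fst q k \<otimes> (snd q m \<otimes> snd r n)) (d (fst r)) =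
          lsum E (\<lambda>q. (fst q k \<otimes> snd q m) \<otimes> snd r n) (d (fst r))"
        using dx[OF r] dy k m n by (intro lsum_cong) (simp add: m_assoc)
      also have "\<dots> = lsum E (\<lambda>q. fst q k \<otimes> snd q m) (d (fst r)) \<otimes> snd r n"
        using dx[OF r] dy k m n by (intro lsum_ldistr[symmetric]) auto
      also have "\<dots> = (if k = m then \<one> else \<zero>) \<otimes> (fst r m \<otimes> snd r n)"
        using dx[OF r] k m n by (simp add: comult_eq[OF dD[OF dx(1)[OF r]]])
      finally show "lsum E (\<lambda>q. fst q k \<otimes> (snd q m \<otimes> snd r n)) (d (fst r)) =
          (if k = m then \<one> else \<zero>) \<otimes> (fst r m \<otimes> snd r n)" .
    qed
    also have "\<dots> = (if k = m then \<one> else \<zero>) \<otimes> (if m = n then x n else \<zero>)"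
      using dx m n comult_eq[OF dD[OF x] m n] by (subst lsum_rdistr[symmetric]) auto
    also have "\<dots> = (if m = n then \<one> else \<zero>) \<otimes> (if k = n then x n else \<zero>)"
      using x n by auto
    also have "\<dots> = lsum E (\<lambda>r. (if m = n then \<one> else \<zero>) \<otimes> (fst r k \<otimes> snd r n)) (d x)"
      using dx k n comult_eq[OF dD[OF x] k n] by (subst lsum_rdistr[symmetric]) auto
    also have "\<dots> = lsum E (\<lambda>r. lsum E (\<lambda>q. fst r k \<otimes> (fst q m \<otimes> snd q n)) (d (snd r))) (d x)"
    proof (intro lsum_cong)
      fix r assume r: "r \<in> set (d x)"
      have "lsum E (\<lambda>q. fst r k \<otimes> (fst q m \<otimes> snd q n)) (d (snd r)) =
          fst r k \<otimes> lsum E (\<lambda>q. fst q m \<otimes> snd q n) (d (snd r))"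
        using dx[OF r] dy k m n by (intro lsum_rdistr[symmetric]) auto
      also have "\<dots> = (if m = n then \<one> else \<zero>) \<otimes> (fst r k \<otimes> snd r n)"
        using dx[OF r] k m n by (simp add: comult_eq[OF dD[OF dx(2)[OF r]]])
      finally show "(if m = n then \<one> else \<zero>) \<otimes> (fst r k \<otimes> snd r n) =
          lsum E (\<lambda>q. fst r k \<otimes> (fst q m \<otimes> snd q n)) (d (snd r))" ..
    qed
    also have "\<dots> = lsum E (\<lambda>(u, v, w). u k \<otimes> (v m \<otimes> w n)) ?t"
      unfolding case_prod_unfold using dx dy k m n
      by (subst lsum_concat_map) (auto simp: lsum_map)
    finally show "lsum E (\<lambda>(u, v, w). u k \<otimes> (v m \<otimes> w n)) ?s =
        lsum E (\<lambda>(u, v, w). u k \<otimes> (v m \<otimes> w n)) ?t" .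
  qed
next
  fix x s assume "x \<in> carrier A" and s: "s \<in> comult A x"
  then have x: "x \<in> N.W" by simp
  note mem = comult_mem[OF s]
  interpret A: abelian_monoid A using abelian_group_gp by (rule abelian_group.axioms)
  show "lsum A (\<lambda>(u, v). counit A u \<odot>\<^bsub>A\<^esub> v) s = x"
  proof (rule N_W_eqI)
    show "lsum A (\<lambda>(u, v). counit A u \<odot>\<^bsub>A\<^esub> v) s \<in> N.W"
      using A.lsum_closed[of s "\<lambda>(u, v). counit A u \<odot>\<^bsub>A\<^esub> v"] mem
      by (force simp: smult_closed_W counit_K)
    fix n assume n: "n \<in> N"
    have "lsum A (\<lambda>(u, v). counit A u \<odot>\<^bsub>A\<^esub> v) s n =
        lsum E (\<lambda>p. \<Oplus>m\<in>N. \<one> \<otimes> (fst p m \<otimes> snd p n)) s"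
      unfolding gp_lsum[OF n] using mem n
      by (intro lsum_cong, simp add: case_prod_unfold gp_counit finsum_ldistr Pi_def)
        (intro finsum_cong' refl, auto)
    also have "\<dots> = (\<Oplus>m\<in>N. if m = n then \<one> \<otimes> x n else \<zero>)"
      using n by (intro comult_lsum[OF s x]) auto
    also have "\<dots> = x n"
      using x n by (subst finsum_delta) auto
    finally show "lsum A (\<lambda>(u, v). counit A u \<odot>\<^bsub>A\<^esub> v) s n = x n" .
  qed (fact x)
  show "lsum A (\<lambda>(u, v). counit A v \<odot>\<^bsub>A\<^esub> u) s = x"
  proof (rule N_W_eqI)
    show "lsum A (\<lambda>(u, v). counit A v \<odot>\<^bsub>A\<^esub> u) s \<in> N.W"
      using A.lsum_closed[of s "\<lambda>(u, v). counit A v \<odot>\<^bsub>A\<^esub> u"] mem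
      by (force simp: smult_closed_W counit_K)
    fix n assume n: "n \<in> N"
    have "lsum A (\<lambda>(u, v). counit A v \<odot>\<^bsub>A\<^esub> u) s n =
        lsum E (\<lambda>p. \<Oplus>m\<in>N. \<one> \<otimes> (fst p n \<otimes> snd p m)) s"
      unfolding gp_lsum[OF n] using mem n
      by (intro lsum_cong, simp add: case_prod_unfold gp_counit finsum_ldistr Pi_def)
        (intro finsum_cong' refl, auto simp: m_comm)
    also have "\<dots> = (\<Oplus>m\<in>N. if n = m then \<one> \<otimes> x m else \<zero>)"
      using n by (intro comult_lsum[OF s x]) auto
    also have "\<dots> = (\<Oplus>m\<in>N. if m = n then x m else \<zero>)"
      using x n by (intro finsum_cong' refl) auto
    also have "\<dots> = x n"
      using x n by (subst finsum_delta) auto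
    finally show "lsum A (\<lambda>(u, v). counit A v \<odot>\<^bsub>A\<^esub> u) s n = x n" .
  qed (fact x)
qed

lemma bialgebra_gp: "bialgebra F A"
  unfolding bialgebra_def
proof (intro conjI ballI)
  show "unital_algebra F A" by (rule unital_algebra_gp)
  show "coalgebra F A" by (rule coalgebra_gp)
  show "[(\<one>\<^bsub>A\<^esub>, \<one>\<^bsub>A\<^esub>)] \<in> comult A \<one>\<^bsub>A\<^esub>"
    by (auto simp: gp_comult one_closed_W)
next
  fix x y s t assume "x \<in> carrier A" "y \<in> carrier A" and s: "s \<in> comult A x" and t: "t \<in> comult A y"
  then have x: "x \<in> N.W" and y: "y \<in> N.W" by auto
  note smem = comult_mem[OF s] and tmem = comult_mem[OF t]
  let ?s = "[(u \<otimes>\<^bsub>A\<^esub> p, v \<otimes>\<^bsub>A\<^esub> q). (u, v) \<leftarrow> s, (p, q) \<leftarrow> t]"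
  show "?s \<in> comult A (x \<otimes>\<^bsub>A\<^esub> y)"
    unfolding gp_comult
  proof (intro conjI ballI)
    show "?s \<in> lists (N.W \<times> N.W)"
      using smem tmem by (fastforce simp: in_lists_conv_set mult_closed)
    fix m n assume m: "m \<in> N" and n: "n \<in> N"
    \<comment> \<open>The value of the coproduct of \<open>y\<close> at the pair of \<open>i\<^sup>-\<^sup>1 \<cdot> m\<close> and \<open>j\<^sup>-\<^sup>1 \<cdot> n\<close>.\<close>
    define D where "D i j = (if inv\<^bsub>P\<^esub> i \<otimes>\<^bsub>P\<^esub> m = inv\<^bsub>P\<^esub> j \<otimes>\<^bsub>P\<^esub> n then y (inv\<^bsub>P\<^esub> j \<otimes>\<^bsub>P\<^esub> n) else \<zero>)"
      for i j
    have Dc: "D i j \<in> carrier E" if "i \<in> N" "j \<in> N" for i j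
      using that y n by (simp add: D_def)
    have "lsum E (\<lambda>(u, v). u m \<otimes> v n) ?s =
        lsum E (\<lambda>r. lsum E (\<lambda>q. (fst r \<otimes>\<^bsub>A\<^esub> fst q) m \<otimes> (snd r \<otimes>\<^bsub>A\<^esub> snd q) n) t) s"
      unfolding case_prod_unfold using smem tmem m n
      by (subst lsum_concat_map) (auto simp: lsum_map mult_closed simp del: gp_apply)
    also have "\<dots> = lsum E (\<lambda>r. \<Oplus>i\<in>N. \<Oplus>j\<in>N. D i j \<otimes> (fst r i \<otimes> snd r j)) s"
    proof (intro lsum_cong)
      fix r assume r: "r \<in> set s"
      note rmem = smem[OF r]
      let ?e = "\<lambda>i j q. fst q (inv\<^bsub>P\<^esub> i \<otimes>\<^bsub>P\<^esub> m) \<otimes> snd q (inv\<^bsub>P\<^esub> j \<otimes>\<^bsub>P\<^esub> n)"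
      have "lsum E (\<lambda>q. (fst r \<otimes>\<^bsub>A\<^esub> fst q) m \<otimes> (snd r \<otimes>\<^bsub>A\<^esub> snd q) n) t =
          lsum E (\<lambda>q. \<Oplus>i\<in>N. \<Oplus>j\<in>N. (fst r i \<otimes> snd r j) \<otimes> ?e i j q) t"
      proof (intro lsum_cong)
        fix q assume q: "q \<in> set t"
        note qmem = tmem[OF q]
        have "(fst r \<otimes>\<^bsub>A\<^esub> fst q) m \<otimes> (snd r \<otimes>\<^bsub>A\<^esub> snd q) n =
            (\<Oplus>i\<in>N. (fst r i \<otimes> fst q (inv\<^bsub>P\<^esub> i \<otimes>\<^bsub>P\<^esub> m)) \<otimes>
              (\<Oplus>j\<in>N. snd r j \<otimes> snd q (inv\<^bsub>P\<^esub> j \<otimes>\<^bsub>P\<^esub> n)))"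
          unfolding gp_apply(1)[OF m] gp_apply(1)[OF n] using rmem qmem m n
          by (intro finsum_ldistr) auto
        also have "\<dots> = (\<Oplus>i\<in>N. \<Oplus>j\<in>N. (fst r i \<otimes> snd r j) \<otimes> ?e i j q)"
        proof (intro finsum_cong' refl funcsetI)
          fix i assume i: "i \<in> N"
          show "(fst r i \<otimes> fst q (inv\<^bsub>P\<^esub> i \<otimes>\<^bsub>P\<^esub> m)) \<otimes>
              (\<Oplus>j\<in>N. snd r j \<otimes> snd q (inv\<^bsub>P\<^esub> j \<otimes>\<^bsub>P\<^esub> n)) =
              (\<Oplus>j\<in>N. (fst r i \<otimes> snd r j) \<otimes> ?e i j q)"
      using rmem qmem i m n
      by (intro finsum_rdistr_cong) (auto simp: m_ac)
        qed (use rmem qmem m n in \<open>auto intro!: finsum_closed\<close>)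
        finally show "(fst r \<otimes>\<^bsub>A\<^esub> fst q) m \<otimes> (snd r \<otimes>\<^bsub>A\<^esub> snd q) n =
            (\<Oplus>i\<in>N. \<Oplus>j\<in>N. (fst r i \<otimes> snd r j) \<otimes> ?e i j q)" .
      qed
      also have "\<dots> = (\<Oplus>i\<in>N. \<Oplus>j\<in>N. (fst r i \<otimes> snd r j) \<otimes> lsum E (?e i j) t)"
        using rmem tmem m n by (intro lsum_scaled_swap2) auto
      also have "\<dots> = (\<Oplus>i\<in>N. \<Oplus>j\<in>N. D i j \<otimes> (fst r i \<otimes> snd r j))"
      proof (intro finsum_cong' refl funcsetI)
        fix i j assume ij: "i \<in> N" "j \<in> N"
        have "lsum E (?e i j) t = D i j"
          using comult_eq[OF t, of "inv\<^bsub>P\<^esub> i \<otimes>\<^bsub>P\<^esub> m" "inv\<^bsub>P\<^esub> j \<otimes>\<^bsub>P\<^esub> n"] ij m n by (simp add: D_def)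
        then show "(fst r i \<otimes> snd r j) \<otimes> lsum E (?e i j) t = D i j \<otimes> (fst r i \<otimes> snd r j)"
          using rmem ij Dc by (simp add: m_comm)
      qed (use rmem Dc in \<open>auto intro!: finsum_closed\<close>)
      finally show "lsum E (\<lambda>q. (fst r \<otimes>\<^bsub>A\<^esub> fst q) m \<otimes> (snd r \<otimes>\<^bsub>A\<^esub> snd q) n) t =
          (\<Oplus>i\<in>N. \<Oplus>j\<in>N. D i j \<otimes> (fst r i \<otimes> snd r j))" .
    qed
    also have "\<dots> = (\<Oplus>i\<in>N. D i i \<otimes> x i)"
      using Dc by (intro comult_lsum2[OF s x])
    also have "\<dots> = (if m = n then (x \<otimes>\<^bsub>A\<^esub> y) n else \<zero>)"
    proof (cases "m = n")
      case True
      then show ?thesis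
        using x y n by (simp add: D_def) (intro finsum_cong' refl, auto simp: m_comm)
    next
      case False
      have "D i i \<otimes> x i = \<zero>" if i: "i \<in> N" for i
      proof -
        have "inv\<^bsub>P\<^esub> i \<otimes>\<^bsub>P\<^esub> m \<noteq> inv\<^bsub>P\<^esub> i \<otimes>\<^bsub>P\<^esub> n"
          using False i m n by (simp add: P.inv_closed)
        then show ?thesis using i x by (simp add: D_def)
      qed
      then have "(\<Oplus>i\<in>N. D i i \<otimes> x i) = (\<Oplus>i\<in>N. \<zero>)"
        by (intro finsum_cong' refl) auto
      with False show ?thesis by simp
    qed
    finally show "lsum E (\<lambda>(u, v). u m \<otimes> v n) ?s = (if m = n then (x \<otimes>\<^bsub>A\<^esub> y) n else \<zero>)" .
  qed
next
  have "counit A \<one>\<^bsub>A\<^esub> = (\<Oplus>n\<in>N. if n = \<one>\<^bsub>P\<^esub> then \<one> else \<zero>)"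
    unfolding gp_counit by (intro finsum_cong' refl) auto
  also have "\<dots> = \<one>"
    using finsum_delta[of N "\<one>\<^bsub>P\<^esub>" "\<lambda>_. \<one>"] by simp
  finally show "counit A \<one>\<^bsub>A\<^esub> = \<one>\<^bsub>F\<^esub>" by simp
next
  fix x y assume "x \<in> carrier A" "y \<in> carrier A"
  then have x: "x \<in> N.W" and y: "y \<in> N.W" by auto
  have "counit A (x \<otimes>\<^bsub>A\<^esub> y) = (\<Oplus>n\<in>N. \<Oplus>m\<in>N. x m \<otimes> y (inv\<^bsub>P\<^esub> m \<otimes>\<^bsub>P\<^esub> n))"
    unfolding gp_counit using x y by (intro finsum_cong' refl) auto
  also have "\<dots> = (\<Oplus>m\<in>N. \<Oplus>n\<in>N. x m \<otimes> y (inv\<^bsub>P\<^esub> m \<otimes>\<^bsub>P\<^esub> n))"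
    using x y by (intro finsum_swap) auto
  also have "\<dots> = (\<Oplus>m\<in>N. x m \<otimes> (\<Oplus>n\<in>N. y n))"
  proof (intro finsum_cong' refl funcsetI)
    fix m assume m: "m \<in> N"
    have "(\<Oplus>n\<in>N. x m \<otimes> y (inv\<^bsub>P\<^esub> m \<otimes>\<^bsub>P\<^esub> n)) = (\<Oplus>n\<in>N. x m \<otimes> y n)"
      using x y m by (intro finsum_N_lmult[of "inv\<^bsub>P\<^esub> m" "\<lambda>n. x m \<otimes> y n"]) auto
    also have "\<dots> = x m \<otimes> (\<Oplus>n\<in>N. y n)"
      using x y m by (intro finsum_rdistr[symmetric]) auto
    finally show "(\<Oplus>n\<in>N. x m \<otimes> y (inv\<^bsub>P\<^esub> m \<otimes>\<^bsub>P\<^esub> n)) = x m \<otimes> (\<Oplus>n\<in>N. y n)" .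
  qed (use x y in auto)
  also have "\<dots> = (\<Oplus>m\<in>N. x m) \<otimes> (\<Oplus>n\<in>N. y n)"
    using x y by (intro finsum_ldistr[symmetric]) auto
  finally show "counit A (x \<otimes>\<^bsub>A\<^esub> y) = counit A x \<otimes>\<^bsub>F\<^esub> counit A y"
    by (simp add: gp_counit)
qed

definition antipode where "antipode a = (\<lambda>n\<in>N. a (inv\<^bsub>P\<^esub> n))"

lemma antipode_W: "a \<in> N.W \<Longrightarrow> antipode a \<in> N.W"
  by (rule N_W_I) (auto simp: antipode_def conj_inv[symmetric] N.W_act)

lemma hopf_algebra_gp: "hopf_algebra F A"
  unfolding hopf_algebra_def
proof (intro conjI bexI[of _ antipode] ballI)
  show "bialgebra F A" by (rule bialgebra_gp)
  show "antipode \<in> linear_maps F A A"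
    unfolding linear_maps_def
  proof (intro CollectI conjI ballI funcsetI)
    show "antipode a \<in> carrier A" if "a \<in> carrier A" for a
      using that by (simp add: antipode_W)
    show "antipode (a \<oplus>\<^bsub>A\<^esub> b) = antipode a \<oplus>\<^bsub>A\<^esub> antipode b"
      if "a \<in> carrier A" "b \<in> carrier A" for a b
      using that by (intro N_W_eqI antipode_W add_closed_W) (auto simp: antipode_def)
    show "antipode (k \<odot>\<^bsub>A\<^esub> a) = k \<odot>\<^bsub>A\<^esub> antipode a"
      if "k \<in> carrier F" "a \<in> carrier A" for k a
      using that by (intro N_W_eqI antipode_W smult_closed_W) (auto simp: antipode_def)
  qed
next
  fix x s assume "x \<in> carrier A" and s: "s \<in> comult A x"
  then have x: "x \<in> N.W" by simp
  note mem = comult_mem[OF s]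
  interpret A: abelian_monoid A using abelian_group_gp by (rule abelian_group.axioms)
  have unit: "counit A x \<odot>\<^bsub>A\<^esub> \<one>\<^bsub>A\<^esub> \<in> N.W"
    using x by (intro smult_closed_W counit_K one_closed_W)
  show "lsum A (\<lambda>(u, v). antipode u \<otimes>\<^bsub>A\<^esub> v) s = counit A x \<odot>\<^bsub>A\<^esub> \<one>\<^bsub>A\<^esub>"
  proof (rule N_W_eqI)
    show "lsum A (\<lambda>(u, v). antipode u \<otimes>\<^bsub>A\<^esub> v) s \<in> N.W"
      using A.lsum_closed[of s "\<lambda>(u, v). antipode u \<otimes>\<^bsub>A\<^esub> v"] mem
      by (force simp: mult_closed antipode_W simp del: gp_apply)
    fix n assume n: "n \<in> N"
    have iff: "inv\<^bsub>P\<^esub> m = inv\<^bsub>P\<^esub> m \<otimes>\<^bsub>P\<^esub> n \<longleftrightarrow> n = \<one>\<^bsub>P\<^esub>" if "m \<in> N" for m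
      using that n P.l_cancel_one'[of "inv\<^bsub>P\<^esub> m" n] by auto
    have "lsum A (\<lambda>(u, v). antipode u \<otimes>\<^bsub>A\<^esub> v) s n =
        lsum E (\<lambda>p. \<Oplus>m\<in>N. \<one> \<otimes> (fst p (inv\<^bsub>P\<^esub> m) \<otimes> snd p (inv\<^bsub>P\<^esub> m \<otimes>\<^bsub>P\<^esub> n))) s"
      unfolding gp_lsum[OF n] using mem n
      by (intro lsum_cong, simp add: case_prod_unfold)
        (intro finsum_cong' refl, auto simp: antipode_def)
    also have "\<dots> = (\<Oplus>m\<in>N. if inv\<^bsub>P\<^esub> m = inv\<^bsub>P\<^esub> m \<otimes>\<^bsub>P\<^esub> n then \<one> \<otimes> x (inv\<^bsub>P\<^esub> m \<otimes>\<^bsub>P\<^esub> n) else \<zero>)"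
      using n by (intro comult_lsum[OF s x]) auto
    also have "\<dots> = (\<Oplus>m\<in>N. if n = \<one>\<^bsub>P\<^esub> then x (inv\<^bsub>P\<^esub> m) else \<zero>)"
      using x n by (intro finsum_cong' refl) (auto simp: iff)
    also have "\<dots> = (counit A x \<odot>\<^bsub>A\<^esub> \<one>\<^bsub>A\<^esub>) n"
    proof (cases "n = \<one>\<^bsub>P\<^esub>")
      case True
      have "counit A x \<in> carrier E" using counit_K[OF x] by simp
      then show ?thesis
        using x True finsum_N_inv[of x] by (simp add: gp_counit)
    next
      case False
      have "counit A x \<in> carrier E" using counit_K[OF x] by simp
      then show ?thesis using False n by simp
    qed
    finally show "lsum A (\<lambda>(u, v). antipode u \<otimes>\<^bsub>A\<^esub> v) s n = (counit A x \<odot>\<^bsub>A\<^esub> \<one>\<^bsub>A\<^esub>) n" .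
  qed (fact unit)
  show "lsum A (\<lambda>(u, v). u \<otimes>\<^bsub>A\<^esub> antipode v) s = counit A x \<odot>\<^bsub>A\<^esub> \<one>\<^bsub>A\<^esub>"
  proof (rule N_W_eqI)
    show "lsum A (\<lambda>(u, v). u \<otimes>\<^bsub>A\<^esub> antipode v) s \<in> N.W"
      using A.lsum_closed[of s "\<lambda>(u, v). u \<otimes>\<^bsub>A\<^esub> antipode v"] mem
      by (force simp: mult_closed antipode_W simp del: gp_apply)
    fix n assume n: "n \<in> N"
    have iff: "m = inv\<^bsub>P\<^esub> n \<otimes>\<^bsub>P\<^esub> m \<longleftrightarrow> n = \<one>\<^bsub>P\<^esub>" if "m \<in> N" for m
      using that n P.r_cancel_one'[of m "inv\<^bsub>P\<^esub> n"] P.inv_eq_1_iff[of n] by auto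
    have "lsum A (\<lambda>(u, v). u \<otimes>\<^bsub>A\<^esub> antipode v) s n =
        lsum E (\<lambda>p. \<Oplus>m\<in>N. \<one> \<otimes> (fst p m \<otimes> snd p (inv\<^bsub>P\<^esub> n \<otimes>\<^bsub>P\<^esub> m))) s"
      unfolding gp_lsum[OF n] using mem n
      by (intro lsum_cong, simp add: case_prod_unfold)
        (intro finsum_cong' refl, auto simp: antipode_def P.inv_mult_group)
    also have "\<dots> = (\<Oplus>m\<in>N. if m = inv\<^bsub>P\<^esub> n \<otimes>\<^bsub>P\<^esub> m then \<one> \<otimes> x (inv\<^bsub>P\<^esub> n \<otimes>\<^bsub>P\<^esub> m) else \<zero>)"
      using n by (intro comult_lsum[OF s x]) auto
    also have "\<dots> = (\<Oplus>m\<in>N. if n = \<one>\<^bsub>P\<^esub> then x m else \<zero>)"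
    proof (intro finsum_cong' refl funcsetI)
      fix m assume m: "m \<in> N"
      show "(if m = inv\<^bsub>P\<^esub> n \<otimes>\<^bsub>P\<^esub> m then \<one> \<otimes> x (inv\<^bsub>P\<^esub> n \<otimes>\<^bsub>P\<^esub> m) else \<zero>) =
          (if n = \<one>\<^bsub>P\<^esub> then x m else \<zero>)"
        using iff[OF m] x m by (cases "n = \<one>\<^bsub>P\<^esub>") simp_all
    qed (use x in auto)
    also have "\<dots> = (counit A x \<odot>\<^bsub>A\<^esub> \<one>\<^bsub>A\<^esub>) n"
      using counit_K[OF x] n by (cases "n = \<one>\<^bsub>P\<^esub>") (simp_all add: gp_counit)
    finally show "lsum A (\<lambda>(u, v). u \<otimes>\<^bsub>A\<^esub> antipode v) s n = (counit A x \<odot>\<^bsub>A\<^esub> \<one>\<^bsub>A\<^esub>) n" .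
  qed (fact unit)
qed

section \<open>The Hopf-Galois structure of a regular stable subgroup\<close>

lemma coset_apply_one: "C \<in> \<Omega> \<Longrightarrow> coset_apply C \<one> = \<one>"
  by (rule coset_apply_K[OF _ K_subring(3)])

lemma action_L:
  assumes a: "a \<in> N.W" and x: "x \<in> L"
  shows "action A a x \<in> L"
proof (rule fixed_points_S)
  show "action A a x \<in> carrier E"
    using a x by (auto simp: gp_action)
  fix s assume s: "s \<in> S"
  have "s (action A a x) = (\<Oplus>n\<in>N. a (conj s n) \<otimes> coset_apply (twist (conj s n)) x)"
    using a x S_G[OF s]
    by (simp add: gp_action, intro finsum_cong' refl)
      (auto simp: N.W_act twist_conj_stabilizer[OF s] coset_apply_translation)
  also have "\<dots> = action A a x"
    unfolding gp_action using a x S_G[OF s]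
    by (intro finsum_N_conj[where f = "\<lambda>n. a n \<otimes> coset_apply (twist n) x"]) auto
  finally show "s (action A a x) = action A a x" .
qed

text \<open>If \<open>twist n\<close> is the translate of the base coset by \<open>g\<close>, then \<open>coset_apply (twist n)\<close> is \<open>g\<close>, and
  translation by \<open>g\<close> takes \<open>twist m\<close> to \<open>twist (n \<cdot> conj g m)\<close>. The factor \<open>conj g\<close> is absorbed by
  reindexing, since \<open>b\<close> is equivariant.\<close>

lemma coset_apply_action:
  assumes b: "b \<in> N.W" and x: "x \<in> L" and n: "n \<in> N"
  shows "coset_apply (twist n) (action A b x) = (\<Oplus>m\<in>N. b m \<otimes> coset_apply (twist (n \<otimes>\<^bsub>P\<^esub> m)) x)"
proof -
  obtain g where g: "g \<in> carrier G" "twist n = \<tau> g base"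
    using twist_mem[OF n] by (rule coset_as_translate)
  have tw: "\<tau> g (twist m) = twist (n \<otimes>\<^bsub>P\<^esub> conj g m)" if m: "m \<in> N" for m
  proof -
    have "\<tau> g (twist m) = conj g (inv\<^bsub>P\<^esub> m) (twist n)"
      using conj_apply_translation[of g "inv\<^bsub>P\<^esub> m" base] g m by (simp add: twist_def)
    also have "\<dots> = twist (n \<otimes>\<^bsub>P\<^esub> conj g m)"
      using g m n by (simp add: twist_def conj_inv P.inv_mult_group perm_mult_apply)
    finally show ?thesis .
  qed
  have "coset_apply (twist n) (action A b x) = g (action A b x)"
    using g action_L[OF b x] by (simp add: coset_apply_translation coset_apply_base)
  also have "\<dots> = (\<Oplus>m\<in>N. b (conj g m) \<otimes> coset_apply (twist (n \<otimes>\<^bsub>P\<^esub> conj g m)) x)"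
    using b x g n
    by (simp add: gp_action, intro finsum_cong' refl)
      (auto simp: N.W_act tw[symmetric] coset_apply_translation)
  also have "\<dots> = (\<Oplus>m\<in>N. b m \<otimes> coset_apply (twist (n \<otimes>\<^bsub>P\<^esub> m)) x)"
    using b x g n
    by (intro finsum_N_conj[where f = "\<lambda>m. b m \<otimes> coset_apply (twist (n \<otimes>\<^bsub>P\<^esub> m)) x"]) auto
  finally show ?thesis .
qed

lemma action_mult:
  assumes a: "a \<in> N.W" and b: "b \<in> N.W" and x: "x \<in> L"
  shows "action A (a \<otimes>\<^bsub>A\<^esub> b) x = action A a (action A b x)"
proof -
  let ?t = "\<lambda>n k. a n \<otimes> (b (inv\<^bsub>P\<^esub> n \<otimes>\<^bsub>P\<^esub> k) \<otimes> coset_apply (twist k) x)"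
  have "action A (a \<otimes>\<^bsub>A\<^esub> b) x = (\<Oplus>k\<in>N. \<Oplus>n\<in>N. ?t n k)"
    unfolding gp_action
  proof (intro finsum_cong' refl funcsetI)
    fix k assume k: "k \<in> N"
    show "(a \<otimes>\<^bsub>A\<^esub> b) k \<otimes> coset_apply (twist k) x = (\<Oplus>n\<in>N. ?t n k)"
      unfolding gp_apply(1)[OF k] using a b x k
      by (intro finsum_ldistr_cong) (auto simp: m_assoc)
  qed (use a b x in auto)
  also have "\<dots> = (\<Oplus>n\<in>N. \<Oplus>k\<in>N. ?t n k)"
    using a b x by (intro finsum_swap) auto
  also have "\<dots> = (\<Oplus>n\<in>N. a n \<otimes> coset_apply (twist n) (action A b x))"
  proof (intro finsum_cong' refl funcsetI)
    fix n assume n: "n \<in> N"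
    have "(\<Oplus>k\<in>N. ?t n k) = (\<Oplus>m\<in>N. ?t n (n \<otimes>\<^bsub>P\<^esub> m))"
      using a b x n by (intro finsum_N_lmult[symmetric]) auto
    also have "\<dots> = (\<Oplus>m\<in>N. a n \<otimes> (b m \<otimes> coset_apply (twist (n \<otimes>\<^bsub>P\<^esub> m)) x))"
      using a b x n by (intro finsum_cong' refl) auto
    also have "\<dots> = a n \<otimes> coset_apply (twist n) (action A b x)"
      unfolding coset_apply_action[OF b x n] using a b x n
      by (intro finsum_rdistr[symmetric]) auto
    finally show "(\<Oplus>k\<in>N. ?t n k) = a n \<otimes> coset_apply (twist n) (action A b x)" .
  qed (use a action_L[OF b x] in auto)
  finally show ?thesis by (simp add: gp_action)
qed

lemma action_one:
  assumes "x \<in> L"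
  shows "action A \<one>\<^bsub>A\<^esub> x = x"
proof -
  have "action A \<one>\<^bsub>A\<^esub> x = (\<Oplus>n\<in>N. if n = \<one>\<^bsub>P\<^esub> then coset_apply (twist n) x else \<zero>)"
    unfolding gp_action using assms by (intro finsum_cong' refl) auto
  also have "\<dots> = coset_apply (twist \<one>\<^bsub>P\<^esub>) x"
    using assms by (intro finsum_delta) auto
  finally show ?thesis
    using assms by (simp add: twist_def perm_one_apply coset_apply_base)
qed

lemma action_unit: "a \<in> N.W \<Longrightarrow> action A a \<one> = counit A a"
  unfolding gp_action gp_counit by (intro finsum_cong' refl) (auto simp: coset_apply_one)

lemma action_product:
  assumes a: "a \<in> N.W" and s: "s \<in> comult A a" and x: "x \<in> L" and y: "y \<in> L"
  shows "action A a (x \<otimes> y) = lsum E (\<lambda>(u, v). action A u x \<otimes> action A v y) s"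
proof -
  note mem = comult_mem[OF s]
  let ?x = "\<lambda>m. coset_apply (twist m) x" and ?y = "\<lambda>n. coset_apply (twist n) y"
  have "lsum E (\<lambda>(u, v). action A u x \<otimes> action A v y) s =
      lsum E (\<lambda>p. \<Oplus>m\<in>N. \<Oplus>n\<in>N. (?x m \<otimes> ?y n) \<otimes> (fst p m \<otimes> snd p n)) s"
  proof (intro lsum_cong)
    fix p assume p: "p \<in> set s"
    have "action A (fst p) x \<otimes> action A (snd p) y =
        (\<Oplus>m\<in>N. (fst p m \<otimes> ?x m) \<otimes> (\<Oplus>n\<in>N. snd p n \<otimes> ?y n))"
      unfolding gp_action using mem[OF p] x y by (intro finsum_ldistr) auto
    also have "\<dots> = (\<Oplus>m\<in>N. \<Oplus>n\<in>N. (?x m \<otimes> ?y n) \<otimes> (fst p m \<otimes> snd p n))"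
    proof (intro finsum_cong' refl funcsetI)
      fix m assume m: "m \<in> N"
      show "(fst p m \<otimes> ?x m) \<otimes> (\<Oplus>n\<in>N. snd p n \<otimes> ?y n) =
          (\<Oplus>n\<in>N. (?x m \<otimes> ?y n) \<otimes> (fst p m \<otimes> snd p n))"
      using mem[OF p] x y m
      by (intro finsum_rdistr_cong) (auto simp: m_ac)
    qed (use mem[OF p] x y in \<open>auto intro!: finsum_closed\<close>)
    finally show "(case p of (u, v) \<Rightarrow> action A u x \<otimes> action A v y) =
        (\<Oplus>m\<in>N. \<Oplus>n\<in>N. (?x m \<otimes> ?y n) \<otimes> (fst p m \<otimes> snd p n))"
      by (simp add: case_prod_unfold)
  qed
  also have "\<dots> = (\<Oplus>n\<in>N. (?x n \<otimes> ?y n) \<otimes> a n)"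
    using x y by (intro comult_lsum2[OF s a]) auto
  also have "\<dots> = action A a (x \<otimes> y)"
    unfolding gp_action using a x y
    by (intro finsum_cong' refl) (auto simp: coset_apply_mult m_comm)
  finally show ?thesis ..
qed

lemma action_bilinear: "action A \<in> bilinear_maps F A L_module L_module"
  unfolding bilinear_maps_def linear_maps_def
proof (intro CollectI conjI ballI funcsetI, goal_cases)
  case (1 a x) then show ?case by (simp add: action_L)
next
  case (2 a x y)
  then have "action A a (x \<oplus> y) = (\<Oplus>n\<in>N. a n \<otimes> coset_apply (twist n) x \<oplus> a n \<otimes> coset_apply (twist n) y)"
    unfolding gp_action by (intro finsum_cong' refl) (auto simp: coset_apply_add r_distr)
  also have "\<dots> = action A a x \<oplus> action A a y"
    unfolding gp_action using 2 by (intro finsum_addf) auto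
  finally show ?case by simp
next
  case (3 a k x)
  then have kL: "k \<in> L" "k \<in> carrier E" using K_subset_L by auto
  from 3 have "action A a (k \<otimes> x) = (\<Oplus>n\<in>N. k \<otimes> (a n \<otimes> coset_apply (twist n) x))"
    unfolding gp_action using kL
    by (intro finsum_cong' refl) (auto simp: coset_apply_mult coset_apply_K m_lcomm)
  also have "\<dots> = k \<otimes> action A a x"
    unfolding gp_action using 3 kL by (intro finsum_rdistr[symmetric]) auto
  finally show ?case by simp
next
  case (4 x a) then show ?case by (simp add: action_L)
next
  case (5 x a b)
  then have "action A (a \<oplus>\<^bsub>A\<^esub> b) x = (\<Oplus>n\<in>N. a n \<otimes> coset_apply (twist n) x \<oplus> b n \<otimes> coset_apply (twist n) x)"
    unfolding gp_action by (intro finsum_cong' refl) (auto simp: l_distr)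
  also have "\<dots> = action A a x \<oplus> action A b x"
    unfolding gp_action using 5 by (intro finsum_addf) auto
  finally show ?case by simp
next
  case (6 x k a)
  then have "action A (k \<odot>\<^bsub>A\<^esub> a) x = (\<Oplus>n\<in>N. k \<otimes> (a n \<otimes> coset_apply (twist n) x))"
    unfolding gp_action by (intro finsum_cong' refl) (auto simp: m_assoc)
  also have "\<dots> = k \<otimes> action A a x"
    unfolding gp_action using 6 by (intro finsum_rdistr[symmetric]) auto
  finally show ?case by simp
qed

text \<open>The embeddings \<open>coset_apply (twist n)\<close> are all the embeddings of \<open>L\<close>, without repetition.\<close>

lemma twist_independent:
  assumes z: "\<And>n. n \<in> N \<Longrightarrow> z n \<in> carrier E" "\<And>n. n \<in> N \<Longrightarrow> z' n \<in> carrier E"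
    and eq: "\<And>x. x \<in> L \<Longrightarrow> (\<Oplus>n\<in>N. z n \<otimes> coset_apply (twist n) x) =
      (\<Oplus>n\<in>N. z' n \<otimes> coset_apply (twist n) x)"
    and n: "n \<in> N"
  shows "z n = z' n"
proof -
  define i where "i = inv_into N twist"
  have i: "i C \<in> N" "twist (i C) = C" if "C \<in> \<Omega>" for C
    using that bij_betw_twist by (auto simp: i_def bij_betw_def inv_into_into f_inv_into_f)
  have i_twist: "i (twist m) = m" if "m \<in> N" for m
    using that bij_betw_twist by (auto simp: i_def bij_betw_def)
  have sum: "(\<Oplus>C\<in>\<Omega>. f (i C) \<otimes> coset_apply C x) = (\<Oplus>n\<in>N. f n \<otimes> coset_apply (twist n) x)"
    if f: "\<And>n. n \<in> N \<Longrightarrow> f n \<in> carrier E" and x: "x \<in> L" for f x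
  proof -
    have "(\<Oplus>C\<in>\<Omega>. f (i C) \<otimes> coset_apply C x) = (\<Oplus>n\<in>N. f (i (twist n)) \<otimes> coset_apply (twist n) x)"
      using f x i by (intro finsum_twist[symmetric]) auto
    also have "\<dots> = (\<Oplus>n\<in>N. f n \<otimes> coset_apply (twist n) x)"
      using f x by (intro finsum_cong' refl) (auto simp: i_twist)
    finally show ?thesis .
  qed
  have "z (i (twist n)) = z' (i (twist n))"
  proof (rule dedekind_cosets[where z = "\<lambda>C. z (i C)" and z' = "\<lambda>C. z' (i C)"])
    show "(\<Oplus>C\<in>\<Omega>. z (i C) \<otimes> coset_apply C x) = (\<Oplus>C\<in>\<Omega>. z' (i C) \<otimes> coset_apply C x)"
      if x: "x \<in> L" for x
      using sum[of z, OF z(1) x] sum[of z', OF z(2) x] eq[OF x] by simp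
  qed (use z i n in auto)
  then show ?thesis using n by (simp add: i_twist)
qed

text \<open>In terms of embeddings, the endomorphism of \<open>L\<close> given by a formal sum has the values of the
  formal sum at the base coset as coefficients.\<close>

lemma smash_sum:
  assumes s: "s \<in> lists (L \<times> N.W)" and x: "x \<in> L"
  shows "lsum E (\<lambda>(l, a). l \<otimes> action A a x) s =
    (\<Oplus>n\<in>N. lsum E (\<lambda>(l, a). l \<otimes> a n) s \<otimes> coset_apply (twist n) x)"
proof -
  have mem: "fst p \<in> L" "snd p \<in> N.W" if "p \<in> set s" for p
    using s that by (auto simp: in_lists_conv_set)
  have "lsum E (\<lambda>(l, a). l \<otimes> action A a x) s =
      lsum E (\<lambda>p. \<Oplus>n\<in>N. (fst p \<otimes> snd p n) \<otimes> coset_apply (twist n) x) s"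
  proof (intro lsum_cong)
    fix p assume p: "p \<in> set s"
    have "fst p \<otimes> action A (snd p) x = (\<Oplus>n\<in>N. fst p \<otimes> (snd p n \<otimes> coset_apply (twist n) x))"
      unfolding gp_action using mem[OF p] x by (intro finsum_rdistr) auto
    also have "\<dots> = (\<Oplus>n\<in>N. (fst p \<otimes> snd p n) \<otimes> coset_apply (twist n) x)"
      using mem[OF p] x by (intro finsum_cong' refl) (auto simp: m_assoc)
    finally show "(case p of (l, a) \<Rightarrow> l \<otimes> action A a x) =
        (\<Oplus>n\<in>N. (fst p \<otimes> snd p n) \<otimes> coset_apply (twist n) x)"
      by (simp add: case_prod_unfold)
  qed
  also have "\<dots> = (\<Oplus>n\<in>N. lsum E (\<lambda>p. (fst p \<otimes> snd p n) \<otimes> coset_apply (twist n) x) s)"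
    using mem x by (intro lsum_finsum) auto
  also have "\<dots> = (\<Oplus>n\<in>N. lsum E (\<lambda>(l, a). l \<otimes> a n) s \<otimes> coset_apply (twist n) x)"
    unfolding case_prod_unfold using mem x
    by (intro finsum_cong' refl) (auto simp: lsum_ldistr)
  finally show ?thesis .
qed

text \<open>By independence of the embeddings, equal endomorphisms have equal values at the pairs of the base
  coset and an element of \<open>N\<close>; applying \<open>g\<close> yields the values at the pairs with other cosets.\<close>

lemma smash_injective:
  assumes s: "s \<in> lists (L \<times> N.W)" and t: "t \<in> lists (L \<times> N.W)"
    and eq: "\<And>x. x \<in> L \<Longrightarrow> lsum E (\<lambda>(l, a). l \<otimes> action A a x) s = lsum E (\<lambda>(l, a). l \<otimes> action A a x) t"
  shows "tensor_eq F L_module A s t"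
proof (rule tensor_eqI[OF coordinatized_L coordinatized_gp])
  have closed: "lsum E (\<lambda>(l, a). l \<otimes> a n) r \<in> carrier E" if "r \<in> lists (L \<times> N.W)" "n \<in> N" for r n
    using that by (intro lsum_closed) (auto simp: in_lists_conv_set)
  have vals: "lsum E (\<lambda>(l, a). l \<otimes> a n) s = lsum E (\<lambda>(l, a). l \<otimes> a n) t" if n: "n \<in> N" for n
    using eq smash_sum[OF s] smash_sum[OF t] closed[OF s] closed[OF t] n
    by (intro twist_independent[where z = "\<lambda>n. lsum E (\<lambda>(l, a). l \<otimes> a n) s"]) auto
  fix C n assume C: "C \<in> \<Omega>" and n: "n \<in> N"
  obtain g where g: "g \<in> carrier G" "C = \<tau> g base" using C by (rule coset_as_translate)
  have "lsum E (\<lambda>(l, a). coset_apply C l \<otimes> a n) r =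
      g (lsum E (\<lambda>(l, a). l \<otimes> a (conj (inv\<^bsub>G\<^esub> g) n)) r)" if r: "r \<in> lists (L \<times> N.W)" for r
  proof -
    have mem: "fst p \<in> L" "snd p \<in> N.W" if "p \<in> set r" for p
      using r that by (auto simp: in_lists_conv_set)
    have "g (snd p (conj (inv\<^bsub>G\<^esub> g) n)) = snd p n" if "p \<in> set r" for p
      using N.W_act[OF mem(2)[OF that] g(1), of "conj (inv\<^bsub>G\<^esub> g) n"] g n by simp
    then show ?thesis
      unfolding case_prod_unfold using mem g n
      by (subst gal_lsum)
        (auto intro!: lsum_cong simp: coset_apply_translation coset_apply_base)
  qed
  from this[OF s] this[OF t] vals[of "conj (inv\<^bsub>G\<^esub> g) n"] g n
  show "lsum E (\<lambda>(u, v). coset_apply C u \<otimes> v n) s = lsum E (\<lambda>(u, v). coset_apply C u \<otimes> v n) t"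
    by simp
qed (use s t in auto)

text \<open>An endomorphism of \<open>L\<close> is a combination of embeddings with coefficients \<open>p C\<close>. Transported to
  \<open>N\<close>, the coefficients are equivariant for the stabilizer of the base coset only; induced to a
  function of a coset and an element of \<open>N\<close>, they become equivariant for the whole Galois group, and
  so a sum of products of elements of \<open>L\<close> and of the Hopf algebra.\<close>

lemma smash_surjective:
  assumes f: "f \<in> linear_maps F L_module L_module"
  obtains s where "s \<in> lists (L \<times> N.W)"
    "\<And>x. x \<in> L \<Longrightarrow> f x = lsum E (\<lambda>(l, a). l \<otimes> action A a x) s"
proof -
  have fL: "f x \<in> L" if "x \<in> L" for x using linear_mapsD(1)[OF f] that by simp
  have "f \<in> functionals L_module"
    using linear_mapsD[OF f] by (intro functionalI) auto
  then obtain p where p: "\<And>C. C \<in> \<Omega> \<Longrightarrow> p C \<in> carrier E"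
    "\<And>x. x \<in> L \<Longrightarrow> f x = (\<Oplus>C\<in>\<Omega>. p C \<otimes> coset_apply C x)"
  proof -
    assume f': "f \<in> functionals L_module"
      and thesis: "\<And>p. (\<And>C. C \<in> \<Omega> \<Longrightarrow> p C \<in> carrier E) \<Longrightarrow>
        (\<And>x. x \<in> L \<Longrightarrow> f x = (\<Oplus>C\<in>\<Omega>. p C \<otimes> coset_apply C x)) \<Longrightarrow> thesis"
    obtain B where B: "\<And>p y. p \<in> set B \<Longrightarrow> y \<in> \<Omega> \<Longrightarrow> fst p y \<in> carrier E"
      "\<And>p. p \<in> set B \<Longrightarrow> snd p \<in> carrier L_module"
      "\<And>\<phi> u. \<phi> \<in> functionals L_module \<Longrightarrow> u \<in> carrier L_module \<Longrightarrow>
        \<phi> u = (\<Oplus>y\<in>\<Omega>. lsum E (\<lambda>p. fst p y \<otimes> \<phi> (snd p)) B \<otimes> coset_apply y u)"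
      using coordinatized_L by (rule coordinatizedE) blast
    show thesis
    proof (rule thesis[of "\<lambda>C. lsum E (\<lambda>p. fst p C \<otimes> f (snd p)) B"])
      show "lsum E (\<lambda>p. fst p C \<otimes> f (snd p)) B \<in> carrier E" if "C \<in> \<Omega>" for C
        using that B(1,2) fL by (intro lsum_closed m_closed) auto
    qed (use B(3)[OF f'] in simp)
  qed
  \<comment> \<open>The values of \<open>f\<close> are fixed by \<open>s\<close>, so applying \<open>s\<close> to the expansion of \<open>f\<close> gives another
    expansion of \<open>f\<close>.\<close>
  have p_S: "p (\<tau> s C) = s (p C)" if s: "s \<in> S" and C: "C \<in> \<Omega>" for s C
  proof -
    have sG: "s \<in> carrier G" using s by (rule S_G)
    let ?p = "\<lambda>C. s (p (\<tau> (inv\<^bsub>G\<^esub> s) C))"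
    have "p (\<tau> s C) = ?p (\<tau> s C)"
    proof (rule dedekind_cosets[where z = p and z' = ?p])
      fix x assume x: "x \<in> L"
      have "(\<Oplus>C\<in>\<Omega>. p C \<otimes> coset_apply C x) = s (f x)"
        using p(2)[OF x] S_fix[OF s fL[OF x]] by simp
      also have "\<dots> = (\<Oplus>C\<in>\<Omega>. s (p C) \<otimes> coset_apply (\<tau> s C) x)"
        using p x sG by (simp, intro finsum_cong' refl) (auto simp: coset_apply_translation)
      also have "\<dots> = (\<Oplus>C\<in>\<Omega>. ?p (\<tau> s C) \<otimes> coset_apply (\<tau> s C) x)"
        using p x sG by (intro finsum_cong' refl) auto
      also have "\<dots> = (\<Oplus>C\<in>\<Omega>. ?p C \<otimes> coset_apply C x)"
        using p x sG
        by (intro finsum_reindex_bij[OF X.bij_betw_act, where f = "\<lambda>C. ?p C \<otimes> coset_apply C x"]) auto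
      finally show "(\<Oplus>C\<in>\<Omega>. p C \<otimes> coset_apply C x) = (\<Oplus>C\<in>\<Omega>. ?p C \<otimes> coset_apply C x)" .
    qed (use p sG C in auto)
    then show ?thesis using sG C by simp
  qed
  define q where "q n = p (twist n)" for n
  have q: "q n \<in> carrier E" if "n \<in> N" for n using that p(1) by (simp add: q_def)
  have q_S: "q (conj s n) = s (q n)" if "s \<in> S" "n \<in> N" for s n
    using that p_S by (simp add: q_def twist_conj_stabilizer)
  \<comment> \<open>The induced function \<open>Q\<close> does not depend on the representatives \<open>r C\<close>, because \<open>q\<close> is equivariant
    for \<open>S\<close>.\<close>
  define r where "r C = (SOME g. g \<in> carrier G \<and> C = \<tau> g base)" for C
  have r: "r C \<in> carrier G" "\<tau> (r C) base = C" if "C \<in> \<Omega>" for C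
  proof -
    have "\<exists>g. g \<in> carrier G \<and> C = \<tau> g base" using that by (blast elim: coset_as_translate)
    from someI_ex[OF this] show "r C \<in> carrier G" "\<tau> (r C) base = C" by (auto simp: r_def)
  qed
  define Q where "Q C n = r C (q (conj (inv\<^bsub>G\<^esub> (r C)) n))" for C n
  have Q_eq: "Q (\<tau> g base) n = g (q (conj (inv\<^bsub>G\<^esub> g) n))" if g: "g \<in> carrier G" and n: "n \<in> N" for g n
  proof -
    define h where "h = r (\<tau> g base)"
    have h: "h \<in> carrier G" "\<tau> h base = \<tau> g base" using r[of "\<tau> g base"] g by (auto simp: h_def)
    define s where "s = inv\<^bsub>G\<^esub> g \<otimes>\<^bsub>G\<^esub> h"
    have sG: "s \<in> carrier G" using g h by (simp add: s_def)
    have "\<tau> s base = base" using g h by (simp add: s_def X.act_mult)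
    then have s: "s \<in> S" using translation_base_eq_iff[OF sG] by simp
    have h_eq: "h = g \<otimes>\<^bsub>G\<^esub> s" using g h by (simp add: s_def G.m_assoc[symmetric])
    have "Q (\<tau> g base) n = h (q (conj (inv\<^bsub>G\<^esub> h) n))" by (simp add: Q_def h_def)
    also have "conj (inv\<^bsub>G\<^esub> h) n = conj (inv\<^bsub>G\<^esub> s) (conj (inv\<^bsub>G\<^esub> g) n)"
      using g sG n by (simp add: h_eq G.inv_mult_group N.act_mult)
    also have "h (q (conj (inv\<^bsub>G\<^esub> s) (conj (inv\<^bsub>G\<^esub> g) n))) =
        g (q (conj s (conj (inv\<^bsub>G\<^esub> s) (conj (inv\<^bsub>G\<^esub> g) n))))"
      using g sG s n q by (simp add: h_eq q_S del: N.act_inv)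
    also have "\<dots> = g (q (conj (inv\<^bsub>G\<^esub> g) n))"
      using g sG n by simp
    finally show ?thesis .
  qed
  interpret XN: gset_pair E K \<Omega> \<tau> N conj by unfold_locales
  obtain s where s: "s \<in> lists (X.W \<times> N.W)"
    "\<And>C n. C \<in> \<Omega> \<Longrightarrow> n \<in> N \<Longrightarrow> Q C n = lsum E (\<lambda>(u, v). u C \<otimes> v n) s"
  proof (rule XN.equivariant_maps_product[of Q])
    show "Q C n \<in> carrier E" if "C \<in> \<Omega>" "n \<in> N" for C n
      using that r[OF that(1)] q by (simp add: Q_def)
    fix g C n assume g: "g \<in> carrier G" and C: "C \<in> \<Omega>" and n: "n \<in> N"
    obtain h where h: "h \<in> carrier G" "C = \<tau> h base" using C by (rule coset_as_translate)
    have "Q (\<tau> g C) (conj g n) = Q (\<tau> (g \<otimes>\<^bsub>G\<^esub> h) base) (conj g n)"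
      using g h by (simp add: X.act_mult)
    also have "\<dots> = (g \<otimes>\<^bsub>G\<^esub> h) (q (conj (inv\<^bsub>G\<^esub> (g \<otimes>\<^bsub>G\<^esub> h)) (conj g n)))"
      using g h n by (intro Q_eq) auto
    also have "conj (inv\<^bsub>G\<^esub> (g \<otimes>\<^bsub>G\<^esub> h)) (conj g n) = conj (inv\<^bsub>G\<^esub> h) n"
      using g h n by (simp add: G.inv_mult_group N.act_mult)
    also have "(g \<otimes>\<^bsub>G\<^esub> h) (q (conj (inv\<^bsub>G\<^esub> h) n)) = g (Q C n)"
      using g h n q by (simp add: Q_eq)
    finally show "Q (\<tau> g C) (conj g n) = g (Q C n)" .
  qed blast
  have mem: "fst i \<in> X.W" "snd i \<in> N.W" if "i \<in> set s" for i
    using s(1) that by (auto simp: in_lists_conv_set)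
  let ?s = "map (\<lambda>i. (fst i base, snd i)) s"
  show thesis
  proof
    show sL: "?s \<in> lists (L \<times> N.W)"
      using mem equivariant_imp_coset_apply(1) by (auto simp: in_lists_conv_set)
    fix x assume x: "x \<in> L"
    have "lsum E (\<lambda>(l, a). l \<otimes> action A a x) ?s =
        (\<Oplus>n\<in>N. lsum E (\<lambda>(l, a). l \<otimes> a n) ?s \<otimes> coset_apply (twist n) x)"
      by (rule smash_sum[OF sL x])
    also have "\<dots> = (\<Oplus>n\<in>N. p (twist n) \<otimes> coset_apply (twist n) x)"
    proof (intro finsum_cong' refl funcsetI)
      fix n assume n: "n \<in> N"
      have "lsum E (\<lambda>(l, a). l \<otimes> a n) ?s = Q base n"
        using s(2)[OF base_mem n] by (simp add: lsum_map case_prod_unfold)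
      also have "\<dots> = p (twist n)"
        using Q_eq[of "\<one>\<^bsub>G\<^esub>" n] n q[OF n] by (simp add: q_def)
      finally show "lsum E (\<lambda>(l, a). l \<otimes> a n) ?s \<otimes> coset_apply (twist n) x =
          p (twist n) \<otimes> coset_apply (twist n) x" by simp
    qed (use p x in auto)
    also have "\<dots> = f x"
      unfolding p(2)[OF x] using p(1) x by (intro finsum_twist) auto
    finally show "f x = lsum E (\<lambda>(l, a). l \<otimes> action A a x) ?s" ..
  qed
qed

theorem hopf_galois_structure_gp: "hopf_galois_structure E K L A"
  unfolding hopf_galois_structure_def Let_def
proof (intro conjI ballI impI)
  show "hopf_algebra F A" by (rule hopf_algebra_gp)
  show "action A \<in> bilinear_maps F A L_module L_module" by (rule action_bilinear)
next
  fix s t assume "s \<in> lists (L \<times> carrier A)" "t \<in> lists (L \<times> carrier A)"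
    "\<forall>x\<in>L. lsum E (\<lambda>(l, a). l \<otimes> action A a x) s = lsum E (\<lambda>(l, a). l \<otimes> action A a x) t"
  then show "tensor_eq F L_module A s t" by (intro smash_injective) auto
next
  fix f assume "f \<in> linear_maps F L_module L_module"
  then show "\<exists>s\<in>lists (L \<times> carrier A). \<forall>x\<in>L. f x = lsum E (\<lambda>(l, a). l \<otimes> action A a x) s"
    by (rule smash_surjective) auto
qed (auto simp: action_one action_mult action_unit action_product simp del: gp_apply)

end

section \<open>Isomorphisms of Hopf-Galois structures\<close>

lemma hopf_galois_isomorphicE:
  assumes "hopf_galois_isomorphic E K L A B"
  obtains \<psi> where "\<psi> \<in> ring_iso A B" "\<psi> \<in> linear_maps (E\<lparr>carrier := K\<rparr>) A B"
    "\<And>a s. a \<in> carrier A \<Longrightarrow> s \<in> comult A a \<Longrightarrow> map (map_prod \<psi> \<psi>) s \<in> comult B (\<psi> a)"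
    "\<And>a. a \<in> carrier A \<Longrightarrow> counit B (\<psi> a) = counit A a"
    "\<And>a x. a \<in> carrier A \<Longrightarrow> x \<in> L \<Longrightarrow> action B (\<psi> a) x = action A a x"
  using assms unfolding hopf_galois_isomorphic_def by blast

lemma hopf_galois_isomorphic_refl: "hopf_galois_isomorphic E K L A A"
proof -
  have "id \<in> ring_iso A A" by (auto simp: ring_iso_def ring_hom_def)
  moreover have "id \<in> linear_maps (E\<lparr>carrier := K\<rparr>) A A" by (auto simp: linear_maps_def)
  ultimately show ?thesis
    unfolding hopf_galois_isomorphic_def by (intro exI[of _ id]) (auto simp: prod.map_id0)
qed

lemma hopf_galois_isomorphic_trans:
  assumes "hopf_galois_isomorphic E K L A B" "hopf_galois_isomorphic E K L B C"
  shows "hopf_galois_isomorphic E K L A C"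
proof -
  obtain \<psi> where \<psi>: "\<psi> \<in> ring_iso A B" "\<psi> \<in> linear_maps (E\<lparr>carrier := K\<rparr>) A B"
    "\<And>a s. a \<in> carrier A \<Longrightarrow> s \<in> comult A a \<Longrightarrow> map (map_prod \<psi> \<psi>) s \<in> comult B (\<psi> a)"
    "\<And>a. a \<in> carrier A \<Longrightarrow> counit B (\<psi> a) = counit A a"
    "\<And>a x. a \<in> carrier A \<Longrightarrow> x \<in> L \<Longrightarrow> action B (\<psi> a) x = action A a x"
    using assms(1) by (rule hopf_galois_isomorphicE) blast
  obtain \<chi> where \<chi>: "\<chi> \<in> ring_iso B C" "\<chi> \<in> linear_maps (E\<lparr>carrier := K\<rparr>) B C"
    "\<And>a s. a \<in> carrier B \<Longrightarrow> s \<in> comult B a \<Longrightarrow> map (map_prod \<chi> \<chi>) s \<in> comult C (\<chi> a)"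
    "\<And>a. a \<in> carrier B \<Longrightarrow> counit C (\<chi> a) = counit B a"
    "\<And>a x. a \<in> carrier B \<Longrightarrow> x \<in> L \<Longrightarrow> action C (\<chi> a) x = action B a x"
    using assms(2) by (rule hopf_galois_isomorphicE) blast
  have \<psi>B: "\<psi> a \<in> carrier B" if "a \<in> carrier A" for a
    using linear_mapsD(1)[OF \<psi>(2) that] .
  show ?thesis
    unfolding hopf_galois_isomorphic_def
  proof (intro exI[of _ "\<chi> \<circ> \<psi>"] conjI ballI)
    show "\<chi> \<circ> \<psi> \<in> ring_iso A C" using \<psi>(1) \<chi>(1) by (rule ring_iso_set_trans)
    show "\<chi> \<circ> \<psi> \<in> linear_maps (E\<lparr>carrier := K\<rparr>) A C"
      using \<psi>B linear_mapsD[OF \<psi>(2)] linear_mapsD[OF \<chi>(2)]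
      unfolding linear_maps_def by simp
    show "map (map_prod (\<chi> \<circ> \<psi>) (\<chi> \<circ> \<psi>)) s \<in> comult C ((\<chi> \<circ> \<psi>) a)"
      if "a \<in> carrier A" "s \<in> comult A a" for a s
      using \<chi>(3)[OF \<psi>B[OF that(1)] \<psi>(3)[OF that]] by (simp add: map_prod.comp)
  qed (use \<psi> \<chi> \<psi>B in auto)
qed

lemma tensor_product_member:
  assumes "T \<in> tensor_product F M N"
  obtains s where "s \<in> T" "\<And>t. t \<in> T \<longleftrightarrow>
    s \<in> lists (carrier M \<times> carrier N) \<and> t \<in> lists (carrier M \<times> carrier N) \<and> tensor_eq F M N s t"
proof -
  obtain s where s: "s \<in> lists (carrier M \<times> carrier N)" and
    T: "T = {(s, t). s \<in> lists (carrier M \<times> carrier N) \<and> t \<in> lists (carrier M \<times> carrier N) \<and>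
      tensor_eq F M N s t} `` {s}"
    using assms unfolding tensor_product_def by (rule quotientE)
  then show thesis
    by (intro that[of s]) (auto simp: tensor_eq_def)
qed

text \<open>For the inverse of an isomorphism to respect comultiplication, a coproduct has to be a full
  class of formal sums: the inverse image of a formal sum is then equivalent to a representative
  of the coproduct, although it need not be that representative.\<close>

lemma hopf_galois_isomorphic_sym:
  assumes A: "hopf_galois_structure E K L A" and B: "hopf_galois_structure E K L B"
    and iso: "hopf_galois_isomorphic E K L A B"
  shows "hopf_galois_isomorphic E K L B A"
proof -
  let ?F = "E\<lparr>carrier := K\<rparr>"
  have hopf: "ring A" "module ?F A" "comult A \<in> carrier A \<rightarrow> tensor_product ?F A A"
    "comult B \<in> carrier B \<rightarrow> tensor_product ?F B B"
  proof -
    have "unital_algebra ?F A" "coalgebra ?F A" "coalgebra ?F B"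
      using A B unfolding hopf_galois_structure_def Let_def hopf_algebra_def bialgebra_def
      by simp_all
    then show "ring A" "module ?F A" "comult A \<in> carrier A \<rightarrow> tensor_product ?F A A"
      "comult B \<in> carrier B \<rightarrow> tensor_product ?F B B"
      unfolding unital_algebra_def coalgebra_def by simp_all
  qed
  interpret M: module ?F A by fact
  obtain \<psi> where \<psi>: "\<psi> \<in> ring_iso A B" "\<psi> \<in> linear_maps ?F A B"
    "\<And>a s. a \<in> carrier A \<Longrightarrow> s \<in> comult A a \<Longrightarrow> map (map_prod \<psi> \<psi>) s \<in> comult B (\<psi> a)"
    "\<And>a. a \<in> carrier A \<Longrightarrow> counit B (\<psi> a) = counit A a"
    "\<And>a x. a \<in> carrier A \<Longrightarrow> x \<in> L \<Longrightarrow> action B (\<psi> a) x = action A a x"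
    using iso by (rule hopf_galois_isomorphicE) blast
  have bij: "bij_betw \<psi> (carrier A) (carrier B)"
    using \<psi>(1) by (simp add: ring_iso_def)
  define \<chi> where "\<chi> = inv_into (carrier A) \<psi>"
  have \<chi>A: "\<chi> b \<in> carrier A" and \<psi>\<chi>: "\<psi> (\<chi> b) = b" if "b \<in> carrier B" for b
    using that bij by (auto simp: \<chi>_def bij_betw_def inv_into_into f_inv_into_f)
  have \<chi>\<psi>: "\<chi> (\<psi> a) = a" if "a \<in> carrier A" for a
    using that bij by (auto simp: \<chi>_def bij_betw_def)
  have \<chi>_lin: "\<chi> \<in> linear_maps ?F B A"
    unfolding linear_maps_def
  proof (intro CollectI conjI ballI funcsetI)
    show "\<chi> b \<in> carrier A" if "b \<in> carrier B" for b using \<chi>A[OF that] .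
    show "\<chi> (b \<oplus>\<^bsub>B\<^esub> c) = \<chi> b \<oplus>\<^bsub>A\<^esub> \<chi> c" if "b \<in> carrier B" "c \<in> carrier B" for b c
      using that \<chi>A \<psi>\<chi> linear_mapsD(2)[OF \<psi>(2), of "\<chi> b" "\<chi> c"]
        \<chi>\<psi>[of "\<chi> b \<oplus>\<^bsub>A\<^esub> \<chi> c"] by simp
    show "\<chi> (k \<odot>\<^bsub>B\<^esub> b) = k \<odot>\<^bsub>A\<^esub> \<chi> b" if "k \<in> carrier ?F" "b \<in> carrier B" for k b
      using that \<chi>A \<psi>\<chi> linear_mapsD(3)[OF \<psi>(2), of k "\<chi> b"] \<chi>\<psi>[of "k \<odot>\<^bsub>A\<^esub> \<chi> b"]
        M.smult_closed[of k "\<chi> b"] by simp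
  qed
  have \<chi>_bilin: "(\<lambda>x y. \<beta> (\<chi> x) (\<chi> y)) \<in> bilinear_maps ?F B B (self_module ?F)"
    if \<beta>: "\<beta> \<in> bilinear_maps ?F A A (self_module ?F)" for \<beta>
  proof -
    have comp: "(\<lambda>x. f (\<chi> x)) \<in> linear_maps ?F B (self_module ?F)"
      if f: "f \<in> linear_maps ?F A (self_module ?F)" for f
      using linear_mapsD[OF f] linear_mapsD[OF \<chi>_lin] \<chi>A
      unfolding linear_maps_def by simp
    show ?thesis
      using \<beta> comp \<chi>A unfolding bilinear_maps_def by blast
  qed
  show ?thesis
    unfolding hopf_galois_isomorphic_def
  proof (intro exI[of _ \<chi>] conjI ballI)
    show "\<chi> \<in> ring_iso B A"
      unfolding \<chi>_def using hopf(1) \<psi>(1) by (rule ring_iso_set_sym)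
    show "\<chi> \<in> linear_maps ?F B A" by fact
    fix b t assume b: "b \<in> carrier B" and t: "t \<in> comult B b"
    have "comult A (\<chi> b) \<in> tensor_product ?F A A" using hopf(3) \<chi>A[OF b] by auto
    from tensor_product_member[OF this] obtain s where s: "s \<in> comult A (\<chi> b)" "\<And>r. r \<in> comult A (\<chi> b) \<longleftrightarrow>
        s \<in> lists (carrier A \<times> carrier A) \<and> r \<in> lists (carrier A \<times> carrier A) \<and> tensor_eq ?F A A s r"
      by metis
    have "comult B b \<in> tensor_product ?F B B" using hopf(4) b by auto
    from tensor_product_member[OF this] obtain s' where s': "\<And>r. r \<in> comult B b \<longleftrightarrow>
        s' \<in> lists (carrier B \<times> carrier B) \<and> r \<in> lists (carrier B \<times> carrier B) \<and> tensor_eq ?F B B s' r"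
      by metis
    have sA: "s \<in> lists (carrier A \<times> carrier A)" using s by blast
    have tB: "t \<in> lists (carrier B \<times> carrier B)" using s' t by blast
    have "map (map_prod \<psi> \<psi>) s \<in> comult B b"
      using \<psi>(3)[OF \<chi>A[OF b] s(1)] \<psi>\<chi>[OF b] by simp
    then have eq: "tensor_eq ?F B B (map (map_prod \<psi> \<psi>) s) t"
      using s' t unfolding tensor_eq_def by metis
    have "tensor_eq ?F A A s (map (map_prod \<chi> \<chi>) t)"
      unfolding tensor_eq_def
    proof
      fix \<beta> assume \<beta>: "\<beta> \<in> bilinear_maps ?F A A (self_module ?F)"
      have "lsum ?F (\<lambda>(x, y). \<beta> x y) s =
          lsum ?F (\<lambda>(x, y). \<beta> (\<chi> x) (\<chi> y)) (map (map_prod \<psi> \<psi>) s)"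
        unfolding lsum_map using sA by (intro lsum_cong) (auto simp: in_lists_conv_set \<chi>\<psi>)
      also have "\<dots> = lsum ?F (\<lambda>(x, y). \<beta> (\<chi> x) (\<chi> y)) t"
        using eq \<chi>_bilin[OF \<beta>] unfolding tensor_eq_def by blast
      also have "\<dots> = lsum ?F (\<lambda>(x, y). \<beta> x y) (map (map_prod \<chi> \<chi>) t)"
        unfolding lsum_map by (intro lsum_cong) auto
      finally show "lsum ?F (\<lambda>(x, y). \<beta> x y) s =
          lsum ?F (\<lambda>(x, y). \<beta> x y) (map (map_prod \<chi> \<chi>) t)" .
    qed
    moreover have "map (map_prod \<chi> \<chi>) t \<in> lists (carrier A \<times> carrier A)"
      using tB \<chi>A by (fastforce simp: in_lists_conv_set)
    ultimately show "map (map_prod \<chi> \<chi>) t \<in> comult A (\<chi> b)"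
      using s sA by blast
  next
    show "counit A (\<chi> b) = counit B b" if "b \<in> carrier B" for b
      using \<psi>(4)[OF \<chi>A[OF that]] \<psi>\<chi>[OF that] by simp
    show "action A (\<chi> b) x = action B b x" if "b \<in> carrier B" "x \<in> L" for b x
      using \<psi>(5)[OF \<chi>A[OF that(1)] that(2)] \<psi>\<chi>[OF that(1)] by simp
  qed
qed

section \<open>Injectivity of the Greither-Pareigis correspondence\<close>

context gset
begin

text \<open>If \<open>y\<close> and \<open>z\<close> were not separated, neither would be their indicator functions as coefficients.\<close>

lemma equivariant_maps_separate_points:
  assumes y: "y \<in> Y" and z: "z \<in> Y" and eq: "\<And>w. w \<in> W \<Longrightarrow> w y = w z"
  shows "y = z"
proof (rule ccontr)
  assume ne: "y \<noteq> z"
  have "(if y = y then \<one> else \<zero>) = (if y = z then \<one> else \<zero>)"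
  proof (rule equivariant_maps_separate_coefficients
      [where c = "\<lambda>x. if x = y then \<one> else \<zero>" and c' = "\<lambda>x. if x = z then \<one> else \<zero>"])
    fix w assume w: "w \<in> W"
    have "(\<Oplus>x\<in>Y. (if x = u then \<one> else \<zero>) \<otimes> w x) = w u" if u: "u \<in> Y" for u
    proof -
      have "(\<Oplus>x\<in>Y. (if x = u then \<one> else \<zero>) \<otimes> w x) = (\<Oplus>x\<in>Y. if x = u then w x else \<zero>)"
        using w by (intro finsum_cong' refl) auto
      also have "\<dots> = w u" using w u by (intro finsum_delta) auto
      finally show ?thesis .
    qed
    then show "(\<Oplus>x\<in>Y. (if x = y then \<one> else \<zero>) \<otimes> w x) = (\<Oplus>x\<in>Y. (if x = z then \<one> else \<zero>) \<otimes> w x)"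
      using eq[OF w] y z by simp
  qed (use y in auto)
  with ne show False by simp
qed

end

context intermediate_field
begin

text \<open>An isomorphism of the structures respects the action on \<open>L\<close>, so by independence of the
  embeddings it is given by the bijection \<open>\<theta>\<close> that preserves \<open>twist\<close>; since it is multiplicative,
  so is \<open>\<theta>\<close>, and regularity forces \<open>\<theta> n = n\<close>.\<close>

lemma greither_pareigis_inject:
  assumes N: "regular_stable_subgroup E K L N" and N': "regular_stable_subgroup E K L N'"
    and iso: "hopf_galois_isomorphic E K L (greither_pareigis E K L N) (greither_pareigis E K L N')"
  shows "N = N'"
proof -
  interpret M: regular_stable E K L N by unfold_locales (fact N)
  interpret M': regular_stable E K L N' by unfold_locales (fact N')
  obtain \<psi> where \<psi>: "\<psi> \<in> ring_iso M.A M'.A"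
    "\<And>a x. a \<in> carrier M.A \<Longrightarrow> x \<in> L \<Longrightarrow> action M'.A (\<psi> a) x = action M.A a x"
    using iso by (rule hopf_galois_isomorphicE) blast
  have \<psi>W: "\<psi> a \<in> M'.N.W" if "a \<in> M.N.W" for a
    using \<psi>(1) that by (auto simp: ring_iso_def ring_hom_def)
  have \<psi>_mult: "\<psi> (a \<otimes>\<^bsub>M.A\<^esub> b) = \<psi> a \<otimes>\<^bsub>M'.A\<^esub> \<psi> b" if "a \<in> M.N.W" "b \<in> M.N.W" for a b
    using \<psi>(1) that by (auto simp: ring_iso_def ring_hom_def)
  define \<theta> where "\<theta> n = inv_into N' M'.twist (M.twist n)" for n
  have \<theta>: "\<theta> n \<in> N'" "M'.twist (\<theta> n) = M.twist n" if "n \<in> N" for n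
    using M.twist_mem[OF that] M'.bij_betw_twist
    by (auto simp: \<theta>_def bij_betw_def inv_into_into f_inv_into_f)
  have bij: "bij_betw \<theta> N N'"
  proof -
    have "bij_betw (inv_into N' M'.twist \<circ> M.twist) N N'"
      using M.bij_betw_twist bij_betw_inv_into[OF M'.bij_betw_twist] by (rule bij_betw_trans)
    then show ?thesis by (simp add: \<theta>_def[abs_def] comp_def)
  qed
  have \<psi>\<theta>: "\<psi> a (\<theta> n) = a n" if a: "a \<in> M.N.W" and n: "n \<in> N" for a n
  proof (rule M.twist_independent[where z = "\<lambda>n. \<psi> a (\<theta> n)" and z' = a])
    fix x assume x: "x \<in> L"
    have "(\<Oplus>n\<in>N. \<psi> a (\<theta> n) \<otimes> coset_apply (M.twist n) x) =
        (\<Oplus>n\<in>N. \<psi> a (\<theta> n) \<otimes> coset_apply (M'.twist (\<theta> n)) x)"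
      using \<psi>W[OF a] x \<theta> by (intro finsum_cong' refl) auto
    also have "\<dots> = (\<Oplus>n\<in>N'. \<psi> a n \<otimes> coset_apply (M'.twist n) x)"
      using \<psi>W[OF a] x
      by (intro finsum_reindex_bij[OF bij, where f = "\<lambda>n. \<psi> a n \<otimes> coset_apply (M'.twist n) x"]) auto
    also have "\<dots> = (\<Oplus>n\<in>N. a n \<otimes> coset_apply (M.twist n) x)"
      using \<psi>(2)[of a x] a x by (simp add: M.gp_action M'.gp_action)
    finally show "(\<Oplus>n\<in>N. \<psi> a (\<theta> n) \<otimes> coset_apply (M.twist n) x) =
        (\<Oplus>n\<in>N. a n \<otimes> coset_apply (M.twist n) x)" .
  qed (use a n \<theta> \<psi>W[OF a] in auto)
  have \<theta>_quot: "\<theta> (inv\<^bsub>P\<^esub> n \<otimes>\<^bsub>P\<^esub> k) = inv\<^bsub>P\<^esub> (\<theta> n) \<otimes>\<^bsub>P\<^esub> \<theta> k" if n: "n \<in> N" and k: "k \<in> N" for n k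
  proof -
    \<comment> \<open>Both \<open>m\<^sup>-\<^sup>1 \<cdot> k\<close> and \<open>\<rho> m\<close> are the place at which \<open>b\<close> enters the coefficient of \<open>a m\<close> in the
      value of \<open>a \<cdot> b\<close> at \<open>k\<close>: the first computed in \<open>N\<close>, the second in \<open>N'\<close>.\<close>
    define \<rho> where "\<rho> m = inv_into N \<theta> (inv\<^bsub>P\<^esub> (\<theta> m) \<otimes>\<^bsub>P\<^esub> \<theta> k)" for m
    have \<rho>: "\<rho> m \<in> N" "\<theta> (\<rho> m) = inv\<^bsub>P\<^esub> (\<theta> m) \<otimes>\<^bsub>P\<^esub> \<theta> k" if "m \<in> N" for m
    proof -
      have "inv\<^bsub>P\<^esub> (\<theta> m) \<otimes>\<^bsub>P\<^esub> \<theta> k \<in> \<theta> ` N"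
        using bij \<theta>(1)[OF that] \<theta>(1)[OF k] by (simp add: bij_betw_def)
      then show "\<rho> m \<in> N" "\<theta> (\<rho> m) = inv\<^bsub>P\<^esub> (\<theta> m) \<otimes>\<^bsub>P\<^esub> \<theta> k"
        by (simp_all add: \<rho>_def inv_into_into f_inv_into_f)
    qed
    have "inv\<^bsub>P\<^esub> n \<otimes>\<^bsub>P\<^esub> k = \<rho> n"
    proof (rule M.N.equivariant_maps_separate_points)
      fix b assume b: "b \<in> M.N.W"
      show "b (inv\<^bsub>P\<^esub> n \<otimes>\<^bsub>P\<^esub> k) = b (\<rho> n)"
      proof (rule M.N.equivariant_maps_separate_coefficients
          [where c = "\<lambda>n. b (inv\<^bsub>P\<^esub> n \<otimes>\<^bsub>P\<^esub> k)" and c' = "\<lambda>n. b (\<rho> n)"])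
        fix a assume a: "a \<in> M.N.W"
        have "(\<Oplus>m\<in>N. b (inv\<^bsub>P\<^esub> m \<otimes>\<^bsub>P\<^esub> k) \<otimes> a m) = (a \<otimes>\<^bsub>M.A\<^esub> b) k"
          using a b k by (simp, intro finsum_cong' refl) (auto simp: m_comm)
        also have "\<dots> = (\<psi> a \<otimes>\<^bsub>M'.A\<^esub> \<psi> b) (\<theta> k)"
          using \<psi>\<theta>[OF M.mult_closed[OF a b] k] \<psi>_mult[OF a b] by simp
        also have "\<dots> = (\<Oplus>n\<in>N'. \<psi> a n \<otimes> \<psi> b (inv\<^bsub>P\<^esub> n \<otimes>\<^bsub>P\<^esub> \<theta> k))"
          using \<theta>(1)[OF k] by simp
        also have "\<dots> = (\<Oplus>m\<in>N. \<psi> a (\<theta> m) \<otimes> \<psi> b (inv\<^bsub>P\<^esub> (\<theta> m) \<otimes>\<^bsub>P\<^esub> \<theta> k))"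
          using \<psi>W[OF a] \<psi>W[OF b] \<theta>(1)[OF k]
          by (intro finsum_reindex_bij[OF bij, symmetric,
                where f = "\<lambda>n. \<psi> a n \<otimes> \<psi> b (inv\<^bsub>P\<^esub> n \<otimes>\<^bsub>P\<^esub> \<theta> k)"]) auto
        also have "\<dots> = (\<Oplus>m\<in>N. b (\<rho> m) \<otimes> a m)"
          using a b \<rho> by (intro finsum_cong' refl) (auto simp: \<psi>\<theta> \<rho>(2)[symmetric] m_comm)
        finally show "(\<Oplus>m\<in>N. b (inv\<^bsub>P\<^esub> m \<otimes>\<^bsub>P\<^esub> k) \<otimes> a m) = (\<Oplus>m\<in>N. b (\<rho> m) \<otimes> a m)" .
      qed (use b n k \<rho> in auto)
    qed (use n k \<rho> in auto)
    then show ?thesis using \<rho>(2)[OF n] by simp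
  qed
  have quot: "(inv\<^bsub>P\<^esub> k) (n base) = (inv\<^bsub>P\<^esub> (\<theta> k)) (\<theta> n base)" if n: "n \<in> N" and k: "k \<in> N" for n k
  proof -
    have "M.twist (inv\<^bsub>P\<^esub> n \<otimes>\<^bsub>P\<^esub> k) = M'.twist (inv\<^bsub>P\<^esub> (\<theta> n) \<otimes>\<^bsub>P\<^esub> \<theta> k)"
      using \<theta>(2)[of "inv\<^bsub>P\<^esub> n \<otimes>\<^bsub>P\<^esub> k"] n k by (simp add: \<theta>_quot)
    then show ?thesis
      using n k \<theta>(1)[OF n] \<theta>(1)[OF k]
      by (simp add: M.twist_def P.inv_mult_group perm_mult_apply)
  qed
  have \<theta>_one: "\<theta> \<one>\<^bsub>P\<^esub> = \<one>\<^bsub>P\<^esub>"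
    using \<theta>_quot[of "\<one>\<^bsub>P\<^esub>" "\<one>\<^bsub>P\<^esub>"] \<theta>(1)[of "\<one>\<^bsub>P\<^esub>"] by simp
  have base: "\<theta> n base = n base" if n: "n \<in> N" for n
    using quot[OF n, of "\<one>\<^bsub>P\<^esub>"] n \<theta>(1)[OF n] by (simp add: \<theta>_one perm_one_apply)
  have \<theta>_id: "\<theta> k = k" if k: "k \<in> N" for k
  proof -
    have "inv\<^bsub>P\<^esub> (\<theta> k) = inv\<^bsub>P\<^esub> k"
    proof (rule perm_eqI)
      fix C assume "C \<in> \<Omega>"
      then obtain n where n: "n \<in> N" "n base = C" using M.regular[of base C] by auto
      then show "(inv\<^bsub>P\<^esub> (\<theta> k)) C = (inv\<^bsub>P\<^esub> k) C"
        using quot[OF n(1) k] base[OF n(1)] by simp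
    qed (use k \<theta>(1)[OF k] in auto)
    then show ?thesis using k \<theta>(1)[OF k] P.inv_inv by (metis M.N_P M'.N_P)
  qed
  then have "\<theta> ` N = N" by simp
  then show "N = N'" using bij by (simp add: bij_betw_def)
qed

section \<open>Operations and regular subgroups\<close>

abbreviation additive_group where
  "additive_group star \<equiv> \<lparr>carrier = \<Omega>, monoid.mult = star, one = base\<rparr>"

definition right_translation where "right_translation star y = (\<lambda>x\<in>\<Omega>. star x y)"

lemma stabilizer_base: "stabilizer G \<tau> base = S"
  unfolding stabilizer_def using translation_base_eq_iff S_G by blast

lemma complement_carrier:
  assumes "normal_complement G S H" "h \<in> H"
  shows "h \<in> carrier G"
proof -
  have "subgroup H G"
    using assms(1) by (simp add: normal_complement_def normal_imp_subgroup)
  then show ?thesis using assms(2) by (rule subgroup.mem_carrier)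
qed

lemma complement_transitive:
  assumes H: "normal_complement G S H" and C: "C \<in> \<Omega>"
  obtains h where "h \<in> H" "C = \<tau> h base"
proof -
  obtain g where g: "g \<in> carrier G" "C = \<tau> g base" using C by (rule coset_as_translate)
  have "g \<in> H <#>\<^bsub>G\<^esub> S" using H g(1) by (simp add: normal_complement_def)
  then obtain h s where hs: "h \<in> H" "s \<in> S" "g = h \<otimes>\<^bsub>G\<^esub> s" by (auto simp: set_mult_def)
  have hG: "h \<in> carrier G" using H hs(1) by (rule complement_carrier)
  have "C = \<tau> h base"
    using g hs hG S_G[OF hs(2)] translation_base_eq_iff[OF S_G[OF hs(2)]] by (simp add: X.act_mult)
  with hs(1) show thesis by (rule that)
qed

lemma almost_classical_operationD:
  assumes "star \<in> almost_classical_operations E K L"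
  shows "star \<in> \<Omega> \<rightarrow>\<^sub>E (\<Omega> \<rightarrow>\<^sub>E \<Omega>)" "group (additive_group star)"
    "\<And>g x y. g \<in> carrier G \<Longrightarrow> x \<in> \<Omega> \<Longrightarrow> y \<in> \<Omega> \<Longrightarrow> \<tau> g (star x y) =
      star (star (\<tau> g x) (inv\<^bsub>additive_group star\<^esub> (\<tau> g base))) (\<tau> g y)"
    "\<exists>H. normal_complement G S H \<and>
      (\<forall>h\<in>H. \<forall>k\<in>H. star (\<tau> h base) (\<tau> k base) = \<tau> (h \<otimes>\<^bsub>G\<^esub> k) base)"
  using assms unfolding almost_classical_operations_def almost_classical_bracoid_def
    skew_bracoid_def by (auto simp: stabilizer_base)

text \<open>The bracoid law says that conjugation by \<open>\<tau> g\<close> takes right multiplication by \<open>y\<close> to right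
  multiplication by \<open>(\<tau> g base)\<^sup>-\<^sup>1 \<star> \<tau> g y\<close>.\<close>

lemma right_translations_regular_stable:
  assumes star: "star \<in> almost_classical_operations E K L"
  shows "regular_stable_subgroup E K L (right_translation star ` \<Omega>)"
proof -
  note D = almost_classical_operationD[OF star]
  interpret B: group "additive_group star" by (fact D(2))
  let ?R = "right_translation star"
  let ?i = "\<lambda>y. inv\<^bsub>additive_group star\<^esub> y"
  have closed: "star x y \<in> \<Omega>" if "x \<in> \<Omega>" "y \<in> \<Omega>" for x y
    using B.m_closed[of x y] that by simp
  have assoc: "star (star x y) z = star x (star y z)" if "x \<in> \<Omega>" "y \<in> \<Omega>" "z \<in> \<Omega>" for x y z
    using B.m_assoc[of x y z] that by simp
  have i: "?i y \<in> \<Omega>" "star y (?i y) = base" "star (?i y) y = base" if "y \<in> \<Omega>" for y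
    using B.inv_closed[of y] B.r_inv[of y] B.l_inv[of y] that by auto
  have one: "star x base = x" "star base x = x" if "x \<in> \<Omega>" for x
    using B.r_one[of x] B.l_one[of x] that by auto
  have R_apply: "?R y x = star x y" if "x \<in> \<Omega>" for x y
    using that by (simp add: right_translation_def)
  have R_perm: "?R y \<in> carrier P" if y: "y \<in> \<Omega>" for y
  proof -
    have "bij_betw (?R y) \<Omega> \<Omega>"
      using y i[OF y] by (intro bij_betwI[where g = "?R (?i y)"])
        (auto simp: R_apply closed assoc one)
    then show ?thesis by (simp add: BijGroup_def Bij_def right_translation_def)
  qed
  have R_mult: "?R y \<otimes>\<^bsub>P\<^esub> ?R z = ?R (star z y)" if "y \<in> \<Omega>" "z \<in> \<Omega>" for y z
    using that by (intro perm_eqI) (auto simp: R_perm closed perm_mult_apply R_apply assoc)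
  have R_one: "?R base = \<one>\<^bsub>P\<^esub>"
    by (intro perm_eqI) (auto simp: R_perm R_apply one perm_one_apply)
  have R_inv: "inv\<^bsub>P\<^esub> (?R y) = ?R (?i y)" if "y \<in> \<Omega>" for y
    using that by (intro P.inv_equality) (simp_all add: R_mult R_perm R_one i)
  show ?thesis
    unfolding regular_stable_subgroup_def
  proof (intro conjI ballI)
    show "subgroup (?R ` \<Omega>) P"
    proof (rule P.subgroupI)
      show "?R ` \<Omega> \<noteq> {}" using base_mem by blast
    qed (auto simp: R_perm R_inv R_mult i closed)
  next
    fix C D assume C: "C \<in> \<Omega>" and D: "D \<in> \<Omega>"
    show "\<exists>!n. n \<in> ?R ` \<Omega> \<and> n C = D"
    proof (rule ex1I[of _ "?R (star (?i C) D)"])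
      show "?R (star (?i C) D) \<in> ?R ` \<Omega> \<and> ?R (star (?i C) D) C = D"
        using C D i[OF C] by (simp add: R_apply closed assoc[symmetric] one)
      fix n assume "n \<in> ?R ` \<Omega> \<and> n C = D"
      then obtain y where y: "y \<in> \<Omega>" "n = ?R y" "star C y = D" using C by (auto simp: R_apply)
      then have "y = star (?i C) D"
        using C i[OF C] assoc[of "?i C" C y] by (simp add: one)
      then show "n = ?R (star (?i C) D)" using y by simp
    qed
  next
    fix g n assume g: "g \<in> carrier G" and "n \<in> ?R ` \<Omega>"
    then obtain y where y: "y \<in> \<Omega>" "n = ?R y" by auto
    let ?z = "star (?i (\<tau> g base)) (\<tau> g y)"
    have z: "?z \<in> \<Omega>" using g y by (simp add: closed i)
    have "\<tau> g \<otimes>\<^bsub>P\<^esub> n \<otimes>\<^bsub>P\<^esub> inv\<^bsub>P\<^esub> (\<tau> g) = ?R ?z"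
    proof (rule perm_eqI)
      fix C assume C: "C \<in> \<Omega>"
      define x where "x = (inv\<^bsub>P\<^esub> (\<tau> g)) C"
      have x: "x \<in> \<Omega>" "\<tau> g x = C"
        using C translation_perm[OF g] by (auto simp: x_def perm_closed perm_inv_apply)
      have "(\<tau> g \<otimes>\<^bsub>P\<^esub> n \<otimes>\<^bsub>P\<^esub> inv\<^bsub>P\<^esub> (\<tau> g)) C = \<tau> g (star x y)"
        using C x(1) y translation_perm[OF g] R_perm[OF y(1)]
        by (simp add: perm_mult_apply x_def[symmetric] R_apply)
      also have "\<dots> = ?R ?z C"
        using D(3)[OF g x(1) y(1)] x C g y(1) by (simp add: R_apply assoc i)
      finally show "(\<tau> g \<otimes>\<^bsub>P\<^esub> n \<otimes>\<^bsub>P\<^esub> inv\<^bsub>P\<^esub> (\<tau> g)) C = ?R ?z C" .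
    qed (use y z translation_perm[OF g] R_perm in auto)
    then show "\<tau> g \<otimes>\<^bsub>P\<^esub> n \<otimes>\<^bsub>P\<^esub> inv\<^bsub>P\<^esub> (\<tau> g) \<in> ?R ` \<Omega>" using z by simp
  qed
qed

text \<open>Left translations by elements of \<open>H\<close> are left multiplications of the operation, and the
  permutations that commute with all left multiplications are the right multiplications.\<close>

lemma right_translations_eq_lambda_opp:
  assumes star: "star \<in> almost_classical_operations E K L"
    and H: "normal_complement G S H"
      "\<And>h k. h \<in> H \<Longrightarrow> k \<in> H \<Longrightarrow> star (\<tau> h base) (\<tau> k base) = \<tau> (h \<otimes>\<^bsub>G\<^esub> k) base"
  shows "right_translation star ` \<Omega> = lambda_opp E K L H"
proof -
  note D = almost_classical_operationD[OF star]
  interpret B: group "additive_group star" by (fact D(2))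
  have closed: "star x y \<in> \<Omega>" if "x \<in> \<Omega>" "y \<in> \<Omega>" for x y
    using B.m_closed[of x y] that by simp
  have assoc: "star (star x y) z = star x (star y z)" if "x \<in> \<Omega>" "y \<in> \<Omega>" "z \<in> \<Omega>" for x y z
    using B.m_assoc[of x y z] that by simp
  have one: "star base x = x" "star x base = x" if "x \<in> \<Omega>" for x
    using B.l_one[of x] B.r_one[of x] that by auto
  have HG: "h \<in> carrier G" if "h \<in> H" for h using H(1) that by (rule complement_carrier)
  have left: "\<tau> h x = star (\<tau> h base) x" if h: "h \<in> H" and x: "x \<in> \<Omega>" for h x
  proof -
    obtain k where k: "k \<in> H" "x = \<tau> k base" using complement_transitive[OF H(1) x] .
    then show ?thesis using H(2)[OF h k(1)] HG h by (simp add: X.act_mult)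
  qed
  have R_perm: "right_translation star y \<in> carrier P" if "y \<in> \<Omega>" for y
  proof -
    have "subgroup (right_translation star ` \<Omega>) P"
      using right_translations_regular_stable[OF star] by (simp add: regular_stable_subgroup_def)
    then show ?thesis by (rule subgroup.mem_carrier) (use that in simp)
  qed
  show ?thesis
  proof
    show "right_translation star ` \<Omega> \<subseteq> lambda_opp E K L H"
    proof
      fix n assume "n \<in> right_translation star ` \<Omega>"
      then obtain y where y: "y \<in> \<Omega>" "n = right_translation star y" by auto
      have "\<tau> h \<otimes>\<^bsub>P\<^esub> n = n \<otimes>\<^bsub>P\<^esub> \<tau> h" if h: "h \<in> H" for h
      proof (rule perm_eqI)
        fix C assume C: "C \<in> \<Omega>"
        show "(\<tau> h \<otimes>\<^bsub>P\<^esub> n) C = (n \<otimes>\<^bsub>P\<^esub> \<tau> h) C"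
          using C y R_perm[OF y(1)] translation_perm[OF HG[OF h]] HG[OF h]
            left[OF h closed[OF C y(1)]] left[OF h C]
          by (simp add: perm_mult_apply right_translation_def closed assoc)
      qed (use y R_perm translation_perm[OF HG[OF h]] in auto)
      then show "n \<in> lambda_opp E K L H"
        using y R_perm by (simp add: lambda_opp_def)
    qed
    show "lambda_opp E K L H \<subseteq> right_translation star ` \<Omega>"
    proof
      fix n assume "n \<in> lambda_opp E K L H"
      then have n: "n \<in> carrier P" "\<And>h. h \<in> H \<Longrightarrow> \<tau> h \<otimes>\<^bsub>P\<^esub> n = n \<otimes>\<^bsub>P\<^esub> \<tau> h"
        by (auto simp: lambda_opp_def)
      have nb: "n base \<in> \<Omega>" using n(1) by (simp add: perm_closed)
      have "n = right_translation star (n base)"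
      proof (rule perm_eqI[OF n(1) R_perm[OF nb]])
        fix C assume C: "C \<in> \<Omega>"
        obtain h where h: "h \<in> H" "C = \<tau> h base" using complement_transitive[OF H(1) C] .
        have "n C = \<tau> h (n base)"
          using fun_cong[OF n(2)[OF h(1)], of base] n(1) translation_perm[OF HG[OF h(1)]] h
          by (simp add: perm_mult_apply)
        also have "\<dots> = right_translation star (n base) C"
          using left[OF h(1) nb] C h(2) by (simp add: right_translation_def)
        finally show "n C = right_translation star (n base) C" .
      qed
      then show "n \<in> right_translation star ` \<Omega>" using nb by blast
    qed
  qed
qed

text \<open>The right multiplication by \<open>y\<close> is the one that takes the base coset to \<open>y\<close>.\<close>

lemma right_translation_inject:
  assumes star: "star \<in> almost_classical_operations E K L"
    and star': "star' \<in> almost_classical_operations E K L"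
    and eq: "right_translation star ` \<Omega> = right_translation star' ` \<Omega>"
  shows "star = star'"
proof -
  note D = almost_classical_operationD[OF star] and D' = almost_classical_operationD[OF star']
  have one: "star base x = x" if "x \<in> \<Omega>" for x
    using group.is_monoid[OF D(2)] monoid.l_one[of "additive_group star" x] that by simp
  have one': "star' base x = x" if "x \<in> \<Omega>" for x
    using group.is_monoid[OF D'(2)] monoid.l_one[of "additive_group star'" x] that by simp
  have val: "star x y = star' x y" if x: "x \<in> \<Omega>" and y: "y \<in> \<Omega>" for x y
  proof -
    have "right_translation star y \<in> right_translation star' ` \<Omega>" using eq y by blast
    then obtain y' where y': "y' \<in> \<Omega>" "right_translation star y = right_translation star' y'" by auto
    have "y = y'"
      using fun_cong[OF y'(2), of base] y y'(1) by (simp add: right_translation_def one one')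
    then show ?thesis
      using fun_cong[OF y'(2), of x] x by (simp add: right_translation_def)
  qed
  show ?thesis
  proof (rule PiE_ext[OF D(1) D'(1)])
    fix x assume x: "x \<in> \<Omega>"
    show "star x = star' x"
      using D(1) D'(1) x val by (intro PiE_ext[of "star x" \<Omega> "\<lambda>_. \<Omega>" "star' x"]) auto
  qed
qed

end

context regular_stable
begin

definition elem_to where "elem_to y = (THE n. n \<in> N \<and> n base = y)"

lemma elem_to: "y \<in> \<Omega> \<Longrightarrow> elem_to y \<in> N" "y \<in> \<Omega> \<Longrightarrow> elem_to y base = y"
  using theI'[OF regular[OF base_mem, of y]] by (auto simp: elem_to_def)

lemma elem_to_eqI: "n \<in> N \<Longrightarrow> n base = y \<Longrightarrow> elem_to y = n"
  using elem_to[of y] by (auto intro!: regular_eqI[of _ _ base])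

definition operation where "operation = (\<lambda>x\<in>\<Omega>. \<lambda>y\<in>\<Omega>. elem_to y x)"

lemma operation_apply [simp]: "x \<in> \<Omega> \<Longrightarrow> y \<in> \<Omega> \<Longrightarrow> operation x y = elem_to y x"
  by (simp add: operation_def)

lemma elem_to_apply_closed [simp]: "x \<in> \<Omega> \<Longrightarrow> y \<in> \<Omega> \<Longrightarrow> elem_to y x \<in> \<Omega>"
  by (simp add: elem_to)

lemma elem_to_elem_to: "y \<in> \<Omega> \<Longrightarrow> z \<in> \<Omega> \<Longrightarrow> elem_to (elem_to z y) = elem_to z \<otimes>\<^bsub>P\<^esub> elem_to y"
  by (intro elem_to_eqI) (simp_all add: elem_to perm_mult_apply)

lemma group_operation: "group (additive_group operation)"
proof (rule groupI)
  fix x assume "x \<in> carrier (additive_group operation)"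
  then have x: "x \<in> \<Omega>" by simp
  then show "\<exists>y\<in>carrier (additive_group operation).
      y \<otimes>\<^bsub>additive_group operation\<^esub> x = \<one>\<^bsub>additive_group operation\<^esub>"
    using elem_to[OF x] by (intro bexI[of _ "(inv\<^bsub>P\<^esub> (elem_to x)) base"]) (simp_all add: perm_inv_apply)
qed (auto simp: elem_to elem_to_elem_to perm_mult_apply)

text \<open>Both sides of the bracoid law are values at \<open>\<tau> g x\<close> of elements of \<open>N\<close>: on the left a conjugate by
  \<open>\<tau> g\<close>, on the right a product. These agree at \<open>\<tau> g base\<close>, hence everywhere.\<close>

lemma skew_bracoid_operation: "skew_bracoid G (additive_group operation) \<tau>"
  unfolding skew_bracoid_def
proof (intro conjI ballI)
  show "group G" by (rule G.group_axioms)
  show "group (additive_group operation)" by (rule group_operation)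
  have "\<tau> \<in> hom G P"
    by (auto simp: hom_def translation_perm translation_mult)
  then show "transitive_action G (carrier (additive_group operation)) \<tau>"
  proof (intro transitive_action.intro transitive_action_axioms.intro)
    assume "\<tau> \<in> hom G P"
    then show "group_action G (carrier (additive_group operation)) \<tau>"
      by (simp add: group_action_def group_hom_def group_hom_axioms_def group_BijGroup G.group_axioms)
  next
    fix x y assume "x \<in> carrier (additive_group operation)" "y \<in> carrier (additive_group operation)"
    then have xy: "x \<in> \<Omega>" "y \<in> \<Omega>" by auto
    obtain g where g: "g \<in> carrier G" "x = \<tau> g base" using xy(1) by (rule coset_as_translate)
    obtain h where h: "h \<in> carrier G" "y = \<tau> h base" using xy(2) by (rule coset_as_translate)
    have "\<tau> (h \<otimes>\<^bsub>G\<^esub> inv\<^bsub>G\<^esub> g) x = y" using g h by (simp add: X.act_mult)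
    then show "\<exists>g\<in>carrier G. \<tau> g x = y" using g h by (intro bexI[of _ "h \<otimes>\<^bsub>G\<^esub> inv\<^bsub>G\<^esub> g"]) auto
  qed
  interpret B: group "additive_group operation" by (rule group_operation)
  fix g x y assume g: "g \<in> carrier G" and "x \<in> carrier (additive_group operation)"
    "y \<in> carrier (additive_group operation)"
  then have x: "x \<in> \<Omega>" and y: "y \<in> \<Omega>" by auto
  define u where "u = inv\<^bsub>additive_group operation\<^esub> (\<tau> g base)"
  have u: "u \<in> \<Omega>" "elem_to u (\<tau> g base) = base"
    using B.inv_closed[of "\<tau> g base"] B.r_inv[of "\<tau> g base"] g by (auto simp: u_def)
  have "conj g (elem_to y) = elem_to (\<tau> g y) \<otimes>\<^bsub>P\<^esub> elem_to u"
  proof (rule regular_eqI[of _ _ "\<tau> g base"])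
    show "conj g (elem_to y) (\<tau> g base) = (elem_to (\<tau> g y) \<otimes>\<^bsub>P\<^esub> elem_to u) (\<tau> g base)"
      using g y u elem_to by (simp add: conj_apply_translation perm_mult_apply)
  qed (use g y u elem_to in auto)
  then have "\<tau> g (elem_to y x) = elem_to (\<tau> g y) (elem_to u (\<tau> g x))"
    using conj_apply_translation[OF g elem_to(1)[OF y] x] g x y u elem_to
    by (simp add: perm_mult_apply)
  then show "\<tau> g (x \<otimes>\<^bsub>additive_group operation\<^esub> y) =
      \<tau> g x \<otimes>\<^bsub>additive_group operation\<^esub> inv\<^bsub>additive_group operation\<^esub> (\<tau> g \<one>\<^bsub>additive_group operation\<^esub>)
      \<otimes>\<^bsub>additive_group operation\<^esub> \<tau> g y"
    using g x y u by (simp add: u_def[symmetric])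
qed

text \<open>The operation multiplies by \<open>\<tau> k base\<close> on the right by means of an element of \<open>N\<close>, which commutes
  with left translation by \<open>h\<close>.\<close>

lemma operation_almost_classical:
  assumes H: "normal_complement G S H" and N: "N = lambda_opp E K L H"
  shows "operation \<in> almost_classical_operations E K L"
  unfolding almost_classical_operations_def almost_classical_bracoid_def
proof (intro CollectI conjI exI[of _ H] ballI)
  show "operation \<in> \<Omega> \<rightarrow>\<^sub>E \<Omega> \<rightarrow>\<^sub>E \<Omega>" by (auto simp: operation_def)
  show "skew_bracoid G (additive_group operation) \<tau>" by (rule skew_bracoid_operation)
  show "normal_complement G (stabilizer G \<tau> \<one>\<^bsub>additive_group operation\<^esub>) H"
    using H by (simp add: stabilizer_base)
  fix h k assume h: "h \<in> H" and k: "k \<in> H"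
  have hG: "h \<in> carrier G" "k \<in> carrier G" using complement_carrier[OF H] h k by auto
  let ?n = "elem_to (\<tau> k base)"
  have n: "?n \<in> N" using hG by (intro elem_to) simp
  then have "\<tau> h \<otimes>\<^bsub>P\<^esub> ?n = ?n \<otimes>\<^bsub>P\<^esub> \<tau> h"
    using h unfolding N lambda_opp_def by blast
  from fun_cong[OF this, of base] have "?n (\<tau> h base) = \<tau> h (?n base)"
    using n hG translation_perm by (simp add: perm_mult_apply)
  then show "\<tau> h \<one>\<^bsub>additive_group operation\<^esub> \<otimes>\<^bsub>additive_group operation\<^esub> \<tau> k \<one>\<^bsub>additive_group operation\<^esub> =
      \<tau> (h \<otimes>\<^bsub>G\<^esub> k) \<one>\<^bsub>additive_group operation\<^esub>"
    using hG by (simp add: elem_to X.act_mult)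
qed

lemma right_translations_operation: "right_translation operation ` \<Omega> = N"
proof -
  have eq: "right_translation operation y = elem_to y" if "y \<in> \<Omega>" for y
  proof
    fix x
    show "right_translation operation y x = elem_to y x"
    proof (cases "x \<in> \<Omega>")
      case False
      have "elem_to y \<in> extensional \<Omega>"
        using N_P[OF elem_to(1)[OF that]] by (simp add: BijGroup_def Bij_def)
      then show ?thesis using False by (simp add: right_translation_def extensional_def)
    qed (simp add: right_translation_def that)
  qed
  have "elem_to (n base) = n" if "n \<in> N" for n using that by (intro elem_to_eqI) auto
  then have "n \<in> elem_to ` \<Omega>" if "n \<in> N" for n using that by (metis N_closed base_mem imageI)
  then show ?thesis using eq elem_to(1) by (auto simp: image_iff)
qed

end

section \<open>The correspondence\<close>

context intermediate_field
begin

definition structure_class where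
  "structure_class star = iso_rel E K L `` {greither_pareigis E K L (right_translation star ` \<Omega>)}"

lemma gp_almost_classical:
  assumes "regular_stable_subgroup E K L N" "normal_complement G S H" "N = lambda_opp E K L H"
  shows "greither_pareigis E K L N \<in> almost_classical_hopf_galois E K L"
proof -
  interpret regular_stable E K L N by unfold_locales (fact assms(1))
  show ?thesis
    unfolding almost_classical_hopf_galois_def
    using hopf_galois_structure_gp hopf_galois_isomorphic_refl assms by blast
qed

text \<open>Isomorphic structures have the same class only because isomorphism is symmetric and transitive on
  Hopf-Galois structures; this identifies the class of an arbitrary almost classical structure with
  the class of \<open>E[N]\<^sup>G\<close>.\<close>

lemma bij_betw_structure_class:
  "bij_betw structure_class (almost_classical_operations E K L)
    (almost_classical_hopf_galois E K L // iso_rel E K L)"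
  unfolding bij_betw_def
proof (intro conjI equalityI subsetI)
  have struct: "hopf_galois_structure E K L (greither_pareigis E K L (right_translation star ` \<Omega>))"
    if "star \<in> almost_classical_operations E K L" for star
  proof -
    interpret regular_stable E K L "right_translation star ` \<Omega>"
      by unfold_locales (rule right_translations_regular_stable[OF that])
    show ?thesis by (rule hopf_galois_structure_gp)
  qed
  show "inj_on structure_class (almost_classical_operations E K L)"
  proof (rule inj_onI)
    fix star star' assume star: "star \<in> almost_classical_operations E K L"
      and star': "star' \<in> almost_classical_operations E K L"
      and eq: "structure_class star = structure_class star'"
    let ?A = "greither_pareigis E K L (right_translation star ` \<Omega>)"
    let ?B = "greither_pareigis E K L (right_translation star' ` \<Omega>)"
    have "?B \<in> structure_class star'"
      using struct[OF star'] hopf_galois_isomorphic_refl by (auto simp: structure_class_def iso_rel_def)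
    then have "hopf_galois_isomorphic E K L ?A ?B"
      unfolding eq[symmetric] by (simp add: structure_class_def iso_rel_def)
    then show "star = star'"
      using star star' right_translations_regular_stable
      by (intro right_translation_inject greither_pareigis_inject) auto
  qed
  fix T assume "T \<in> structure_class ` almost_classical_operations E K L"
  then obtain star where star: "star \<in> almost_classical_operations E K L" "T = structure_class star"
    by auto
  obtain H where H: "normal_complement G S H"
    "\<And>h k. h \<in> H \<Longrightarrow> k \<in> H \<Longrightarrow> star (\<tau> h base) (\<tau> k base) = \<tau> (h \<otimes>\<^bsub>G\<^esub> k) base"
    using almost_classical_operationD(4)[OF star(1)] by blast
  have "greither_pareigis E K L (right_translation star ` \<Omega>) \<in> almost_classical_hopf_galois E K L"
    using right_translations_regular_stable[OF star(1)] H(1)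
      right_translations_eq_lambda_opp[OF star(1) H] by (rule gp_almost_classical)
  then show "T \<in> almost_classical_hopf_galois E K L // iso_rel E K L"
    unfolding star(2) structure_class_def by (rule quotientI)
next
  fix T assume "T \<in> almost_classical_hopf_galois E K L // iso_rel E K L"
  then obtain A where A: "A \<in> almost_classical_hopf_galois E K L" "T = iso_rel E K L `` {A}"
    by (rule quotientE)
  then obtain N H where NH: "regular_stable_subgroup E K L N"
    "hopf_galois_isomorphic E K L A (greither_pareigis E K L N)"
    "normal_complement G S H" "N = lambda_opp E K L H" and str: "hopf_galois_structure E K L A"
    unfolding almost_classical_hopf_galois_def by blast
  interpret regular_stable E K L N by unfold_locales (fact NH(1))
  note gp = hopf_galois_structure_gp
  have "hopf_galois_isomorphic E K L (greither_pareigis E K L N) A"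
    by (rule hopf_galois_isomorphic_sym[OF str gp NH(2)])
  then have "T = iso_rel E K L `` {greither_pareigis E K L N}"
    using str gp NH(2) hopf_galois_isomorphic_trans unfolding A(2) iso_rel_def by blast
  also have "\<dots> = structure_class operation"
    by (simp add: structure_class_def right_translations_operation)
  finally show "T \<in> structure_class ` almost_classical_operations E K L"
    using operation_almost_classical[OF NH(3,4)] by blast
qed

end

theorem theorem5p3:
  fixes E :: "('a, 'm) ring_scheme" and K L :: "'a set"
  assumes "field E" and "subfield K E" and "subfield L E" and "K \<subseteq> L"
    and "ring.finite_dimension E K L"
    and "separable_in E K L"
    and "galois_closure E K L"
  shows "\<exists>\<Phi>. bij_betw \<Phi> (almost_classical_operations E K L)
    (almost_classical_hopf_galois E K L // iso_rel E K L)"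
proof -
  interpret intermediate_field E K L
    using assms(1,3,4,7)
    by (intro intermediate_field.intro galois_extension.intro galois_extension_axioms.intro
        intermediate_field_axioms.intro) (simp_all add: galois_closure_def)
  show ?thesis using bij_betw_structure_class by blast
qed

end
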